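(* Assume that $\underline s=(s_{ij})$ is generic. Then a basis over $\mathbb Q^{\mathrm{dR}}_{\underline s}$ of the algebraic de Rham cohomology group $H^n(\mathcal M_{0,n+3},\nabla_{\underline s})$ is provided by the classes of the differential forms $$\frac{dt_1\wedge\dots\wedge dt_n}{\prod_{k=1}^{n+1}(t_{\sigma(k)}-t_{\sigma(k-1)})}$$ for permutations $\sigma\in\Sigma_n$ of $\{1,\dots,n\}$, where $t_{\sigma(0)}=0$ and $t_{\sigma(n+1)}=1$.
   Context: $\mathcal M_{0,n+3}$ is the moduli space over $\mathbb{Q}$ of $N=n+3$ distinct points $p_1,\dots,p_N$ on $\mathbb P^1$ modulo $\mathrm{PGL}_2$. Simplicial coordinates $t_1,\dots,t_n$ are obtained by normalising $p_{n+1}=1$, $p_{n+2}=\infty$, $p_{n+3}=0$ and $t_i=p_i$; thus $\mathcal M_{0,n+3}$ is the complement in $\mathbb A^n$ of the hyperplanes $t_i=0$, $t_i=1$, $t_i=t_j$. Put $t_0=0$, $t_{n+1}=1$. $\underline s=(s_{ij})_{1\le i,j\le N}$ are complex numbers with $s_{ij}=s_{ji}$, $s_{ii}=0$ and $\sum_js_{ij}=0$ for all $i$; put $s_{0j}=s_{j,n+3}$. $\underline s$ is *generic* if $\sum_{i<j;\,i,j\in I}s_{ij}\notin\mathbb Z$ for every $I\subset\{1,\dots,N\}$ with $|I|\ge2$ and $|\{1,\dots,N\}\setminus I|\ge2$. $\mathbb Q^{\mathrm{dR}}_{\underline s}=\mathbb Q(s_{ij})\subset\mathbb C$. $\nabla_{\underline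 s}=d+\omega_{\underline s}$ is the integrable connection on the structure sheaf of $\mathcal M_{0,n+3}\times_{\mathbb Q}\mathbb Q^{\mathrm{dR}}_{\underline s}$ with $\omega_{\underline s}=\sum_{0\le i<j\le n+1}s_{ij}\,d\log(t_j-t_i)$. *)

theory Defs
  imports
    "Jordan_Normal_Form.Missing_VectorSpace"
    "HOL-Algebra.Algebraic_Closure_Type"
    "HOL-Algebra.Generated_Fields"
    "HOL-Library.Poly_Mapping"
    "HOL-Computational_Algebra.Fraction_Field"
    "HOL-Combinatorics.Permutations"
    "HOL.Complex"
begin

section \<open>Polynomials and rational functions in the simplicial coordinates\<close>

text \<open>
  Polynomials in variables indexed by \<open>nat\<close>, as finitely supported functions on exponent vectors.
  The coordinate ring of the scheme over a subfield \<open>K\<close> of the complex numbers is realised inside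
  the field of rational functions with complex coefficients, by restricting the coefficients to \<open>K\<close>.
\<close>

type_synonym cpoly = "(nat \<Rightarrow>\<^sub>0 nat) \<Rightarrow>\<^sub>0 complex"
type_synonym cratfun = "cpoly fract"

definition poly_deriv :: "nat \<Rightarrow> cpoly \<Rightarrow> cpoly" where
  "poly_deriv i p =
     (\<Sum>m\<in>Poly_Mapping.keys p. Poly_Mapping.single (m - Poly_Mapping.single i 1)
                     (of_nat (Poly_Mapping.lookup m i) * Poly_Mapping.lookup p m))"

lemma sum_single_lookup:
  fixes p :: cpoly
  shows "(\<Sum>m\<in>Poly_Mapping.keys p. Poly_Mapping.single m (Poly_Mapping.lookup p m)) = p"
proof (rule poly_mapping_eqI)
  fix k
  have "Poly_Mapping.lookup (\<Sum>m\<in>Poly_Mapping.keys p. Poly_Mapping.single m (Poly_Mapping.lookup p m)) k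
      = (\<Sum>m\<in>Poly_Mapping.keys p. if m = k then Poly_Mapping.lookup p m else 0)"
    by (simp add: lookup_sum lookup_single when_def)
  also have "\<dots> = Poly_Mapping.lookup p k"
    by (simp add: in_keys_iff)
  finally show "Poly_Mapping.lookup (\<Sum>m\<in>Poly_Mapping.keys p.
      Poly_Mapping.single m (Poly_Mapping.lookup p m)) k = Poly_Mapping.lookup p k" .
qed

lemma poly_deriv_superset:
  assumes "finite A" "Poly_Mapping.keys p \<subseteq> A"
  shows "poly_deriv i p =
     (\<Sum>m\<in>A. Poly_Mapping.single (m - Poly_Mapping.single i 1)
                     (of_nat (Poly_Mapping.lookup m i) * Poly_Mapping.lookup p m))"
  unfolding poly_deriv_def
  by (rule sum.mono_neutral_left) (use assms in \<open>auto simp: in_keys_iff\<close>)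

lemma poly_deriv_add: "poly_deriv i (p + q) = poly_deriv i p + poly_deriv i q"
proof -
  let ?A = "Poly_Mapping.keys p \<union> Poly_Mapping.keys q"
  have "poly_deriv i (p + q) =
     (\<Sum>m\<in>?A. Poly_Mapping.single (m - Poly_Mapping.single i 1)
                     (of_nat (Poly_Mapping.lookup m i) * Poly_Mapping.lookup (p + q) m))"
    by (rule poly_deriv_superset) (simp_all add: Poly_Mapping.keys_add)
  also have "\<dots> = poly_deriv i p + poly_deriv i q"
    by (simp add: poly_deriv_superset[of ?A p] poly_deriv_superset[of ?A q] lookup_add
        distrib_left single_add sum.distrib)
  finally show ?thesis .
qed

lemma poly_deriv_0 [simp]: "poly_deriv i 0 = 0"
  by (simp add: poly_deriv_def)

lemma poly_deriv_sum: "poly_deriv i (sum f A) = (\<Sum>a\<in>A. poly_deriv i (f a))"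
  by (induction A rule: infinite_finite_induct) (simp_all add: poly_deriv_add)

lemma poly_deriv_single:
  "poly_deriv i (Poly_Mapping.single m c) =
     Poly_Mapping.single (m - Poly_Mapping.single i 1) (of_nat (Poly_Mapping.lookup m i) * c)"
  by (cases "c = 0") (simp_all add: poly_deriv_def)

lemma poly_deriv_mult_single:
  "poly_deriv i (Poly_Mapping.single m c * Poly_Mapping.single l d) =
     poly_deriv i (Poly_Mapping.single m c) * Poly_Mapping.single l d
     + Poly_Mapping.single m c * poly_deriv i (Poly_Mapping.single l d)"
proof -
  let ?e = "Poly_Mapping.single i (1::nat)"
  have *: "a - ?e + b = a + b - ?e" if "Poly_Mapping.lookup a i \<noteq> 0" for a b :: "nat \<Rightarrow>\<^sub>0 nat"
    by (rule poly_mapping_eqI)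
      (use that in \<open>auto simp: lookup_add lookup_minus lookup_single when_def\<close>)
  have 1: "Poly_Mapping.single (m - ?e + l) (of_nat (Poly_Mapping.lookup m i) * c * d) =
           Poly_Mapping.single (m + l - ?e) (of_nat (Poly_Mapping.lookup m i) * c * d)"
    using *[of m l] by (cases "Poly_Mapping.lookup m i = 0") simp_all
  have 2: "Poly_Mapping.single (m + (l - ?e)) (c * (of_nat (Poly_Mapping.lookup l i) * d)) =
           Poly_Mapping.single (m + l - ?e) (c * (of_nat (Poly_Mapping.lookup l i) * d))"
    using *[of l m] by (cases "Poly_Mapping.lookup l i = 0") (simp_all add: add.commute)
  show ?thesis
    by (simp only: poly_deriv_single mult_single 1 2 lookup_add flip: single_add)
      (simp add: algebra_simps)
qed

lemma poly_deriv_mult: "poly_deriv i (p * q) = poly_deriv i p * q + p * poly_deriv i q"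
proof -
  let ?s = "\<lambda>p m. Poly_Mapping.single m (Poly_Mapping.lookup p m)"
  have p: "p = (\<Sum>m\<in>Poly_Mapping.keys p. ?s p m)" and q: "q = (\<Sum>l\<in>Poly_Mapping.keys q. ?s q l)"
    by (simp_all add: sum_single_lookup)
  have dp: "poly_deriv i p = (\<Sum>m\<in>Poly_Mapping.keys p. poly_deriv i (?s p m))"
    and dq: "poly_deriv i q = (\<Sum>l\<in>Poly_Mapping.keys q. poly_deriv i (?s q l))"
    by (simp_all add: sum_single_lookup flip: poly_deriv_sum)
  have "poly_deriv i (p * q) =
      poly_deriv i ((\<Sum>m\<in>Poly_Mapping.keys p. ?s p m) * (\<Sum>l\<in>Poly_Mapping.keys q. ?s q l))"
    using p q by simp
  also have "\<dots> = (\<Sum>m\<in>Poly_Mapping.keys p. poly_deriv i (?s p m)) * (\<Sum>l\<in>Poly_Mapping.keys q. ?s q l)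
        + (\<Sum>m\<in>Poly_Mapping.keys p. ?s p m) * (\<Sum>l\<in>Poly_Mapping.keys q. poly_deriv i (?s q l))"
    by (simp only: sum_product poly_deriv_sum poly_deriv_mult_single sum.distrib)
  also have "\<dots> = poly_deriv i p * q + p * poly_deriv i q"
    using p q dp dq by simp
  finally show ?thesis .
qed

text \<open>The partial derivative with respect to the \<open>i\<close>-th variable, extended by the quotient rule.\<close>

definition ratfun_deriv :: "nat \<Rightarrow> cratfun \<Rightarrow> cratfun" where
  "ratfun_deriv i f = (THE g. \<exists>a b. b \<noteq> 0 \<and> f = Fract a b \<and>
     g = Fract (poly_deriv i a * b - a * poly_deriv i b) (b * b))"

lemma ratfun_deriv_Fract:
  assumes "b \<noteq> 0"
  shows "ratfun_deriv i (Fract a b) = Fract (poly_deriv i a * b - a * poly_deriv i b) (b * b)"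
  unfolding ratfun_deriv_def
proof (rule the_equality)
  fix g
  let ?D = "poly_deriv i"
  assume "\<exists>c d. d \<noteq> 0 \<and> Fract a b = Fract c d \<and> g = Fract (?D c * d - c * ?D d) (d * d)"
  then obtain c d where d: "d \<noteq> 0" and ab: "Fract a b = Fract c d"
    and g: "g = Fract (?D c * d - c * ?D d) (d * d)"
    by blast
  have e: "a * d = c * b"
    using ab assms d by (simp add: eq_fract)
  have "?D a * d + a * ?D d = ?D c * b + c * ?D b"
    using arg_cong[OF e, of ?D] by (simp add: poly_deriv_mult)
  then have D: "?D c * b = ?D a * d + a * ?D d - c * ?D b"
    by simp
  have "(?D c * d - c * ?D d) * (b * b) = (?D c * b) * (b * d) - (c * b) * (b * ?D d)"
    by (simp add: algebra_simps)
  also have "\<dots> = (?D a * d) * (b * d) - (c * b) * (?D b * d)"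
    by (simp only: D flip: e) (use e in \<open>simp add: algebra_simps\<close>)
  also have "\<dots> = (?D a * b - a * ?D b) * (d * d)"
    by (simp only: flip: e) (simp add: algebra_simps)
  finally have "(?D c * d - c * ?D d) * (b * b) = (?D a * b - a * ?D b) * (d * d)" .
  then show "g = Fract (?D a * b - a * ?D b) (b * b)"
    using assms d by (simp add: g eq_fract)
qed (use assms in blast)

definition ratfun_const :: "complex \<Rightarrow> cratfun" where
  "ratfun_const c = Fract (Poly_Mapping.single 0 c) 1"

text \<open>\<open>coord n i\<close> is \<open>t\<^sub>i\<close>, with the conventions \<open>t\<^sub>0 = 0\<close> and \<open>t\<^sub>n\<^sub>+\<^sub>1 = 1\<close>.\<close>

definition coord :: "nat \<Rightarrow> nat \<Rightarrow> cratfun" where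
  "coord n i = (if i = 0 then 0 else if i = n + 1 then 1
                else Fract (Poly_Mapping.single (Poly_Mapping.single i 1) 1) 1)"

section \<open>Algebraic differential forms on the moduli space\<close>

text \<open>
  The open subscheme of affine \<open>n\<close>-space where \<open>t\<^sub>i \<noteq> 0\<close>, \<open>t\<^sub>i \<noteq> 1\<close> and \<open>t\<^sub>i \<noteq> t\<^sub>j\<close> is the
  complement of the zero locus of \<open>discr n\<close> (whose factor for \<open>(0, n + 1)\<close> is 1), so its
  coordinate ring over \<open>K\<close> is the localisation of \<open>K[t\<^sub>1, \<dots>, t\<^sub>n]\<close> at \<open>discr n\<close>.
\<close>

definition discr :: "nat \<Rightarrow> cratfun" where
  "discr n = (\<Prod>(i, j)\<in>{(i, j). i < j \<and> j \<le> n + 1}. coord n j - coord n i)"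

definition poly_over :: "nat \<Rightarrow> complex set \<Rightarrow> cpoly set" where
  "poly_over n K = {p. (\<forall>m. Poly_Mapping.lookup p m \<in> K) \<and> (\<forall>m\<in>Poly_Mapping.keys p. Poly_Mapping.keys m \<subseteq> {1..n})}"

definition M0_coordinate_ring :: "nat \<Rightarrow> complex set \<Rightarrow> cratfun set" where
  "M0_coordinate_ring n K = {Fract p 1 / discr n ^ r |p r. p \<in> poly_over n K}"

text \<open>
  A differential form is given by its coefficients: \<open>\<alpha>\<close> stands for the sum of the \<open>\<alpha> I dt\<^sub>I\<close>, where
  \<open>dt\<^sub>I\<close> is the wedge product of the \<open>dt\<^sub>i\<close>, \<open>i \<in> I\<close>, in increasing order of \<open>i\<close>. The module of
  Kaehler differentials of the coordinate ring is free on the \<open>dt\<^sub>i\<close>.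
\<close>

type_synonym dform = "nat set \<Rightarrow> cratfun"

definition ext_deriv :: "dform \<Rightarrow> dform" where
  "ext_deriv \<alpha> = (\<lambda>J. \<Sum>j\<in>J. (-1) ^ card {i \<in> J. i < j} * ratfun_deriv j (\<alpha> (J - {j})))"

definition wedge :: "dform \<Rightarrow> dform \<Rightarrow> dform" where
  "wedge \<alpha> \<beta> = (\<lambda>J. \<Sum>I\<in>Pow J.
     (-1) ^ card {(i, j). i \<in> I \<and> j \<in> J - I \<and> j < i} * \<alpha> I * \<beta> (J - I))"

definition dlog :: "cratfun \<Rightarrow> dform" where
  "dlog f = (\<lambda>J. ext_deriv (\<lambda>I. if I = {} then f else 0) J / f)"

definition forms :: "nat \<Rightarrow> complex set \<Rightarrow> nat \<Rightarrow> dform set" where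
  "forms n K k = {\<alpha>. \<forall>I. if I \<subseteq> {1..n} \<and> card I = k then \<alpha> I \<in> M0_coordinate_ring n K
                           else \<alpha> I = 0}"

section \<open>The parameters and the connection\<close>

definition admissible :: "nat \<Rightarrow> (nat \<Rightarrow> nat \<Rightarrow> complex) \<Rightarrow> bool" where
  "admissible n s \<longleftrightarrow>
     (\<forall>i\<in>{1..n+3}. \<forall>j\<in>{1..n+3}. s i j = s j i) \<and>
     (\<forall>i\<in>{1..n+3}. s i i = 0) \<and>
     (\<forall>i\<in>{1..n+3}. (\<Sum>j\<in>{1..n+3}. s i j) = 0)"

definition generic :: "nat \<Rightarrow> (nat \<Rightarrow> nat \<Rightarrow> complex) \<Rightarrow> bool" where
  "generic n s \<longleftrightarrow>
     (\<forall>I. I \<subseteq> {1..n+3} \<and> card I \<ge> 2 \<and> card ({1..n+3} - I) \<ge> 2 \<longrightarrow>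
        (\<Sum>(i, j)\<in>{(i, j). i \<in> I \<and> j \<in> I \<and> i < j}. s i j) \<notin> \<int>)"

definition Q_dR :: "nat \<Rightarrow> (nat \<Rightarrow> nat \<Rightarrow> complex) \<Rightarrow> complex ring" where
  "Q_dR n s = ring_of_type_algebra
     \<lparr>carrier := generate_field ring_of_type_algebra {s i j |i j. i \<in> {1..n+3} \<and> j \<in> {1..n+3}}\<rparr>"

text \<open>The convention \<open>s\<^sub>0\<^sub>j = s\<^sub>j\<^sub>,\<^sub>n\<^sub>+\<^sub>3\<close>.\<close>

definition s0 :: "nat \<Rightarrow> (nat \<Rightarrow> nat \<Rightarrow> complex) \<Rightarrow> nat \<Rightarrow> nat \<Rightarrow> complex" where
  "s0 n s i j = (if i = 0 then s j (n + 3) else s i j)"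

definition omega :: "nat \<Rightarrow> (nat \<Rightarrow> nat \<Rightarrow> complex) \<Rightarrow> dform" where
  "omega n s = (\<lambda>J. \<Sum>(i, j)\<in>{(i, j). i < j \<and> j \<le> n + 1}.
     ratfun_const (s0 n s i j) * dlog (coord n j - coord n i) J)"

definition nabla :: "nat \<Rightarrow> (nat \<Rightarrow> nat \<Rightarrow> complex) \<Rightarrow> dform \<Rightarrow> dform" where
  "nabla n s \<alpha> = (\<lambda>J. ext_deriv \<alpha> J + wedge (omega n s) \<alpha> J)"

section \<open>Algebraic de Rham cohomology\<close>

text \<open>
  The scheme is affine, so its algebraic de Rham cohomology with coefficients in the connection is
  the cohomology of the complex of global sections. The \<^type>\<open>module\<close> records carry irrelevant
  multiplicative fields, which are left undefined.
\<close>

definition dR_forms ::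
  "nat \<Rightarrow> (nat \<Rightarrow> nat \<Rightarrow> complex) \<Rightarrow> nat \<Rightarrow> (complex, dform) module" where
  "dR_forms n s k = \<lparr>carrier = forms n (carrier (Q_dR n s)) k,
     monoid.mult = undefined, one = undefined,
     zero = (\<lambda>_. 0), add = (\<lambda>\<alpha> \<beta> I. \<alpha> I + \<beta> I),
     module.smult = (\<lambda>c \<alpha> I. ratfun_const c * \<alpha> I)\<rparr>"

definition dR_cocycles :: "nat \<Rightarrow> (nat \<Rightarrow> nat \<Rightarrow> complex) \<Rightarrow> nat \<Rightarrow> dform set" where
  "dR_cocycles n s k = a_kernel (dR_forms n s k) (dR_forms n s (k + 1)) (nabla n s)"

definition dR_coboundaries :: "nat \<Rightarrow> (nat \<Rightarrow> nat \<Rightarrow> complex) \<Rightarrow> nat \<Rightarrow> dform set" where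
  "dR_coboundaries n s k =
     (if k = 0 then {\<zero>\<^bsub>dR_forms n s k\<^esub>} else nabla n s ` carrier (dR_forms n s (k - 1)))"

definition dR_class ::
  "nat \<Rightarrow> (nat \<Rightarrow> nat \<Rightarrow> complex) \<Rightarrow> nat \<Rightarrow> dform \<Rightarrow> dform set" where
  "dR_class n s k \<alpha> = dR_coboundaries n s k +>\<^bsub>dR_forms n s k\<^esub> \<alpha>"

definition dR_cohomology ::
  "nat \<Rightarrow> (nat \<Rightarrow> nat \<Rightarrow> complex) \<Rightarrow> nat \<Rightarrow> (complex, dform set) module" where
  "dR_cohomology n s k = \<lparr>carrier = dR_class n s k ` dR_cocycles n s k,
     monoid.mult = undefined, one = undefined,
     zero = dR_coboundaries n s k, add = set_add (dR_forms n s k),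
     module.smult = (\<lambda>c A. \<Union>\<alpha>\<in>A. dR_class n s k (c \<odot>\<^bsub>dR_forms n s k\<^esub> \<alpha>))\<rparr>"

text \<open>
  A permutation \<open>\<sigma>\<close> of \<open>{1..n}\<close> fixes \<open>0\<close> and \<open>n + 1\<close>, so that \<open>coord n (\<sigma> 0) = 0\<close> and
  \<open>coord n (\<sigma> (n + 1)) = 1\<close>.
\<close>

definition cell_form :: "nat \<Rightarrow> (nat \<Rightarrow> nat) \<Rightarrow> dform" where
  "cell_form n \<sigma> = (\<lambda>I. if I = {1..n}
     then 1 / (\<Prod>k=1..n+1. coord n (\<sigma> k) - coord n (\<sigma> (k - 1))) else 0)"

end

theory Submission
  imports Defs "HOL-Library.Function_Algebras"
begin

text \<open>
  In top degree the cohomology is the cokernel of the commuting operators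
  \<open>\<partial>\<^sub>i + \<Sum>\<^sub>j s\<^sub>i\<^sub>j / (t\<^sub>i - t\<^sub>j)\<close> on the coordinate ring. Forget the last variable \<open>x\<close>. By partial
  fractions every element is congruent, modulo the operator in the direction \<open>x\<close>, to exactly one
  \<open>\<Sum>\<^sub>j u\<^sub>j / (x - t\<^sub>j)\<close> with \<open>\<Sum>\<^sub>j u\<^sub>j = 0\<close> and \<open>u\<^sub>j\<close> free of \<open>x\<close>, and the remaining operators act on such
  families \<open>u\<close> by a vector-valued system of the same Knizhnik-Zamolodchikov shape. So one inducts on
  the number of variables over all systems with matrix residues \<open>A\<^sub>i\<^sub>j\<close> such that no partial sum
  \<open>A\<^sub>I\<close> of residues, over the pairs in a set \<open>I\<close> of points, has an integral eigenvalue; this is inherited, because the partial sum over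
  \<open>I\<close> of the induced residues is block triangular with diagonal blocks \<open>A\<^sub>I\<close> and \<open>A\<^sub>I\<^sub>\<union>\<^sub>x\<close>.

  Inserting \<open>x\<close> between the neighbours \<open>a\<close>, \<open>b\<close> of a chain multiplies its Parke-Taylor function by
  \<open>1 / (x - a) - 1 / (x - b)\<close>. Along a fixed chain these differences run through a basis of the
  families with sum zero, so the Parke-Taylor functions remain a basis at every step.
\<close>

section \<open>Vectors and constant linear operators\<close>

text \<open>Integrating out the last of \<open>k + 1\<close> variables multiplies the rank of a
  system by \<open>k + 1\<close>, so the scalar statement cannot be proved by induction alone. The
  coefficients of the basis must also stay in the given field. For both reasons nonresonance is
  phrased as invertibility with an inverse whose entries lie in \<open>K\<close>, not through
  eigenvalues: such inverses solve equations over every ring \<open>R k\<close>, and they pass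
  through the block triangular shape by explicit formulas.

  One fibre step consumes only two kinds of sets of points: the pairs consisting of x and one other
  point, which govern the poles at finite distance, and the set of all finite points except x, which
  governs the pole at infinity because the total sum of residues is zero. The other sets are needed
  further down, since the partial sums of the induced residues are built from them.

  Commutation of the induced operators is not computed. It is transported from above, because a
  family whose fibre form is exact in the direction x must vanish.\<close>

lemma sum_apply_fun: "(\<Sum>a\<in>A. f a) w = (\<Sum>a\<in>A. f a w)"
  for f :: "'a \<Rightarrow> 'b \<Rightarrow> 'c::comm_monoid_add"
  by (induction A rule: infinite_finite_induct) auto

definition sc :: "'e::comm_ring_1 \<Rightarrow> ('i \<Rightarrow> 'e) \<Rightarrow> 'i \<Rightarrow> 'e" where
  "sc c f = (\<lambda>w. c * f w)"

lemma sc_apply [simp]: "sc c f w = c * f w"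
  by (simp add: sc_def)

lemma sc_simps [simp]: "sc 0 f = 0" "sc 1 f = f" "sc c 0 = 0" "sc a (sc b f) = sc (a * b) f"
  by (auto simp: fun_eq_iff mult.assoc)

lemma sc_add: "sc c (f + g) = sc c f + sc c g" "sc (a + b) f = sc a f + sc b f"
  by (auto simp: fun_eq_iff algebra_simps)

lemma sc_diff: "sc c (f - g) = sc c f - sc c g" "sc (a - b) f = sc a f - sc b f"
  by (auto simp: fun_eq_iff algebra_simps)

lemma sc_minus: "sc c (- f) = - sc c f" "sc (- c) f = - sc c f"
  by (auto simp: fun_eq_iff)

lemma sc_sum: "sc c (\<Sum>a\<in>A. f a) = (\<Sum>a\<in>A. sc c (f a))"
  by (auto simp: fun_eq_iff sum_apply_fun sum_distrib_left)

text \<open>Vectors of every length share one type, with \<open>W\<close> as the set of admissible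
  indices; this lets the rank grow along the induction. \<open>S\<close> says where the entries
  live: constants, functions on the base, or the whole field.\<close>

definition vecs :: "'i set \<Rightarrow> 'e::zero set \<Rightarrow> ('i \<Rightarrow> 'e) set" where
  "vecs W S = {f. (\<forall>w\<in>W. f w \<in> S) \<and> (\<forall>w. w \<notin> W \<longrightarrow> f w = 0)}"

lemma vecsI: "(\<And>w. w \<in> W \<Longrightarrow> f w \<in> S) \<Longrightarrow> (\<And>w. w \<notin> W \<Longrightarrow> f w = 0) \<Longrightarrow> f \<in> vecs W S"
  by (simp add: vecs_def)

lemma vecs_UNIV: "f \<in> vecs W S \<Longrightarrow> f \<in> vecs W UNIV"
  by (auto simp: vecs_def)

lemma vecs_in: "f \<in> vecs W S \<Longrightarrow> 0 \<in> S \<Longrightarrow> f w \<in> S"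
  by (cases "w \<in> W") (auto simp: vecs_def)

lemma vecs_0: "0 \<in> S \<Longrightarrow> 0 \<in> vecs W S"
  by (auto simp: vecs_def)

lemma vecs_sum:
  assumes "0 \<in> S" "\<And>a b. a \<in> S \<Longrightarrow> b \<in> S \<Longrightarrow> a + b \<in> S" "\<And>a. a \<in> A \<Longrightarrow> f a \<in> vecs W S"
  shows "(\<Sum>a\<in>A. f a) \<in> vecs W S"
  using assms(3)
  by (induction A rule: infinite_finite_induct) (auto simp: vecs_def assms(1) intro!: assms(2))

definition unit_vec :: "'i \<Rightarrow> 'i \<Rightarrow> 'e::zero_neq_one" where
  "unit_vec w = (\<lambda>v. if v = w then 1 else 0)"

lemma vecs_expand:
  fixes f :: "'i \<Rightarrow> 'e::comm_ring_1"
  assumes "finite W" "f \<in> vecs W S"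
  shows "f = (\<Sum>w\<in>W. sc (f w) (unit_vec w))"
proof
  fix v
  have "(\<Sum>w\<in>W. f w * unit_vec w v) = (\<Sum>w\<in>W. if w = v then f v else 0)"
    by (rule sum.cong) (auto simp: unit_vec_def)
  also have "\<dots> = f v"
    using assms by (auto simp: vecs_def)
  finally show "f v = (\<Sum>w\<in>W. sc (f w) (unit_vec w)) v"
    by (simp add: sum_apply_fun)
qed

text \<open>On vectors supported in a finite set \<open>W\<close> these are the matrices with entries in \<open>K\<close>; therefore
  they preserve the vectors with values in any \<open>K\<close>-module.\<close>

definition linop :: "'e::comm_ring_1 set \<Rightarrow> 'i set \<Rightarrow> (('i \<Rightarrow> 'e) \<Rightarrow> ('i \<Rightarrow> 'e)) \<Rightarrow> bool" where
  "linop K W A \<longleftrightarrow> (\<forall>f g. A (f + g) = A f + A g) \<and> (\<forall>c f. A (sc c f) = sc c (A f)) \<and>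
     (\<forall>f\<in>vecs W K. A f \<in> vecs W K) \<and> (\<forall>f w. w \<notin> W \<longrightarrow> A f w = 0)"

lemma linop_add: "linop K W A \<Longrightarrow> A (f + g) = A f + A g"
  and linop_sc: "linop K W A \<Longrightarrow> A (sc c f) = sc c (A f)"
  and linop_K: "linop K W A \<Longrightarrow> f \<in> vecs W K \<Longrightarrow> A f \<in> vecs W K"
  and linop_off: "linop K W A \<Longrightarrow> w \<notin> W \<Longrightarrow> A f w = 0"
  by (auto simp: linop_def)

lemma linop_0: "linop K W A \<Longrightarrow> A 0 = 0"
  using linop_sc[of K W A 0 0] by simp

lemma linop_minus: "linop K W A \<Longrightarrow> A (- f) = - A f"
  using linop_sc[of K W A "-1" f] by (simp add: sc_minus)

lemma linop_sum: "linop K W A \<Longrightarrow> A (\<Sum>a\<in>S. f a) = (\<Sum>a\<in>S. A (f a))"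
proof (induction S rule: infinite_finite_induct)
  case (insert a S)
  then show ?case
    unfolding sum.insert[OF insert(1,2)] linop_add[OF insert.prems] by (simp only: insert.IH)
qed (use linop_0[of K W A] in auto)

lemma linop_UNIV: "linop K W A \<Longrightarrow> A f \<in> vecs W UNIV"
  by (auto simp: vecs_def linop_off)

lemma unit_vec_vecs: "w \<in> W \<Longrightarrow> 0 \<in> K \<Longrightarrow> 1 \<in> K \<Longrightarrow> unit_vec w \<in> vecs W K"
  by (auto simp: vecs_def unit_vec_def)

lemma linop_expand:
  assumes "finite W" "linop K W A" "f \<in> vecs W S"
  shows "A f = (\<Sum>w\<in>W. sc (f w) (A (unit_vec w)))"
  by (subst vecs_expand[OF assms(1,3)]) (simp add: linop_sum[OF assms(2)] linop_sc[OF assms(2)])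

lemma linop_vecs:
  assumes "finite W" "linop K W A" "f \<in> vecs W S" and K: "0 \<in> K" "1 \<in> K"
    and S: "0 \<in> S" "\<And>a b. a \<in> S \<Longrightarrow> b \<in> S \<Longrightarrow> a + b \<in> S" "\<And>a b. a \<in> K \<Longrightarrow> b \<in> S \<Longrightarrow> b * a \<in> S"
  shows "A f \<in> vecs W S"
proof -
  have "sc (f w) (A (unit_vec w)) \<in> vecs W S" if "w \<in> W" for w
    using linop_K[OF assms(2) unit_vec_vecs[OF that K]] assms(3) that
    by (auto simp: vecs_def intro: S)
  then show ?thesis
    by (subst linop_expand[OF assms(1-3)]) (rule vecs_sum, auto intro: S)
qed

section \<open>Derivations\<close>

locale derivation =
  fixes d :: "'e::field \<Rightarrow> 'e"
  assumes d_add: "d (a + b) = d a + d b"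
    and d_mult: "d (a * b) = d a * b + a * d b"
begin

lemma d_0 [simp]: "d 0 = 0"
  using d_add[of 0 0] by (metis add_0 add_cancel_right_right)

lemma d_1 [simp]: "d 1 = 0"
  using d_mult[of 1 1] by (metis mult_1 mult.right_neutral add_cancel_right_right)

lemma d_minus: "d (- a) = - d a"
  using d_add[of a "- a"] by (simp add: add_eq_0_iff)

lemma d_diff: "d (a - b) = d a - d b"
  using d_add[of a "- b"] by (simp add: d_minus)

lemma d_sum: "d (\<Sum>a\<in>A. f a) = (\<Sum>a\<in>A. d (f a))"
  by (induction A rule: infinite_finite_induct) (simp_all add: d_add)

lemma d_of_nat [simp]: "d (of_nat m) = 0"
  by (induction m) (simp_all add: d_add)

lemma d_inverse: "b \<noteq> 0 \<Longrightarrow> d (1 / b) = - d b / b\<^sup>2"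
  using d_mult[of "1 / b" b]
  by (simp add: field_simps power2_eq_square add_eq_0_iff)

lemma d_divide: "b \<noteq> 0 \<Longrightarrow> d (a / b) = (d a * b - a * d b) / b\<^sup>2"
  using d_mult[of a "1 / b"] by (simp add: d_inverse field_simps power2_eq_square)

lemma d_power: "d (a ^ m) = of_nat m * a ^ (m - 1) * d a"
proof (induction m)
  case (Suc m)
  then show ?case
    by (cases m) (simp_all add: d_mult algebra_simps)
qed simp

lemma d_inverse_power:
  assumes "b \<noteq> 0" "m \<noteq> 0"
  shows "d (1 / b ^ m) = - of_nat m * d b / b ^ Suc m"
proof -
  obtain l where m: "m = Suc l"
    using assms(2) by (cases m) auto
  have "d (1 / b ^ m) = - d (b ^ m) / (b ^ m)\<^sup>2"
    using assms(1) by (simp add: d_inverse)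
  also have "d (b ^ m) = of_nat m * b ^ l * d b"
    using d_power[of b m] by (simp add: m del: power_Suc of_nat_Suc)
  also have "(b ^ m)\<^sup>2 = b ^ l * b ^ Suc m"
    by (simp add: m power2_eq_square)
  also have "- (of_nat m * b ^ l * d b) / (b ^ l * b ^ Suc m) = - of_nat m * d b / b ^ Suc m"
    using assms(1) by (simp del: power_Suc)
  finally show ?thesis .
qed

end

section \<open>Systems with simple poles on the line\<close>

text \<open>Degree bounds suffice in place of exact degrees, so the formula applies to a polynomial
  whose top coefficient is about to be shown to vanish.\<close>

lemma coeff_mult_top:
  fixes p q :: "'a::comm_ring_1 poly"
  assumes "degree p \<le> a" "degree q \<le> b"
  shows "coeff (p * q) (a + b) = coeff p a * coeff q b"
proof -
  have "coeff p i * coeff q (a + b - i) = 0" if "i \<noteq> a" "i \<le> a + b" for i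
    using that assms coeff_eq_0[of p i] coeff_eq_0[of q "a + b - i"] by (cases "i < a") auto
  then have "(\<Sum>i\<le>a + b. coeff p i * coeff q (a + b - i)) =
      (\<Sum>i\<le>a + b. if i = a then coeff p a * coeff q b else 0)"
    by (intro sum.cong) auto
  then show ?thesis
    by (simp add: coeff_mult)
qed

lemma degree_pderiv_le: "degree (pderiv p) \<le> degree p - 1"
  by (rule degree_le) (auto simp: coeff_pderiv coeff_eq_0)

lemma degree_prod_linear:
  fixes z :: "'i \<Rightarrow> 'a::field"
  assumes "finite P"
  shows "degree (\<Prod>j\<in>P. [:- z j, 1:]) = card P" "coeff (\<Prod>j\<in>P. [:- z j, 1:]) (card P) = 1"
proof -
  show deg: "degree (\<Prod>j\<in>P. [:- z j, 1:]) = card P"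
    by (subst degree_prod_sum_eq) auto
  have "lead_coeff (\<Prod>j\<in>P. [:- z j, 1:]) = 1"
    by (subst lead_coeff_prod) simp
  then show "coeff (\<Prod>j\<in>P. [:- z j, 1:]) (card P) = 1"
    by (simp only: deg)
qed

lemma pderiv_prod_linear_root:
  fixes z :: "'i \<Rightarrow> 'a::field"
  assumes "finite P" "j \<in> P"
  shows "poly (pderiv (\<Prod>i\<in>P. [:- z i, 1:])) (z j) = poly (\<Prod>i\<in>P - {j}. [:- z i, 1:]) (z j)"
proof -
  have "(\<Prod>i\<in>P. [:- z i, 1:]) = [:- z j, 1:] * (\<Prod>i\<in>P - {j}. [:- z i, 1:])"
    using assms by (simp only: prod.remove)
  then show ?thesis
    by (simp only: pderiv_mult) (simp add: pderiv_pCons)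
qed

text \<open>Abstracts differentiation in the last variable \<open>x\<close>: the constants of
  \<open>d\<close> stand for functions of the other variables. Transcendence of \<open>x\<close>
  over them is derived, using characteristic zero.\<close>

locale unit_derivation = derivation d for d :: "'e::field \<Rightarrow> 'e" +
  fixes x :: 'e
  assumes d_x [simp]: "d x = 1"
    and of_nat_eq_0: "(of_nat m :: 'e) = 0 \<Longrightarrow> m = 0"
begin

text \<open>The coefficients are constants of \<open>d\<close>; the polynomial itself may have any
  degree.\<close>

definition const_poly :: "'e poly \<Rightarrow> bool" where
  "const_poly q \<longleftrightarrow> (\<forall>i. d (coeff q i) = 0)"

lemma const_poly_pCons [simp]: "const_poly (pCons a q) \<longleftrightarrow> d a = 0 \<and> const_poly q"
  by (auto simp: const_poly_def coeff_pCons split: nat.splits)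

lemma const_poly_0 [simp]: "const_poly 0"
  and const_poly_add: "const_poly p \<Longrightarrow> const_poly q \<Longrightarrow> const_poly (p + q)"
  and const_poly_diff: "const_poly p \<Longrightarrow> const_poly q \<Longrightarrow> const_poly (p - q)"
  and const_poly_smult: "d c = 0 \<Longrightarrow> const_poly q \<Longrightarrow> const_poly (smult c q)"
  and const_poly_mult: "const_poly p \<Longrightarrow> const_poly q \<Longrightarrow> const_poly (p * q)"
  and const_poly_pderiv: "const_poly q \<Longrightarrow> const_poly (pderiv q)"
  by (simp_all add: const_poly_def d_add d_diff d_mult coeff_mult d_sum coeff_pderiv)

lemma const_poly_1 [simp]: "const_poly 1"
  by (simp add: one_pCons)

lemma const_poly_sum: "(\<And>a. a \<in> A \<Longrightarrow> const_poly (f a)) \<Longrightarrow> const_poly (\<Sum>a\<in>A. f a)"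
  by (induction A rule: infinite_finite_induct) (auto intro: const_poly_add)

lemma const_poly_prod: "(\<And>a. a \<in> A \<Longrightarrow> const_poly (f a)) \<Longrightarrow> const_poly (\<Prod>a\<in>A. f a)"
  by (induction A rule: infinite_finite_induct) (auto intro: const_poly_mult)

lemma const_poly_power: "const_poly p \<Longrightarrow> const_poly (p ^ m)"
  by (induction m) (auto intro: const_poly_mult)

lemma const_poly_of_nat [simp]: "const_poly (of_nat m)"
  by (simp add: of_nat_poly)

lemma const_poly_synthetic_div:
  "const_poly q \<Longrightarrow> d z = 0 \<Longrightarrow> const_poly (synthetic_div q z) \<and> d (poly q z) = 0"
  by (induction q) (auto simp: d_add d_mult)

lemma d_poly: "const_poly q \<Longrightarrow> d (poly q x) = poly (pderiv q) x"
  by (induction q) (auto simp: d_add d_mult pderiv_pCons)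

text \<open>Differentiating a relation \<open>poly q x = 0\<close> gives one of smaller degree, so
  \<open>pderiv q = 0\<close> by induction, and in characteristic zero this kills the leading
  coefficient.\<close>

lemma const_poly_transcendental:
  assumes "const_poly q" "poly q x = 0"
  shows "q = 0"
  using assms
proof (induction "degree q" arbitrary: q rule: less_induct)
  case less
  show ?case
  proof (cases "degree q = 0")
    case True
    then obtain a where "q = [:a:]"
      by (meson degree_eq_zeroE)
    then show ?thesis
      using less.prems(2) by simp
  next
    case False
    have "degree (pderiv q) < degree q"
      using False degree_pderiv_le[of q] by linarith
    moreover have "poly (pderiv q) x = 0"
      using d_poly[OF less.prems(1)] less.prems(2) by simp
    ultimately have "pderiv q = 0"
      using less const_poly_pderiv by blast
    then have "of_nat (degree q) * coeff q (degree q) = 0"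
      using False coeff_pderiv[of q "degree q - 1"] by simp
    then have "coeff q (degree q) = 0"
      using of_nat_eq_0[of "degree q"] False by auto
    then show ?thesis
      by simp
  qed
qed

text \<open>An identity between values at \<open>x\<close> becomes one between polynomials, which
  may be evaluated at the points \<open>z j\<close> or compared coefficient by coefficient.\<close>

lemma const_poly_eqI:
  assumes "const_poly p" "const_poly q" "poly p x = poly q x"
  shows "p = q"
  using const_poly_transcendental[of "p - q"] assms const_poly_diff by auto

text \<open>Divide by one linear factor at a time: as the roots are distinct, the remaining ones are
  roots of the quotient, and synthetic division keeps the coefficients constant.\<close>

lemma const_poly_divide_roots:
  assumes "finite P" "inj_on z P" "\<And>j. j \<in> P \<Longrightarrow> d (z j) = 0"
    and "const_poly q" "\<And>j. j \<in> P \<Longrightarrow> poly q (z j) = 0"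
  shows "\<exists>r. const_poly r \<and> q = (\<Prod>j\<in>P. [:- z j, 1:]) * r"
  using assms
proof (induction P arbitrary: q rule: finite_induct)
  case (insert i P)
  define r where "r = synthetic_div q (z i)"
  have r: "const_poly r" "q = [:- z i, 1:] * r"
    using insert.prems const_poly_synthetic_div[of q "z i"] synthetic_div_correct'[of "z i" q]
    by (auto simp: r_def)
  have "poly r (z j) = 0" if "j \<in> P" for j
    using insert.prems(1) insert.prems(4)[of j] that insert.hyps r(2)
    by (auto simp: inj_on_def)
  then obtain r' where "const_poly r'" "r = (\<Prod>j\<in>P. [:- z j, 1:]) * r'"
    using insert.IH[of r] insert.prems(1,2) r(1) by auto
  then show ?case
    using insert.hyps r(2) by (intro exI[of _ r']) (simp only: prod.insert mult.assoc simp_thms)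
qed auto

end

text \<open>The restriction of a Knizhnik-Zamolodchikov system to the line with coordinate
  \<open>x\<close>: simple poles at \<open>z j\<close> with residues \<open>A j\<close>. The other
  coordinates survive only through the constants of \<open>d\<close>.\<close>

locale fibre = unit_derivation d x
  for d :: "'e::field \<Rightarrow> 'e" and x :: 'e +
  fixes K :: "'e set" and W :: "'i set" and P :: "nat set" and z :: "nat \<Rightarrow> 'e"
    and A :: "nat \<Rightarrow> ('i \<Rightarrow> 'e) \<Rightarrow> ('i \<Rightarrow> 'e)"
  assumes finW: "finite W" and finP: "finite P"
    and K01: "0 \<in> K" "1 \<in> K" and d_K: "c \<in> K \<Longrightarrow> d c = 0"
    and linA: "j \<in> P \<Longrightarrow> linop K W (A j)"
    and d_z: "j \<in> P \<Longrightarrow> d (z j) = 0" and inj_z: "inj_on z P"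
begin

definition tw :: "('i \<Rightarrow> 'e) \<Rightarrow> ('i \<Rightarrow> 'e)" where
  "tw h = (\<lambda>w. d (h w)) + (\<Sum>j\<in>P. sc (1 / (x - z j)) (A j h))"

definition \<Delta> :: "'e poly" where
  "\<Delta> = (\<Prod>j\<in>P. [:- z j, 1:])"

definition \<Delta>' :: "nat \<Rightarrow> 'e poly" where
  "\<Delta>' j = (\<Prod>i\<in>P - {j}. [:- z i, 1:])"

text \<open>\<open>A j\<close> is given on vectors over the field only. Its matrix entries extend it
  to vectors of polynomials, compatibly with evaluation (\<open>poly_lift\<close>) and with taking
  coefficients (\<open>coeff_lift\<close>).\<close>

definition lift :: "nat \<Rightarrow> ('i \<Rightarrow> 'e poly) \<Rightarrow> 'i \<Rightarrow> 'e poly" where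
  "lift j Q = (\<lambda>v. \<Sum>w\<in>W. smult (A j (unit_vec w) v) (Q w))"

lemma x_neq: "j \<in> P \<Longrightarrow> x \<noteq> z j"
  using d_z[of j] d_x by (metis zero_neq_one)

lemma const_\<Delta>: "const_poly \<Delta>" and const_\<Delta>': "const_poly (\<Delta>' j)"
  unfolding \<Delta>_def \<Delta>'_def by (rule const_poly_prod; simp add: d_minus d_z)+

lemma \<Delta>_split: "j \<in> P \<Longrightarrow> \<Delta> = [:- z j, 1:] * \<Delta>' j"
  unfolding \<Delta>_def \<Delta>'_def using finP by (simp only: prod.remove)

lemma \<Delta>_x: "j \<in> P \<Longrightarrow> poly \<Delta> x = (x - z j) * poly (\<Delta>' j) x"
  by (simp add: \<Delta>_split algebra_simps)

lemma \<Delta>_x_nz: "poly \<Delta> x \<noteq> 0"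
  using finP x_neq by (auto simp: \<Delta>_def poly_prod)

lemma \<Delta>_root: "j \<in> P \<Longrightarrow> poly \<Delta> (z j) = 0"
  by (simp add: \<Delta>_split)

lemma \<Delta>'_root: "i \<in> P \<Longrightarrow> i \<noteq> j \<Longrightarrow> poly (\<Delta>' j) (z i) = 0"
  using finP by (auto simp: \<Delta>'_def poly_prod)

lemma \<Delta>'_nz: "j \<in> P \<Longrightarrow> poly (\<Delta>' j) (z j) \<noteq> 0"
  using finP inj_z by (auto simp: \<Delta>'_def poly_prod inj_on_def)

lemma \<Delta>_pderiv: "j \<in> P \<Longrightarrow> poly (pderiv \<Delta>) (z j) = poly (\<Delta>' j) (z j)"
  unfolding \<Delta>_def \<Delta>'_def using finP by (rule pderiv_prod_linear_root)

lemma d_A_unit: "j \<in> P \<Longrightarrow> w \<in> W \<Longrightarrow> d (A j (unit_vec w) v) = 0"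
  by (rule d_K, rule vecs_in[OF linop_K[OF linA unit_vec_vecs[OF _ K01]] K01(1)])

lemma const_lift: "j \<in> P \<Longrightarrow> (\<And>w. const_poly (Q w)) \<Longrightarrow> const_poly (lift j Q v)"
  by (auto simp: lift_def intro!: const_poly_sum const_poly_smult d_A_unit)

lemma poly_lift:
  assumes "j \<in> P" "\<And>w. w \<notin> W \<Longrightarrow> Q w = 0"
  shows "poly (lift j Q v) y = A j (\<lambda>w. poly (Q w) y) v"
proof -
  have "(\<lambda>w. poly (Q w) y) \<in> vecs W UNIV"
    using assms(2) by (auto simp: vecs_def)
  from linop_expand[OF finW linA[OF assms(1)] this] show ?thesis
    by (simp add: lift_def poly_sum sum_apply_fun mult.commute)
qed

lemma coeff_lift:
  assumes "j \<in> P" "\<And>w. w \<notin> W \<Longrightarrow> Q w = 0"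
  shows "coeff (lift j Q v) m = A j (\<lambda>w. coeff (Q w) m) v"
proof -
  have "(\<lambda>w. coeff (Q w) m) \<in> vecs W UNIV"
    using assms(2) by (auto simp: vecs_def)
  from linop_expand[OF finW linA[OF assms(1)] this] show ?thesis
    by (simp add: lift_def coeff_sum sum_apply_fun mult.commute)
qed

lemma degree_lift: "(\<And>w. degree (Q w) \<le> m) \<Longrightarrow> degree (lift j Q v) \<le> m"
  unfolding lift_def by (rule degree_sum_le[OF finW]) (meson degree_smult_le le_trans)

text \<open>The numerator of \<open>tw (Q / \<Delta> ^ N)\<close> over \<open>\<Delta> ^ (N + 1)\<close>. At \<open>z j\<close> its value is the invertible
  operator \<open>A j - N\<close> applied to a multiple of \<open>Q (z j)\<close>, so poles can be removed one order at a time.\<close>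

definition numer :: "nat \<Rightarrow> ('i \<Rightarrow> 'e poly) \<Rightarrow> 'i \<Rightarrow> 'e poly" where
  "numer N Q w = \<Delta> * pderiv (Q w) - of_nat N * pderiv \<Delta> * Q w + (\<Sum>j\<in>P. \<Delta>' j * lift j Q w)"

lemma const_numer: "(\<And>w. const_poly (Q w)) \<Longrightarrow> const_poly (numer N Q w)"
  unfolding numer_def
  by (intro const_poly_add const_poly_diff const_poly_mult const_poly_sum const_poly_pderiv
      const_\<Delta> const_\<Delta>' const_lift const_poly_of_nat)

text \<open>The quotient rule produces the first two terms of \<open>numer\<close>; in the residue
  terms one factor \<open>\<Delta>\<close> cancels against \<open>x - z j\<close> and leaves
  \<open>\<Delta>' j\<close>.\<close>

lemma tw_numer:
  assumes Q: "\<And>w. const_poly (Q w)" "\<And>w. w \<notin> W \<Longrightarrow> Q w = 0"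
    and h: "h = (\<lambda>w. poly (Q w) x / poly \<Delta> x ^ N)"
  shows "poly \<Delta> x ^ (N + 1) * tw h w = poly (numer N Q w) x"
proof -
  let ?D = "poly \<Delta> x"
  have nz: "?D \<noteq> 0"
    by (rule \<Delta>_x_nz)
  have 1: "?D ^ (N + 1) * d (h w) = poly (\<Delta> * pderiv (Q w) - of_nat N * pderiv \<Delta> * Q w) x"
  proof (cases N)
    case 0
    then show ?thesis
      by (simp add: h d_poly[OF Q(1)])
  next
    case (Suc M)
    have "d (?D ^ N) = of_nat N * ?D ^ M * poly (pderiv \<Delta>) x"
      by (simp only: d_power d_poly[OF const_\<Delta>]) (simp add: Suc)
    then have "d (h w) = (poly (pderiv (Q w)) x * ?D ^ N
        - poly (Q w) x * (of_nat N * ?D ^ M * poly (pderiv \<Delta>) x)) / (?D ^ N)\<^sup>2"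
      using nz by (simp add: h d_divide d_poly[OF Q(1)])
    also have "\<dots> * ?D ^ (N + 1) = ?D * poly (pderiv (Q w)) x - of_nat N * poly (pderiv \<Delta>) x * poly (Q w) x"
    proof -
      have "(a * (D * E) - b * (c * E * e)) / (D * E)\<^sup>2 * (D * (D * E)) = D * a - c * e * b"
        if "D \<noteq> 0" "E \<noteq> 0" for a b c D E e :: 'e
        using that by (simp add: divide_simps power2_eq_square) (simp add: algebra_simps)
      from this[of ?D "?D ^ M"] show ?thesis
        using nz Suc by simp
    qed
    finally show ?thesis
      by (simp add: mult_ac)
  qed
  have hs: "h = sc (1 / ?D ^ N) (\<lambda>w. poly (Q w) x)"
    by (simp add: h fun_eq_iff)
  have 2: "?D ^ (N + 1) * (1 / (x - z j) * A j h w) = poly (\<Delta>' j * lift j Q w) x" if "j \<in> P" for j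
  proof -
    have "A j h w = poly (lift j Q w) x / ?D ^ N"
      unfolding hs linop_sc[OF linA[OF that]] by (simp add: poly_lift[OF that Q(2)])
    moreover have "?D / (x - z j) = poly (\<Delta>' j) x"
      using x_neq[OF that] by (simp add: \<Delta>_x[OF that])
    moreover have "?D ^ (N + 1) * (1 / (x - z j) * (a / ?D ^ N)) = ?D / (x - z j) * a" for a
      using nz by simp
    ultimately show ?thesis
      by simp
  qed
  have "?D ^ (N + 1) * tw h w = ?D ^ (N + 1) * d (h w)
      + (\<Sum>j\<in>P. ?D ^ (N + 1) * (1 / (x - z j) * A j h w))"
    by (simp add: tw_def sum_apply_fun distrib_left sum_distrib_left)
  also have "\<dots> = poly (numer N Q w) x"
    unfolding 1 numer_def using 2 by (simp add: poly_sum del: power_Suc of_nat_Suc)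
  finally show ?thesis .
qed

section \<open>Simple poles with sum zero are not exact on the line\<close>

context
  fixes u :: "nat \<Rightarrow> 'i \<Rightarrow> 'e"
  assumes u: "\<And>j. j \<in> P \<Longrightarrow> u j \<in> vecs W {c. d c = 0}"
    and nonres: "\<And>j m f. j \<in> P \<Longrightarrow> m \<ge> 1 \<Longrightarrow> f \<in> vecs W UNIV \<Longrightarrow> A j f = sc (of_nat m) f \<Longrightarrow> f = 0"
    and nonres_inf: "\<And>m f. f \<in> vecs W UNIV \<Longrightarrow> (\<Sum>j\<in>P. A j f) + sc (of_nat m) f = 0 \<Longrightarrow> f = 0"
    and u_sum: "(\<Sum>j\<in>P. u j) = 0"
begin

text \<open>Both sides agree at \<open>x\<close> after clearing denominators and have constant
  coefficients, so they are equal as polynomials.\<close>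

lemma numer_eq:
  assumes Q: "\<And>w. const_poly (Q w)" "\<And>w. w \<notin> W \<Longrightarrow> Q w = 0"
    and h: "h = (\<lambda>w. poly (Q w) x / poly \<Delta> x ^ N)"
    and tw: "tw h = (\<Sum>j\<in>P. sc (1 / (x - z j)) (u j))"
  shows "numer N Q w = \<Delta> ^ N * (\<Sum>j\<in>P. smult (u j w) (\<Delta>' j))"
proof (rule const_poly_eqI)
  have "d (u j w) = 0" if "j \<in> P" for j
    using vecs_in[OF u[OF that], of w] by simp
  then show "const_poly (\<Delta> ^ N * (\<Sum>j\<in>P. smult (u j w) (\<Delta>' j)))"
    by (auto intro!: const_poly_mult const_poly_power const_\<Delta> const_poly_sum const_poly_smult const_\<Delta>')
  show "const_poly (numer N Q w)"
    by (rule const_numer[OF Q(1)])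
  have *: "poly \<Delta> x * (1 / (x - z j) * u j w) = u j w * poly (\<Delta>' j) x" if "j \<in> P" for j
    using x_neq[OF that] by (simp add: \<Delta>_x[OF that])
  have "poly (numer N Q w) x = poly \<Delta> x ^ N * (poly \<Delta> x * tw h w)"
    by (simp flip: tw_numer[OF Q h] add: mult_ac)
  also have "poly \<Delta> x * tw h w = (\<Sum>j\<in>P. poly \<Delta> x * (1 / (x - z j) * u j w))"
    by (simp only: tw sum_apply_fun sc_apply sum_distrib_left)
  also have "\<dots> = (\<Sum>j\<in>P. u j w * poly (\<Delta>' j) x)"
    by (rule sum.cong) (use * in auto)
  finally show "poly (numer N Q w) x = poly (\<Delta> ^ N * (\<Sum>j\<in>P. smult (u j w) (\<Delta>' j))) x"
    by (simp add: poly_sum)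
qed

text \<open>With denominator \<open>\<Delta> ^ Suc N\<close>, the vector of values of
  \<open>Q\<close> at \<open>z j\<close> satisfies the eigenvalue equation of \<open>A j\<close> for
  the positive integer \<open>Suc N\<close>. So \<open>nonres\<close> makes it 0 at every
  \<open>z j\<close>, and a whole factor \<open>\<Delta>\<close> cancels.\<close>

lemma no_poles:
  assumes Q: "\<And>w. const_poly (Q w)" "\<And>w. w \<notin> W \<Longrightarrow> Q w = 0"
    and h: "h = (\<lambda>w. poly (Q w) x / poly \<Delta> x ^ N)"
    and tw: "tw h = (\<Sum>j\<in>P. sc (1 / (x - z j)) (u j))"
  shows "\<exists>Q. (\<forall>w. const_poly (Q w)) \<and> (\<forall>w. w \<notin> W \<longrightarrow> Q w = 0) \<and> h = (\<lambda>w. poly (Q w) x)"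
  using Q h
proof (induction N arbitrary: Q)
  case 0
  then show ?case
    by (intro exI[of _ Q]) auto
next
  case (Suc N)
  have root: "poly (Q w) (z j) = 0" if j: "j \<in> P" for j w
  proof -
    define f where "f = (\<lambda>w. poly (Q w) (z j))"
    have f: "f \<in> vecs W UNIV"
      using Suc.prems(2) by (auto simp: f_def vecs_def)
    have "A j f v = of_nat (Suc N) * f v" for v
    proof -
      \<comment> \<open>By \<open>numer_eq\<close> this numerator is a multiple of
        \<open>\<Delta> ^ Suc N\<close>, which vanishes at \<open>z j\<close> because the exponent
        is positive.\<close>
      have "poly (numer (Suc N) Q v) (z j) = 0"
        by (subst numer_eq[OF Suc.prems(1,2,3) tw]) (auto simp: \<Delta>_root[OF j])
      moreover have "poly (numer (Suc N) Q v) (z j) = - (of_nat (Suc N) * poly (\<Delta>' j) (z j) * f v)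
          + (\<Sum>i\<in>P. poly (\<Delta>' i) (z j) * A i f v)"
        unfolding numer_def
        by (simp add: poly_sum \<Delta>_root[OF j] \<Delta>_pderiv[OF j] poly_lift[OF _ Suc.prems(2)] f_def del: of_nat_Suc)
      moreover have "(\<Sum>i\<in>P. poly (\<Delta>' i) (z j) * A i f v) = poly (\<Delta>' j) (z j) * A j f v"
        using finP j by (subst sum.remove[of _ j]) (auto simp: \<Delta>'_root[OF j] intro!: sum.neutral)
      ultimately have "poly (\<Delta>' j) (z j) * (A j f v - of_nat (Suc N) * f v) = 0"
        by (simp add: algebra_simps)
      then show ?thesis
        using \<Delta>'_nz[OF j] by simp
    qed
    then have "A j f = sc (of_nat (Suc N)) f"
      by (simp add: fun_eq_iff)
    then have "f = 0"
      using nonres[OF j _ f, of "Suc N"] by simp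
    then show ?thesis
      by (simp add: f_def fun_eq_iff)
  qed
  have "\<forall>w. \<exists>r. const_poly r \<and> Q w = \<Delta> * r"
    unfolding \<Delta>_def using const_poly_divide_roots[OF finP inj_z d_z] Suc.prems(1) root by blast
  then obtain Q' where Q': "\<And>w. const_poly (Q' w)" "\<And>w. Q w = \<Delta> * Q' w"
    by metis
  have "\<Delta> \<noteq> 0"
    using \<Delta>_x_nz by auto
  then have off: "Q' w = 0" if "w \<notin> W" for w
    using Suc.prems(2)[OF that] Q'(2)[of w] by simp
  have "h = (\<lambda>w. poly (Q' w) x / poly \<Delta> x ^ N)"
    using \<Delta>_x_nz by (auto simp: Suc.prems(3) Q'(2))
  from Suc.IH[OF Q'(1) off this] show ?case .
qed

lemma degree_\<Delta>': "j \<in> P \<Longrightarrow> degree (\<Delta>' j) \<le> card P - 1 \<and> coeff (\<Delta>' j) (card P - 1) = 1"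
  using degree_prod_linear[of "P - {j}" z] finP by (simp add: \<Delta>'_def)

text \<open>The behaviour at infinity decides. If all components have degree at most
  \<open>m\<close>, the coefficient of degree \<open>p + m\<close> in the numerator is
  \<open>m\<close> plus the sum of the residues, applied to the coefficients of degree
  \<open>m\<close>. It vanishes, so \<open>nonres_inf\<close> lowers the degree until nothing is
  left.\<close>

lemma polynomial_zero:
  assumes Q: "\<And>w. const_poly (Q w)" "\<And>w. w \<notin> W \<Longrightarrow> Q w = 0"
    and h: "h = (\<lambda>w. poly (Q w) x)"
    and tw: "tw h = (\<Sum>j\<in>P. sc (1 / (x - z j)) (u j))"
  shows "h = 0"
proof (cases "P = {}")
  case True
  \<comment> \<open>Without poles the premise of \<open>nonres_inf\<close> at \<open>m = 0\<close>
    always holds, so every vector is 0.\<close>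
  have "h \<in> vecs W UNIV"
    using Q(2) by (auto simp: h vecs_def)
  then show ?thesis
    using nonres_inf[of h 0] True by simp
next
  case False
  define p where "p = card P - 1"
  have cP: "card P = Suc p"
    using False finP by (simp add: p_def card_gt_0_iff)
  have eq: "numer 0 Q w = (\<Sum>j\<in>P. smult (u j w) (\<Delta>' j))" for w
    using numer_eq[of Q h 0] Q h tw by simp
  have deg_eq: "\<forall>w. degree (Q w) \<le> m \<longrightarrow> coeff (Q w) m = 0" if m: "\<forall>w. degree (Q w) \<le> m" for m
  proof -
    define f where "f = (\<lambda>w. coeff (Q w) m)"
    have f: "f \<in> vecs W UNIV"
      using Q(2) by (auto simp: f_def vecs_def)
    have "((\<Sum>j\<in>P. A j f) + sc (of_nat m) f) w = 0" for w
    proof -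
      have "coeff (\<Delta> * pderiv (Q w)) (p + m) = of_nat m * f w"
      proof (cases m)
        case 0
        then have "pderiv (Q w) = 0"
          using m by (metis degree_eq_zeroE le_zero_eq pderiv_pCons pderiv_0 add_0 pCons_0_0 smult_0_right)
        then show ?thesis
          using 0 by simp
      next
        case (Suc m')
        have "degree \<Delta> \<le> Suc p" "coeff \<Delta> (Suc p) = 1"
          using degree_prod_linear[OF finP, of z] cP by (auto simp: \<Delta>_def)
        moreover have "degree (pderiv (Q w)) \<le> m'"
          using degree_pderiv_le[of "Q w"] m Suc by (metis le_diff_conv Suc_eq_plus1 order_trans)
        ultimately have "coeff (\<Delta> * pderiv (Q w)) (Suc p + m') = coeff (pderiv (Q w)) m'"
          by (simp only: coeff_mult_top mult_1)
        then show ?thesis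
          using Suc by (simp add: coeff_pderiv f_def)
      qed
      moreover have "coeff (\<Delta>' j * lift j Q w) (p + m) = A j f w" if "j \<in> P" for j
      proof -
        have "degree (lift j Q w) \<le> m"
          by (rule degree_lift) (use m in auto)
        then show ?thesis
          using degree_\<Delta>'[OF that] coeff_lift[OF that Q(2)]
          by (simp only: coeff_mult_top p_def f_def mult_1)
      qed
      moreover have "coeff (\<Sum>j\<in>P. smult (u j w) (\<Delta>' j)) (p + m) = 0"
      proof (cases m)
        case 0
        \<comment> \<open>Each \<open>\<Delta>' j\<close> is monic of degree \<open>p\<close>, so
          for \<open>m = 0\<close> the coefficient on the right is the sum of the
          \<open>u j\<close>. This is where sum zero enters.\<close>
        have "(\<Sum>j\<in>P. u j w) = 0"
          using fun_cong[OF u_sum, of w] by (simp add: sum_apply_fun)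
        then show ?thesis
          using 0 degree_\<Delta>' by (simp add: coeff_sum p_def)
      next
        case (Suc m')
        have "coeff (\<Delta>' j) (p + m) = 0" if "j \<in> P" for j
          using degree_\<Delta>'[OF that] Suc by (intro coeff_eq_0) (auto simp: p_def)
        then show ?thesis
          by (simp add: coeff_sum)
      qed
      ultimately show ?thesis
        using arg_cong[OF eq[of w], of "\<lambda>q. coeff q (p + m)"]
        by (simp add: numer_def coeff_sum sum_apply_fun add.commute)
    qed
    then have "(\<Sum>j\<in>P. A j f) + sc (of_nat m) f = 0"
      by (simp add: fun_eq_iff)
    then have "f = 0"
      using nonres_inf[OF f] by simp
    then show ?thesis
      by (simp add: f_def fun_eq_iff)
  qed
  have "\<forall>w. degree (Q w) \<le> m \<Longrightarrow> \<forall>w. Q w = 0" for m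
  proof (induction m)
    case 0
    have "Q w = 0" for w
      using deg_eq[OF 0] 0 by (metis le_zero_eq leading_coeff_0_iff)
    then show ?case
      by blast
  next
    case (Suc m)
    have "degree (Q w) \<le> m" for w
      using deg_eq[OF Suc.prems] Suc.prems by (metis degree_0 le_SucE leading_coeff_0_iff zero_le)
    then show ?case
      using Suc.IH by blast
  qed
  moreover have "\<exists>m. \<forall>w. degree (Q w) \<le> m"
  proof -
    have "degree (Q w) \<le> (\<Sum>w\<in>W. degree (Q w))" for w
      using finW Q(2) member_le_sum[of w W "\<lambda>w. degree (Q w)"] by (cases "w \<in> W") auto
    then show ?thesis
      by blast
  qed
  ultimately show ?thesis
    by (auto simp: h fun_eq_iff)
qed

text \<open>The primitive is 0 by the two preceding reductions, so the polynomial with the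
  \<open>u j\<close> as Lagrange coefficients vanishes; evaluation at \<open>z j\<close> isolates
  \<open>u j\<close>.\<close>

lemma simple_poles_not_exact:
  assumes Q: "\<And>w. const_poly (Q w)" "\<And>w. w \<notin> W \<Longrightarrow> Q w = 0"
    and h: "h = (\<lambda>w. poly (Q w) x / poly \<Delta> x ^ N)"
    and tw: "tw h = (\<Sum>j\<in>P. sc (1 / (x - z j)) (u j))"
    and j: "j \<in> P"
  shows "u j = 0"
proof
  fix w
  obtain Q' where Q': "\<And>w. const_poly (Q' w)" "\<And>w. w \<notin> W \<Longrightarrow> Q' w = 0" "h = (\<lambda>w. poly (Q' w) x)"
    using no_poles[OF Q h tw] by blast
  have h0: "h = (\<lambda>w. poly 0 x / poly \<Delta> x ^ 0)"
    using polynomial_zero[OF Q' tw] by auto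
  have "numer 0 (\<lambda>_. 0) w = (\<Sum>j\<in>P. smult (u j w) (\<Delta>' j))"
    using numer_eq[OF _ _ h0 tw, of w] by simp
  then have "(\<Sum>j\<in>P. smult (u j w) (\<Delta>' j)) = 0"
    by (simp add: numer_def lift_def)
  then have "poly (\<Sum>j\<in>P. smult (u j w) (\<Delta>' j)) (z j) = 0"
    by (simp only: poly_0)
  then have "(\<Sum>i\<in>P. u i w * poly (\<Delta>' i) (z j)) = 0"
    by (simp add: poly_sum)
  moreover have "(\<Sum>i\<in>P. u i w * poly (\<Delta>' i) (z j)) = u j w * poly (\<Delta>' j) (z j)"
    using finP j by (subst sum.remove[of _ j]) (auto simp: \<Delta>'_root[OF j] intro!: sum.neutral)
  ultimately show "u j w = 0 w"
    using \<Delta>'_nz[OF j] by simp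
qed

end

end

context fibre
begin

lemma tw_add: "tw (f + g) = tw f + tw g"
proof -
  have "(\<Sum>j\<in>P. sc (1 / (x - z j)) (A j (f + g))) =
      (\<Sum>j\<in>P. sc (1 / (x - z j)) (A j f)) + (\<Sum>j\<in>P. sc (1 / (x - z j)) (A j g))"
    unfolding sum.distrib[symmetric]
    by (rule sum.cong) (auto simp: linop_add[OF linA] sc_add)
  then show ?thesis
    by (simp add: tw_def fun_eq_iff d_add)
qed

lemma tw_sc:
  assumes "\<And>w. d (v w) = 0"
  shows "tw (sc a v) = sc (d a) v + (\<Sum>j\<in>P. sc (a / (x - z j)) (A j v))"
proof -
  have "(\<Sum>j\<in>P. sc (1 / (x - z j)) (A j (sc a v))) = (\<Sum>j\<in>P. sc (a / (x - z j)) (A j v))"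
    by (rule sum.cong) (auto simp: linop_sc[OF linA])
  then show ?thesis
    by (simp add: tw_def fun_eq_iff d_mult assms)
qed

lemma common_denominator:
  assumes "\<And>w. w \<in> W \<Longrightarrow> \<exists>q N. const_poly q \<and> h w = poly q x / poly \<Delta> x ^ N"
    and "\<And>w. w \<notin> W \<Longrightarrow> h w = 0"
  obtains Q N where "\<And>w. const_poly (Q w)" "\<And>w. w \<notin> W \<Longrightarrow> Q w = 0"
    "h = (\<lambda>w. poly (Q w) x / poly \<Delta> x ^ N)"
proof -
  obtain q M where q: "\<And>w. w \<in> W \<Longrightarrow> const_poly (q w)"
    "\<And>w. w \<in> W \<Longrightarrow> h w = poly (q w) x / poly \<Delta> x ^ M w"
    using assms(1) by metis
  define N where "N = (\<Sum>w\<in>W. M w)"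
  define Q where "Q = (\<lambda>w. if w \<in> W then q w * \<Delta> ^ (N - M w) else 0)"
  show thesis
  proof
    show "const_poly (Q w)" for w
      by (auto simp: Q_def intro!: const_poly_mult const_poly_power const_\<Delta> q(1))
    show "Q w = 0" if "w \<notin> W" for w
      using that by (simp add: Q_def)
    have "h w = poly (Q w) x / poly \<Delta> x ^ N" if "w \<in> W" for w
    proof -
      have "M w \<le> N"
        unfolding N_def using finW that by (intro member_le_sum) auto
      then have "poly \<Delta> x ^ N = poly \<Delta> x ^ (N - M w) * poly \<Delta> x ^ M w"
        by (simp flip: power_add)
      then show ?thesis
        using that q(2)[OF that] \<Delta>_x_nz by (simp add: Q_def)
    qed
    then show "h = (\<lambda>w. poly (Q w) x / poly \<Delta> x ^ N)"
      using assms(2) by (auto simp: fun_eq_iff Q_def)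
  qed
qed

end

section \<open>Functions on the moduli spaces\<close>

text \<open>The identity \<open>1 / ((x - a) * (x - b)) = (1 / (x - a) - 1 / (x - b)) / (a -
  b)\<close> lowers the order at \<open>a\<close> step by step. \<open>Pr\<close> is abstract so as
  to serve both the decomposition of functions and the reduction modulo exact elements.\<close>

lemma partial_fractions_pole:
  fixes x a b :: "'e::field"
  assumes add: "\<And>f g. Pr f \<Longrightarrow> Pr g \<Longrightarrow> Pr (f + g)"
    and mult: "\<And>c f. c \<in> C \<Longrightarrow> Pr f \<Longrightarrow> Pr (c * f)"
    and C: "1 / (a - b) \<in> C" "- 1 / (a - b) \<in> C" and "a \<noteq> b" "x \<noteq> a" "x \<noteq> b"
    and "\<And>l. l \<ge> 1 \<Longrightarrow> l \<le> m \<Longrightarrow> Pr (1 / (x - a) ^ l)" and "Pr (1 / (x - b))"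
  shows "Pr (1 / ((x - a) ^ m * (x - b)))"
  using assms(8)
proof (induction m)
  case 0
  then show ?case
    using assms(9) by simp
next
  case (Suc m)
  have eq: "1 / ((x - a) ^ Suc m * (x - b)) = 1 / (a - b) * (1 / (x - a) ^ Suc m)
      + - 1 / (a - b) * (1 / ((x - a) ^ m * (x - b)))"
    using assms(5-7) by (simp add: divide_simps)
  have "Pr (1 / (x - a) ^ Suc m)"
    by (rule Suc.prems) auto
  moreover have "Pr (1 / ((x - a) ^ m * (x - b)))"
    by (rule Suc.IH, rule Suc.prems) auto
  ultimately show ?case
    unfolding eq by (intro add mult C)
qed

text \<open>Division with remainder of a power of \<open>x\<close> by \<open>x - b\<close>, one
  degree at a time.\<close>

lemma partial_fractions_power:
  fixes x b :: "'e::field"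
  assumes add: "\<And>f g. Pr f \<Longrightarrow> Pr g \<Longrightarrow> Pr (f + g)"
    and mult: "\<And>c f. c \<in> C \<Longrightarrow> Pr f \<Longrightarrow> Pr (c * f)"
    and "b \<in> C" "x \<noteq> b"
    and "\<And>l. l < m \<Longrightarrow> Pr (x ^ l)" and "Pr (1 / (x - b))"
  shows "Pr (x ^ m / (x - b))"
  using assms(5)
proof (induction m)
  case 0
  then show ?case
    using assms(6) by simp
next
  case (Suc m)
  have eq: "x ^ Suc m / (x - b) = x ^ m + b * (x ^ m / (x - b))"
    using \<open>x \<noteq> b\<close> by (simp add: field_simps)
  show ?case
    unfolding eq using Suc by (intro add mult assms(3)) auto
qed

text \<open>Collects what the induction needs to know about the coordinates: \<open>K\<close> is a
  field of constants and the \<open>D i\<close> are dual to the \<open>t i\<close>. Commutation of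
  the \<open>D i\<close> is derived on the functions in question, not assumed.\<close>

locale simplicial =
  fixes K :: "'e::field set" and n :: nat and t :: "nat \<Rightarrow> 'e" and D :: "nat \<Rightarrow> 'e \<Rightarrow> 'e"
  assumes K_0: "0 \<in> K" and K_1: "1 \<in> K"
    and K_add: "a \<in> K \<Longrightarrow> b \<in> K \<Longrightarrow> a + b \<in> K"
    and K_mult: "a \<in> K \<Longrightarrow> b \<in> K \<Longrightarrow> a * b \<in> K"
    and K_uminus: "a \<in> K \<Longrightarrow> - a \<in> K"
    and K_inverse: "a \<in> K \<Longrightarrow> 1 / a \<in> K"
    and char_0: "(of_nat m :: 'e) = 0 \<Longrightarrow> m = 0"
    and D_derivation: "derivation (D i)"
    and D_K: "a \<in> K \<Longrightarrow> D i a = 0"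
    and D_t: "i \<in> {1..n} \<Longrightarrow> j \<in> {1..n} \<Longrightarrow> D i (t j) = (if i = j then 1 else 0)"
    and t_0: "t 0 = 0" and t_last: "t (Suc n) = 1"
begin

sublocale D: derivation "D i" for i
  by (rule D_derivation)

text \<open>The index \<open>Suc n\<close> stands for the point 1 in every \<open>P k\<close>; infinity has no index.\<close>

definition P :: "nat \<Rightarrow> nat set" where
  "P k = insert (Suc n) {0..k}"

lemma finite_P [simp]: "finite (P k)" and P_0: "0 \<in> P k" and P_last: "Suc n \<in> P k"
  by (auto simp: P_def)

lemma P_mono: "k \<le> l \<Longrightarrow> P k \<subseteq> P l"
  by (auto simp: P_def)

lemma P_Suc: "P (Suc k) = insert (Suc k) (P k)"
  by (auto simp: P_def)

lemma D_t': "i \<in> {1..n} \<Longrightarrow> j \<in> P n \<Longrightarrow> D i (t j) = (if i = j then 1 else 0)"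
  using D_t[of i j] by (cases "j = 0"; cases "j = Suc n") (auto simp: P_def t_0 t_last)

text \<open>A derivation \<open>D i\<close> separates the variable \<open>i\<close> from every other
  point. The only pair without a variable is 0 and \<open>Suc n\<close>, whose coordinates are 0 and
  1.\<close>

lemma t_neq:
  assumes "i \<in> P n" "j \<in> P n" "i \<noteq> j"
  shows "t i \<noteq> t j"
proof
  assume eq: "t i = t j"
  have "i \<in> {1..n} \<or> j \<in> {1..n} \<or> {i, j} = {0, Suc n}"
    using assms by (auto simp: P_def)
  then show False
    using eq D_t'[of i i] D_t'[of i j] D_t'[of j i] D_t'[of j j] assms
    by (auto simp: doubleton_eq_iff t_0 t_last)
qed

lemma t_inj: "k \<le> n \<Longrightarrow> inj_on t (P k)"
  using t_neq P_mono[of k n] by (meson inj_onI subsetD)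

text \<open>The coordinate ring in the first \<open>k\<close> coordinates, presented by generators
  instead of as a localisation, so that closure properties follow by induction. For
  \<open>k = n\<close>, \<open>coordinate_ring_eq\<close> identifies it with the
  localisation.\<close>

inductive_set R :: "nat \<Rightarrow> 'e set" for k where
  R_const: "c \<in> K \<Longrightarrow> c \<in> R k"
| R_coord: "i \<in> P k \<Longrightarrow> t i \<in> R k"
| R_inv: "i \<in> P k \<Longrightarrow> j \<in> P k \<Longrightarrow> i \<noteq> j \<Longrightarrow> 1 / (t i - t j) \<in> R k"
| R_add: "a \<in> R k \<Longrightarrow> b \<in> R k \<Longrightarrow> a + b \<in> R k"
| R_mult: "a \<in> R k \<Longrightarrow> b \<in> R k \<Longrightarrow> a * b \<in> R k"

lemma R_0: "0 \<in> R k" and R_1: "1 \<in> R k"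
  using K_0 K_1 by (auto intro: R_const)

lemma R_uminus: "a \<in> R k \<Longrightarrow> - a \<in> R k"
  using R_mult[OF R_const[OF K_uminus[OF K_1]]] by fastforce

lemma R_diff: "a \<in> R k \<Longrightarrow> b \<in> R k \<Longrightarrow> a - b \<in> R k"
  using R_add[OF _ R_uminus] by fastforce

lemma R_power: "a \<in> R k \<Longrightarrow> a ^ m \<in> R k"
  by (induction m) (auto intro: R_1 R_mult)

lemma R_sum: "(\<And>a. a \<in> A \<Longrightarrow> f a \<in> R k) \<Longrightarrow> sum f A \<in> R k"
  by (induction A rule: infinite_finite_induct) (auto intro: R_0 R_add)

lemma R_prod: "(\<And>a. a \<in> A \<Longrightarrow> f a \<in> R k) \<Longrightarrow> prod f A \<in> R k"
  by (induction A rule: infinite_finite_induct) (auto intro: R_1 R_mult)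

lemma R_mono: "a \<in> R k \<Longrightarrow> k \<le> l \<Longrightarrow> a \<in> R l"
  by (induction rule: R.induct) (use P_mono[of k l] in \<open>auto intro: R.intros\<close>)

lemma D_inv:
  assumes "i \<in> P n" "j \<in> P n" "i \<noteq> j"
  shows "D l (1 / (t i - t j)) = - (D l (t i) - D l (t j)) * (1 / (t i - t j) * (1 / (t i - t j)))"
  using t_neq[OF assms] by (simp add: D.d_inverse D.d_diff power2_eq_square)

lemma D_closed:
  assumes "a \<in> R k" "k \<le> n" "i \<in> {1..n}"
  shows "D i a \<in> R k"
  using assms(1)
proof (induction rule: R.induct)
  case (R_coord j)
  then show ?case
    using assms P_mono[of k n] by (auto simp: D_t' subset_iff intro: R_0 R_1)
next
  case (R_inv j l)
  then have "j \<in> P n" "l \<in> P n"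
    using assms P_mono[of k n] by auto
  then show ?case
    using R_inv assms
    by (simp add: D_inv del: times_divide_eq_left times_divide_eq_right minus_diff_eq)
      (auto simp: D_t' intro!: R_mult R_uminus R_diff R_0 R_1 R.R_inv simp del: times_divide_eq_left times_divide_eq_right)
qed (auto simp: D_K D.d_add D.d_mult intro: R.intros R_0)

lemma D_vanish:
  assumes "a \<in> R k" "k < i" "i \<le> n"
  shows "D i a = 0"
  using assms(1)
proof (induction rule: R.induct)
  case (R_coord j)
  then show ?case
    using assms D_t'[of i j] P_mono[of k n] by (auto simp: P_def)
next
  case (R_inv j l)
  then have "j \<in> P n" "l \<in> P n"
    using assms P_mono[of k n] by auto
  then show ?case
    using R_inv assms D_t'[of i j] D_t'[of i l] by (subst D_inv) (auto simp: P_def)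
qed (auto simp: D_K D.d_add D.d_mult)

lemma D_commute:
  assumes "a \<in> R n" "i \<in> {1..n}" "j \<in> {1..n}"
  shows "D i (D j a) = D j (D i a)"
  using assms(1)
proof (induction rule: R.induct)
  case (R_inv p q)
  let ?b = "t p - t q"
  have nz: "?b \<noteq> 0" and D2: "D i (D j ?b) = 0" "D j (D i ?b) = 0"
    using t_neq[OF R_inv] R_inv assms by (auto simp: D_t' D.d_diff)
  \<comment> \<open>The product is 1, so both sides are 0. After expansion the products of first
    derivatives are symmetric in \<open>i\<close> and \<open>j\<close>, and the second derivatives
    of \<open>?b\<close> vanish.\<close>
  have "D i (D j (1 / ?b * ?b)) = D j (D i (1 / ?b * ?b))"
    using nz by simp
  then have "D i (D j (1 / ?b)) * ?b = D j (D i (1 / ?b)) * ?b"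
    by (simp add: D.d_mult D.d_add D2 del: times_divide_eq_left nonzero_divide_eq_eq)
  then show ?case
    using nz by simp
qed (use assms in \<open>auto simp: D_K D_t' D.d_add D.d_mult\<close>)

text \<open>Partial fraction decompositions in the last coordinate. Only their existence is
  recorded, so a predicate is enough; uniqueness up to exact terms comes from
  \<open>fibre_independent\<close>.\<close>

inductive PF :: "nat \<Rightarrow> 'e \<Rightarrow> bool" for k where
  PF_power: "PF k (t (Suc k) ^ m)"
| PF_pole: "j \<in> P k \<Longrightarrow> PF k (1 / (t (Suc k) - t j) ^ Suc m)"
| PF_add: "PF k a \<Longrightarrow> PF k b \<Longrightarrow> PF k (a + b)"
| PF_mult: "c \<in> R k \<Longrightarrow> PF k a \<Longrightarrow> PF k (c * a)"

lemma x_neq: "k < n \<Longrightarrow> j \<in> P k \<Longrightarrow> t (Suc k) \<noteq> t j"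
  using P_mono[of k n] by (intro t_neq) (auto simp: P_def)

lemma R_inv_uminus: "i \<in> P k \<Longrightarrow> j \<in> P k \<Longrightarrow> i \<noteq> j \<Longrightarrow> - 1 / (t i - t j) \<in> R k"
  using R_inv[of j k i] by (metis minus_diff_eq minus_divide_divide minus_divide_left)

lemma PF_mult_x:
  assumes "PF k a" "k < n"
  shows "PF k (t (Suc k) * a)"
  using assms(1)
proof (induction rule: PF.induct)
  case (PF_power m)
  then show ?case
    using PF.PF_power[of k "Suc m"] by simp
next
  case (PF_pole j m)
  let ?x = "t (Suc k)"
  have "?x \<noteq> t j"
    by (rule x_neq[OF assms(2) PF_pole])
  then have eq: "?x * (1 / (?x - t j) ^ Suc m) = 1 / (?x - t j) ^ m + t j * (1 / (?x - t j) ^ Suc m)"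
    by (simp add: field_simps)
  have "PF k (1 / (?x - t j) ^ m)"
    using PF.PF_power[of k 0] PF.PF_pole[OF PF_pole] by (cases m) auto
  then show ?case
    unfolding eq using PF_pole by (intro PF_add PF_mult PF.PF_pole R_coord)
next
  case (PF_mult c a)
  then show ?case
    using PF.PF_mult[of c k "t (Suc k) * a"] by (simp add: mult_ac)
qed (simp add: distrib_left PF.PF_add)

lemma PF_mult_pole:
  assumes "PF k a" "k < n" "i \<in> P k"
  shows "PF k (1 / (t (Suc k) - t i) * a)"
  using assms(1)
proof (induction rule: PF.induct)
  case (PF_power m)
  have "PF k (t (Suc k) ^ m / (t (Suc k) - t i))"
    using PF.PF_pole[OF assms(3), of 0] x_neq[OF assms(2,3)] assms(3)
    by (intro partial_fractions_power[where C = "R k" and Pr = "PF k"])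
      (auto intro: PF.PF_add PF.PF_mult PF.PF_power R_coord)
  then show ?case
    by simp
next
  case (PF_pole j m)
  show ?case
  proof (cases "i = j")
    case True
    then show ?thesis
      using PF.PF_pole[OF PF_pole, of "Suc m"] by simp
  next
    case False
    have "PF k (1 / ((t (Suc k) - t j) ^ Suc m * (t (Suc k) - t i)))"
    proof (rule partial_fractions_pole[where C = "R k" and Pr = "PF k"])
      show "PF k (1 / (t (Suc k) - t j) ^ l)" if "1 \<le> l" for l
        using PF.PF_pole[OF PF_pole, of "l - 1"] that by simp
      show "PF k (1 / (t (Suc k) - t i))"
        using PF.PF_pole[OF assms(3), of 0] by simp
      show "t j \<noteq> t i" "1 / (t j - t i) \<in> R k" "- 1 / (t j - t i) \<in> R k"
        using PF_pole assms False P_mono[of k n] R_inv[of j k i] R_inv_uminus[of j k i] t_neq[of j i]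
        by auto
    qed (use PF_pole assms x_neq in \<open>auto intro: PF.intros\<close>)
    then show ?thesis
      by (simp add: mult.commute)
  qed
next
  case (PF_mult c a)
  then show ?case
    using PF.PF_mult[of c k "1 / (t (Suc k) - t i) * a"] by (simp add: mult_ac)
next
  case (PF_add a b)
  then show ?case
    using PF.PF_add[of k "1 / (t (Suc k) - t i) * a" "1 / (t (Suc k) - t i) * b"]
    by (simp add: distrib_left add_divide_distrib)
qed

lemma R_Suc_PF:
  assumes "a \<in> R (Suc k)" "k < n"
  shows "PF k a"
proof -
  \<comment> \<open>Multiplying by an arbitrary decomposed \<open>b\<close> turns the product case
    into two applications of the hypothesis, so two decompositions never have to be
    multiplied.\<close>
  have "PF k b \<Longrightarrow> PF k (a * b)" for b
    using assms(1)
  proof (induction arbitrary: b rule: R.induct)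
    case (R_const c)
    then show ?case
      by (auto intro: PF_mult R.R_const)
  next
    case (R_coord i)
    then show ?case
      using assms(2) by (auto simp: P_Suc intro: PF_mult R.R_coord PF_mult_x)
  next
    case (R_inv i j)
    consider "i \<in> P k" "j \<in> P k" | "i = Suc k" "j \<in> P k" | "j = Suc k" "i \<in> P k"
      using R_inv by (auto simp: P_Suc)
    then show ?case
    proof cases
      case 1
      then show ?thesis
        using R_inv by (intro PF_mult R.R_inv) auto
    next
      case 2
      then show ?thesis
        using PF_mult_pole[OF R_inv(4) assms(2)] by simp
    next
      case 3
      have "PF k ((- 1) * (1 / (t (Suc k) - t i) * b))"
        using 3 by (intro PF_mult PF_mult_pole R_inv assms R_uminus R_1)
      also have "(- 1) * (1 / (t (Suc k) - t i) * b) = 1 / (t i - t j) * b"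
        using 3 by (metis minus_diff_eq minus_divide_right mult_minus_left mult_1 mult.assoc)
      finally show ?thesis .
    qed
  next
    case (R_add a1 a2)
    then show ?case
      by (auto simp: distrib_right intro: PF_add)
  next
    case (R_mult a1 a2)
    then show ?case
      by (simp add: mult.assoc)
  qed
  from this[of "t (Suc k) ^ 0"] show ?thesis
    using PF_power[of k 0] by simp
qed

end

section \<open>Cohomology along the fibres\<close>

context simplicial
begin

definition M :: "nat \<Rightarrow> 'i set \<Rightarrow> ('i \<Rightarrow> 'e) set" where
  "M k W = vecs W (R k)"

definition kz :: "nat \<Rightarrow> (nat \<Rightarrow> nat \<Rightarrow> ('i \<Rightarrow> 'e) \<Rightarrow> ('i \<Rightarrow> 'e)) \<Rightarrow> nat \<Rightarrow> ('i \<Rightarrow> 'e) \<Rightarrow> ('i \<Rightarrow> 'e)" where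
  "kz k A i f = (\<lambda>w. D i (f w)) + (\<Sum>j\<in>P k - {i}. sc (1 / (t i - t j)) (A i j f))"

definition residue_sum :: "(nat \<Rightarrow> nat \<Rightarrow> ('i \<Rightarrow> 'e) \<Rightarrow> ('i \<Rightarrow> 'e)) \<Rightarrow> nat set \<Rightarrow> ('i \<Rightarrow> 'e) \<Rightarrow> ('i \<Rightarrow> 'e)" where
  "residue_sum A I f = (\<Sum>i\<in>I. \<Sum>j\<in>I. A i j f)"

text \<open>The inverse must have entries in \<open>K\<close>: it then maps vectors over
  \<open>R k\<close> to vectors over \<open>R k\<close>, so equations between functions are solved
  without leaving the ring.\<close>

definition invertible :: "'i set \<Rightarrow> (('i \<Rightarrow> 'e) \<Rightarrow> ('i \<Rightarrow> 'e)) \<Rightarrow> bool" where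
  "invertible W L \<longleftrightarrow> (\<exists>G. linop K W G \<and> (\<forall>f\<in>vecs W UNIV. L (G f) = f \<and> G (L f) = f))"

text \<open>Since \<open>residue_sum\<close> runs over ordered pairs, it is twice the usual partial sum of residues:
  hence the even integers below. The residue at the pair \<open>(0, Suc n)\<close> does not occur in \<open>kz\<close>, as
  \<open>t (Suc n) - t 0\<close> is constant; it is determined by the condition that the total sum vanishes.\<close>

definition nonresonant :: "nat \<Rightarrow> 'i set \<Rightarrow> (nat \<Rightarrow> nat \<Rightarrow> ('i \<Rightarrow> 'e) \<Rightarrow> ('i \<Rightarrow> 'e)) \<Rightarrow> bool" where
  "nonresonant k W A \<longleftrightarrow> finite W \<and>
    (\<forall>i\<in>P k. \<forall>j\<in>P k. linop K W (A i j) \<and> A i j = A j i) \<and>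
    (\<forall>i\<in>P k. \<forall>f. A i i f = 0) \<and>
    (\<forall>f. residue_sum A (P k) f = 0) \<and>
    (\<forall>I\<subseteq>P k. 2 \<le> card I \<longrightarrow> card I \<le> k + 1 \<longrightarrow>
       (\<forall>m. invertible W (\<lambda>f. residue_sum A I f - sc (2 * of_int m) f))) \<and>
    (\<forall>i\<in>{1..k}. \<forall>j\<in>{1..k}. \<forall>f\<in>M k W. kz k A i (kz k A j f) = kz k A j (kz k A i f))"

lemma two_nz: "(2::'e) \<noteq> 0"
  using char_0[of 2] by auto

lemma two_K: "2 \<in> K"
  using K_add[OF K_1 K_1] by simp

lemma linop_M: "finite W \<Longrightarrow> linop K W A \<Longrightarrow> f \<in> M k W \<Longrightarrow> A f \<in> M k W"
  unfolding M_def
  by (rule linop_vecs) (auto intro: K_0 K_1 R_0 R_add R_mult R_const)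

lemma M_vecs: "f \<in> M k W \<Longrightarrow> f \<in> vecs W UNIV"
  unfolding M_def by (rule vecs_UNIV)

lemma M_mono: "f \<in> M k W \<Longrightarrow> k \<le> l \<Longrightarrow> f \<in> M l W"
  unfolding M_def by (auto simp: vecs_def intro: R_mono[of _ k l])

lemma M_add: "f \<in> M k W \<Longrightarrow> g \<in> M k W \<Longrightarrow> f + g \<in> M k W"
  and M_diff: "f \<in> M k W \<Longrightarrow> g \<in> M k W \<Longrightarrow> f - g \<in> M k W"
  and M_uminus: "f \<in> M k W \<Longrightarrow> - f \<in> M k W"
  and M_sc: "f \<in> M k W \<Longrightarrow> c \<in> R k \<Longrightarrow> sc c f \<in> M k W"
  and M_0: "0 \<in> M k W"
  by (auto simp: M_def vecs_def intro: R_add R_diff R_mult R_0 R_uminus)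

lemma M_sum: "(\<And>a. a \<in> S \<Longrightarrow> f a \<in> M k W) \<Longrightarrow> (\<Sum>a\<in>S. f a) \<in> M k W"
  unfolding M_def by (rule vecs_sum) (auto intro: R_0 R_add)

lemma M_in: "f \<in> M k W \<Longrightarrow> f w \<in> R k"
  unfolding M_def by (rule vecs_in) (auto intro: R_0)

lemma M_D: "f \<in> M k W \<Longrightarrow> k \<le> n \<Longrightarrow> i \<in> {1..n} \<Longrightarrow> (\<lambda>w. D i (f w)) \<in> M k W"
  unfolding M_def by (rule vecsI) (auto simp: vecs_def intro: D_closed)

lemma kz_M:
  assumes "finite W" "\<And>j. j \<in> P k \<Longrightarrow> linop K W (A i j)" "f \<in> M k W" "k \<le> n" "i \<in> {1..k}"
  shows "kz k A i f \<in> M k W"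
proof -
  have "A i j f \<in> M k W" if "j \<in> P k" for j
    by (rule linop_M[OF assms(1) assms(2)[OF that] assms(3)])
  moreover have "(\<lambda>w. D i (f w)) \<in> M k W"
    using assms by (intro M_D) auto
  ultimately show ?thesis
    unfolding kz_def using assms(5) by (intro M_add M_sum M_sc R_inv) (auto simp: P_def)
qed

lemma kz_add:
  assumes "\<And>j. j \<in> P k \<Longrightarrow> linop K W (A i j)"
  shows "kz k A i (f + g) = kz k A i f + kz k A i g"
proof -
  have "(\<Sum>j\<in>P k - {i}. sc (1 / (t i - t j)) (A i j (f + g))) =
    (\<Sum>j\<in>P k - {i}. sc (1 / (t i - t j)) (A i j f)) + (\<Sum>j\<in>P k - {i}. sc (1 / (t i - t j)) (A i j g))"
    unfolding sum.distrib[symmetric] by (rule sum.cong) (auto simp: linop_add[OF assms] sc_add)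
  then show ?thesis
    by (simp add: kz_def fun_eq_iff D.d_add)
qed

lemma kz_0: "(\<And>j. j \<in> P k \<Longrightarrow> linop K W (A i j)) \<Longrightarrow> kz k A i 0 = 0"
  using kz_add[of k W A i 0 0] by simp

lemma kz_uminus: "(\<And>j. j \<in> P k \<Longrightarrow> linop K W (A i j)) \<Longrightarrow> kz k A i (- f) = - kz k A i f"
  using kz_add[of k W A i f "- f"] kz_0[of k W A i] by (simp add: eq_neg_iff_add_eq_0 add.commute)

lemma kz_diff:
  "(\<And>j. j \<in> P k \<Longrightarrow> linop K W (A i j)) \<Longrightarrow> kz k A i (f - g) = kz k A i f - kz k A i g"
  using kz_add[of k W A i f "- g"] kz_uminus[of k W A i g] by simp

lemma residue_sum_lin:
  assumes "\<And>i j. i \<in> I \<Longrightarrow> j \<in> I \<Longrightarrow> linop K W (A i j)"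
  shows "linop K W (residue_sum A I)"
  unfolding linop_def
proof (intro conjI allI ballI impI)
  show "residue_sum A I (f + g) = residue_sum A I f + residue_sum A I g" for f g
    unfolding residue_sum_def sum.distrib[symmetric]
    by (intro sum.cong refl linop_add[OF assms])
  show "residue_sum A I (sc c f) = sc c (residue_sum A I f)" for c f
    unfolding residue_sum_def sc_sum by (intro sum.cong refl linop_sc[OF assms])
  show "residue_sum A I f \<in> vecs W K" if "f \<in> vecs W K" for f
    unfolding residue_sum_def by (intro vecs_sum K_0 K_add linop_K[OF assms] that)
  show "residue_sum A I f w = 0" if "w \<notin> W" for f w
    unfolding residue_sum_def sum_apply_fun using linop_off[OF assms that] by simp
qed

lemma invertible_solve:
  assumes "invertible W L" "finite W" "v \<in> M k W"
  obtains u where "u \<in> M k W" "L u = v"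
  using assms linop_M M_vecs unfolding invertible_def by metis

lemma invertible_inj:
  assumes "invertible W L" "f \<in> vecs W UNIV" "L f = 0"
  shows "f = 0"
  using assms linop_0 unfolding invertible_def by metis

lemma linop_scale:
  assumes "linop K W G" "c \<in> K"
  shows "linop K W (\<lambda>f. sc c (G f))"
  using assms(1) unfolding linop_def
  by (auto simp: sc_add(1) vecs_def mult.commute intro!: K_mult[OF assms(2)])

lemma invertible_scale:
  assumes "invertible W L" "c \<in> K" "c \<noteq> 0"
    and L: "\<And>c f. L (sc c f) = sc c (L f)" and L': "\<And>f. f \<in> vecs W UNIV \<Longrightarrow> L' f = sc c (L f)"
  shows "invertible W L'"
proof -
  obtain G where G: "linop K W G" "\<And>f. f \<in> vecs W UNIV \<Longrightarrow> L (G f) = f \<and> G (L f) = f"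
    using assms(1) by (auto simp: invertible_def)
  have "linop K W (\<lambda>f. sc (1 / c) (G f))"
    by (rule linop_scale[OF G(1) K_inverse[OF assms(2)]])
  moreover have "L' (sc (1 / c) (G f)) = f \<and> sc (1 / c) (G (L' f)) = f" if "f \<in> vecs W UNIV" for f
  proof -
    have "sc (1 / c) (G f) \<in> vecs W UNIV"
      using linop_UNIV[OF G(1), of f] by (auto simp: vecs_def)
    then show ?thesis
      using that G(2)[OF that] assms(3) by (simp add: L' L linop_sc[OF G(1)])
  qed
  ultimately show ?thesis
    unfolding invertible_def by blast
qed

lemma card_P: "k \<le> n \<Longrightarrow> card (P k) = k + 2"
  by (auto simp: P_def)

lemma Suc_notin_P: "k < n \<Longrightarrow> Suc k \<notin> P k"
  by (auto simp: P_def)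

lemma residue_sum_insert:
  assumes "i \<notin> I" "finite I" "A i i f = 0" "\<And>j. j \<in> I \<Longrightarrow> A j i f = A i j f"
  shows "residue_sum A (insert i I) f = residue_sum A I f + sc 2 (\<Sum>j\<in>I. A i j f)"
proof -
  have "residue_sum A (insert i I) f = (\<Sum>j\<in>I. A i j f) + ((\<Sum>j\<in>I. A i j f) + residue_sum A I f)"
    using assms by (simp add: residue_sum_def sum.distrib)
  also have "sc 2 (\<Sum>j\<in>I. A i j f) = (\<Sum>j\<in>I. A i j f) + (\<Sum>j\<in>I. A i j f)"
    by (simp add: fun_eq_iff)
  then have "(\<Sum>j\<in>I. A i j f) + ((\<Sum>j\<in>I. A i j f) + residue_sum A I f) = residue_sum A I f + sc 2 (\<Sum>j\<in>I. A i j f)"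
    by (simp only: add_ac)
  finally show ?thesis .
qed

lemma nonresonant_lin: "nonresonant k W A \<Longrightarrow> i \<in> P k \<Longrightarrow> j \<in> P k \<Longrightarrow> linop K W (A i j)"
  and nonresonant_sym: "nonresonant k W A \<Longrightarrow> i \<in> P k \<Longrightarrow> j \<in> P k \<Longrightarrow> A i j = A j i"
  and nonresonant_diag: "nonresonant k W A \<Longrightarrow> i \<in> P k \<Longrightarrow> A i i f = 0"
  and nonresonant_fin: "nonresonant k W A \<Longrightarrow> finite W"
  and nonresonant_total: "nonresonant k W A \<Longrightarrow> residue_sum A (P k) f = 0"
  by (simp_all add: nonresonant_def)

lemma nonresonant_inv:
  assumes "nonresonant k W A" "I \<subseteq> P k" "2 \<le> card I" "card I \<le> k + 1"
  shows "invertible W (\<lambda>f. residue_sum A I f - sc (2 * of_int m) f)"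
  using assms unfolding nonresonant_def by (elim conjE) simp

lemma nonresonant_comm:
  assumes "nonresonant k W A" "i \<in> {1..k}" "j \<in> {1..k}" "f \<in> M k W"
  shows "kz k A i (kz k A j f) = kz k A j (kz k A i f)"
  using assms unfolding nonresonant_def by (elim conjE) simp

section \<open>Unique representatives with simple poles on a fibre\<close>

context
  fixes k W A
  assumes g: "nonresonant (Suc k) (W :: 'i set) A" and k: "k < n"
begin

interpretation F: fibre "D (Suc k)" "t (Suc k)" K W "P k" t "A (Suc k)"
proof
  have "Suc k \<in> P (Suc k)"
    by (simp add: P_Suc)
  then show "linop K W (A (Suc k) j)" if "j \<in> P k" for j
    using nonresonant_lin[OF g] that by (simp add: P_Suc)
  show "D (Suc k) (t (Suc k)) = 1"
    using k by (simp add: D_t)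
  show "D (Suc k) (t j) = 0" if "j \<in> P k" for j
    using k that by (intro D_vanish[of _ k] R_coord) auto
  show "inj_on t (P k)"
    using k by (intro t_inj) simp
qed (fact nonresonant_fin[OF g] finite_P K_0 K_1 | erule char_0 D_K)+

lemma tw_eq_nab: "F.tw h = kz (Suc k) A (Suc k) h"
proof -
  have "P (Suc k) - {Suc k} = P k"
    using Suc_notin_P[OF k] by (auto simp: P_Suc)
  then show ?thesis
    by (simp add: F.tw_def kz_def)
qed

text \<open>The residue where \<open>t (Suc k)\<close> meets \<open>t j\<close> is half the ordered
  partial sum over these two points.\<close>

lemma invertible_pole: "j \<in> P k \<Longrightarrow> invertible W (\<lambda>f. A (Suc k) j f - sc (of_int m) f)"
proof (rule invertible_scale[of W "\<lambda>f. residue_sum A {Suc k, j} f - sc (2 * of_int m) f" "1 / 2"])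
  assume j: "j \<in> P k"
  have ne: "Suc k \<noteq> j"
    using Suc_notin_P[OF k] j by auto
  show "invertible W (\<lambda>f. residue_sum A {Suc k, j} f - sc (2 * of_int m) f)"
    using j ne by (intro nonresonant_inv[OF g]) (auto simp: P_Suc)
  have "residue_sum A {Suc k, j} f = sc 2 (A (Suc k) j f)" for f
    using residue_sum_insert[of "Suc k" "{j}" A f] ne j nonresonant_sym[OF g, of "Suc k" j] nonresonant_diag[OF g, of _ f]
    by (simp add: P_Suc residue_sum_def)
  then show "A (Suc k) j f - sc (of_int m) f = sc (1 / 2) (residue_sum A {Suc k, j} f - sc (2 * of_int m) f)" for f
    using two_nz by (simp add: sc_diff)
  show "1 / 2 \<in> K" "1 / 2 \<noteq> (0::'e)"
    using K_inverse[OF two_K] two_nz by auto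
  have "linop K W (residue_sum A {Suc k, j})"
    using j nonresonant_lin[OF g] by (intro residue_sum_lin) (auto simp: P_Suc)
  from linop_sc[OF this] show "residue_sum A {Suc k, j} (sc c f) - sc (2 * of_int m) (sc c f) =
      sc c (residue_sum A {Suc k, j} f - sc (2 * of_int m) f)" for c f
    by (simp only: sc_diff sc_simps mult_ac)
qed

text \<open>The residue at infinity is minus the sum of the others. As the total over
  \<open>P (Suc k)\<close> vanishes, that sum is minus one half of the partial sum over
  \<open>P k\<close>, a set of \<open>k + 2\<close> points, the largest size that nonresonance at
  level \<open>Suc k\<close> covers.\<close>

lemma invertible_infinity: "invertible W (\<lambda>f. (\<Sum>j\<in>P k. A (Suc k) j f) + sc (of_int m) f)"
proof (rule invertible_scale[of W "\<lambda>f. residue_sum A (P k) f - sc (2 * of_int m) f" "- 1 / 2"])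
  show "invertible W (\<lambda>f. residue_sum A (P k) f - sc (2 * of_int m) f)"
    by (rule nonresonant_inv[OF g]) (use k card_P[of k] P_mono[of k "Suc k"] in auto)
  have "residue_sum A (P k) f + sc 2 (\<Sum>j\<in>P k. A (Suc k) j f) = 0" for f
  proof -
    have "residue_sum A (P (Suc k)) f = residue_sum A (P k) f + sc 2 (\<Sum>j\<in>P k. A (Suc k) j f)"
      unfolding P_Suc
    proof (rule residue_sum_insert)
      show "A j (Suc k) f = A (Suc k) j f" if "j \<in> P k" for j
        using nonresonant_sym[OF g, of j "Suc k"] that by (simp add: P_Suc)
    qed (use nonresonant_diag[OF g, of "Suc k" f] Suc_notin_P[OF k] in \<open>auto simp: P_Suc\<close>)
    then show ?thesis
      by (simp add: nonresonant_total[OF g])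
  qed
  then have *: "residue_sum A (P k) f = - sc 2 (\<Sum>j\<in>P k. A (Suc k) j f)" for f
    by (metis eq_neg_iff_add_eq_0)
  show "(\<Sum>j\<in>P k. A (Suc k) j f) + sc (of_int m) f =
      sc (- 1 / 2) (residue_sum A (P k) f - sc (2 * of_int m) f)" for f
    unfolding * using two_nz by (simp add: fun_eq_iff field_simps)
  show "- 1 / 2 \<in> K" "- 1 / 2 \<noteq> (0::'e)"
    using K_uminus[OF K_inverse[OF two_K]] two_nz by auto
  have "linop K W (residue_sum A (P k))"
    using nonresonant_lin[OF g] by (intro residue_sum_lin) (auto simp: P_Suc)
  from linop_sc[OF this] show "residue_sum A (P k) (sc c f) - sc (2 * of_int m) (sc c f) =
      sc c (residue_sum A (P k) f - sc (2 * of_int m) f)" for c f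
    by (simp only: sc_diff sc_simps mult_ac)
qed

text \<open>This is \<open>simple_poles_not_exact\<close> in the last direction. What needs an
  argument is that primitives of the form polynomial over a power of \<open>\<Delta>\<close> cover
  all of \<open>R (Suc k)\<close>.\<close>

lemma fibre_independent:
  assumes u: "\<And>j. j \<in> P k \<Longrightarrow> u j \<in> M k W" "(\<Sum>j\<in>P k. u j) = 0" and h: "h \<in> M (Suc k) W"
    and eq: "(\<Sum>j\<in>P k. sc (1 / (t (Suc k) - t j)) (u j)) = kz (Suc k) A (Suc k) h"
    and j: "j \<in> P k"
  shows "u j = 0"
proof -
  have rat: "\<exists>q N. F.const_poly q \<and> a = poly q (t (Suc k)) / poly F.\<Delta> (t (Suc k)) ^ N"
    if "a \<in> R (Suc k)" for a
    using that
  proof (induction rule: R.induct)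
    case (R_const c)
    then show ?case
      by (intro exI[of _ "[:c:]"] exI[of _ 0]) (auto simp: D_K)
  next
    case (R_coord i)
    show ?case
    proof (cases "i = Suc k")
      case True
      then show ?thesis
        by (intro exI[of _ "[:0, 1:]"] exI[of _ 0]) auto
    next
      case False
      then show ?thesis
        using R_coord F.d_z by (intro exI[of _ "[:t i:]"] exI[of _ 0]) (auto simp: P_Suc)
    qed
  next
    case (R_inv i j)
    have *: "1 / (t (Suc k) - t l) = poly (F.\<Delta>' l) (t (Suc k)) / poly F.\<Delta> (t (Suc k)) ^ 1"
      if "l \<in> P k" for l
      using F.\<Delta>_x[OF that] F.\<Delta>_x_nz by simp
    consider "i \<in> P k" "j \<in> P k" | "i = Suc k" "j \<in> P k" | "j = Suc k" "i \<in> P k"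
      using R_inv by (auto simp: P_Suc)
    then show ?case
    proof cases
      case 1
      then have "1 / (t i - t j) \<in> R k"
        using R_inv by (intro R.R_inv)
      then have "D (Suc k) (1 / (t i - t j)) = 0"
        using k by (intro D_vanish[of _ k]) auto
      then show ?thesis
        by (intro exI[of _ "[:1 / (t i - t j):]"] exI[of _ 0]) auto
    next
      case 2
      then show ?thesis
        using * F.const_\<Delta>' by blast
    next
      case 3
      have "1 / (t i - t j) = - (1 / (t (Suc k) - t i))"
        using 3 by (metis minus_diff_eq minus_divide_right)
      also have "\<dots> = poly (- F.\<Delta>' i) (t (Suc k)) / poly F.\<Delta> (t (Suc k)) ^ 1"
        using *[OF 3(2)] by simp
      finally show ?thesis
        using F.const_poly_diff[OF F.const_poly_0 F.const_\<Delta>'[of i]] by (metis diff_0)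
    qed
  next
    case (R_add a b)
    then obtain p q M N where
      "F.const_poly p" "a = poly p (t (Suc k)) / poly F.\<Delta> (t (Suc k)) ^ M"
      "F.const_poly q" "b = poly q (t (Suc k)) / poly F.\<Delta> (t (Suc k)) ^ N"
      by blast
    note pq = this
    let ?q = "p * F.\<Delta> ^ N + q * F.\<Delta> ^ M"
    have "F.const_poly ?q"
      by (intro F.const_poly_add F.const_poly_mult F.const_poly_power F.const_\<Delta> pq)
    moreover have "a + b = poly ?q (t (Suc k)) / poly F.\<Delta> (t (Suc k)) ^ (M + N)"
      unfolding pq using F.\<Delta>_x_nz by (simp add: add_frac_eq power_add)
    ultimately show ?case
      by blast
  next
    case (R_mult a b)
    then obtain p q M N where
      "F.const_poly p" "a = poly p (t (Suc k)) / poly F.\<Delta> (t (Suc k)) ^ M"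
      "F.const_poly q" "b = poly q (t (Suc k)) / poly F.\<Delta> (t (Suc k)) ^ N"
      by blast
    then show ?case
      by (intro exI[of _ "p * q"] exI[of _ "M + N"]) (auto simp: power_add intro!: F.const_poly_mult)
  qed
  have "h w = 0" if "w \<notin> W" for w
    using h that by (simp add: M_def vecs_def)
  then obtain Q N where Q: "\<And>w. F.const_poly (Q w)" "\<And>w. w \<notin> W \<Longrightarrow> Q w = 0"
    "h = (\<lambda>w. poly (Q w) (t (Suc k)) / poly F.\<Delta> (t (Suc k)) ^ N)"
    using F.common_denominator[of h, OF rat[OF M_in[OF h]]] by metis
  show ?thesis
  proof (rule F.simple_poles_not_exact[OF _ _ _ u(2) Q _ j])
    show "u j \<in> vecs W {c. D (Suc k) c = 0}" if "j \<in> P k" for j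
      using M_in[OF u(1)[OF that]] u(1)[OF that] k by (auto simp: vecs_def M_def intro: D_vanish[of _ k])
    show "f = 0" if "j \<in> P k" "f \<in> vecs W UNIV" "A (Suc k) j f = sc (of_nat m) f" for j m f
      using invertible_inj[OF invertible_pole[OF that(1), of "int m"] that(2)] that(3) by simp
    show "f = 0" if "f \<in> vecs W UNIV" "(\<Sum>j\<in>P k. A (Suc k) j f) + sc (of_nat m) f = 0" for f m
      using invertible_inj[OF invertible_infinity[of "int m"] that(1)] that(2) by simp
    show "F.tw h = (\<Sum>j\<in>P k. sc (1 / (t (Suc k) - t j)) (u j))"
      by (simp only: tw_eq_nab eq)
  qed
qed

text \<open>By partial fractions it suffices to treat a power of \<open>x\<close> or of
  \<open>1 / (x - t j)\<close> times a vector free of \<open>x\<close>. Each is the leading term of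
  an explicit exact element, obtained by inverting the residue at the pole concerned, shifted by an
  integer; the remaining terms are simpler.\<close>

lemma fibre_spanning:
  assumes "f \<in> M (Suc k) W"
  shows "\<exists>u h. (\<forall>j\<in>P k. u j \<in> M k W) \<and> (\<Sum>j\<in>P k. u j) = 0 \<and> h \<in> M (Suc k) W \<and>
    f = (\<Sum>j\<in>P k. sc (1 / (t (Suc k) - t j)) (u j)) + kz (Suc k) A (Suc k) h"
proof -
  define x where "x = t (Suc k)"
  define S where "S = {f. \<exists>u h. (\<forall>j\<in>P k. u j \<in> M k W) \<and> (\<Sum>j\<in>P k. u j) = 0 \<and> h \<in> M (Suc k) W \<and>
    f = (\<Sum>j\<in>P k. sc (1 / (x - t j)) (u j)) + F.tw h}"
  \<comment> \<open>Quantifying over all vectors \<open>v\<close> makes this property of the scalar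
    \<open>a\<close> stable under multiplication by \<open>R k\<close>, as the partial fraction
    lemmas require.\<close>
  define Pr where "Pr a \<longleftrightarrow> (\<forall>v\<in>M k W. sc a v \<in> S)" for a
  have fin: "finite W"
    by (rule nonresonant_fin[OF g])
  have linA: "linop K W (A (Suc k) j)" if "j \<in> P k" for j
    using F.linA that by blast
  have AM: "A (Suc k) j v \<in> M k W" if "j \<in> P k" "v \<in> M k W" for j v
    by (rule linop_M[OF fin linA[OF that(1)] that(2)])
  have xR: "x \<in> R (Suc k)"
    by (auto simp: x_def P_Suc intro: R_coord)
  have poleR: "1 / (x - t j) ^ m \<in> R (Suc k)" if "j \<in> P k" for j m
    using R_power[OF R_inv[of "Suc k" "Suc k" j], of m] that Suc_notin_P[OF k]
    by (auto simp: x_def P_Suc power_one_over)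
  have S_I: "(\<Sum>j\<in>P k. sc (1 / (x - t j)) (u j)) + F.tw h \<in> S"
    if "\<And>j. j \<in> P k \<Longrightarrow> u j \<in> M k W" "(\<Sum>j\<in>P k. u j) = 0" "h \<in> M (Suc k) W" for u h
    unfolding S_def using that by (intro CollectI exI[of _ u] exI[of _ h]) simp
  have S_add: "f1 + f2 \<in> S" if f: "f1 \<in> S" "f2 \<in> S" for f1 f2
  proof -
    obtain u1 h1 u2 h2 where
      1: "\<forall>j\<in>P k. u1 j \<in> M k W" "(\<Sum>j\<in>P k. u1 j) = 0" "h1 \<in> M (Suc k) W"
        "f1 = (\<Sum>j\<in>P k. sc (1 / (x - t j)) (u1 j)) + F.tw h1" and
      2: "\<forall>j\<in>P k. u2 j \<in> M k W" "(\<Sum>j\<in>P k. u2 j) = 0" "h2 \<in> M (Suc k) W"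
        "f2 = (\<Sum>j\<in>P k. sc (1 / (x - t j)) (u2 j)) + F.tw h2"
      using f unfolding S_def by blast
    have "(\<Sum>j\<in>P k. u1 j + u2 j) = 0"
      by (simp add: sum.distrib 1(2) 2(2))
    moreover have "f1 + f2 = (\<Sum>j\<in>P k. sc (1 / (x - t j)) (u1 j + u2 j)) + F.tw (h1 + h2)"
      by (simp only: 1(4) 2(4) F.tw_add sc_add(1) sum.distrib add_ac)
    ultimately show ?thesis
      using S_I[of "\<lambda>j. u1 j + u2 j" "h1 + h2"] 1(1,3) 2(1,3) by (simp add: M_add)
  qed
  have S_0: "0 \<in> S"
  proof -
    have "F.tw 0 = 0"
      using F.tw_add[of 0 0] by simp
    then show ?thesis
      using S_I[of "\<lambda>_. 0" 0] by (simp add: M_0)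
  qed
  have S_sum: "(\<Sum>a\<in>I. ff a) \<in> S" if "\<And>a. a \<in> I \<Longrightarrow> ff a \<in> S" for I :: "'x set" and ff
    using that by (induction I rule: infinite_finite_induct) (auto intro: S_0 S_add)
  have S_tw: "F.tw h \<in> S" if "h \<in> M (Suc k) W" for h
    using S_I[of "\<lambda>_. 0" h] that by (simp add: M_0)
  have Dv: "D (Suc k) (v w) = 0" if "v \<in> M k W" for v w
    using M_in[OF that] k by (intro D_vanish[of _ k]) auto
  have S_uminus: "- f \<in> S" if f: "f \<in> S" for f
  proof -
    obtain u h where
      1: "\<forall>j\<in>P k. u j \<in> M k W" "(\<Sum>j\<in>P k. u j) = 0" "h \<in> M (Suc k) W"
        "f = (\<Sum>j\<in>P k. sc (1 / (x - t j)) (u j)) + F.tw h"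
      using f unfolding S_def by blast
    have "F.tw (- h) = - F.tw h"
      using F.tw_add[of h "- h"] F.tw_add[of 0 0] by (simp add: eq_neg_iff_add_eq_0 add.commute)
    then have "- f = (\<Sum>j\<in>P k. sc (1 / (x - t j)) (- u j)) + F.tw (- h)"
      by (simp add: 1(4) sc_minus sum_negf)
    moreover have "(\<Sum>j\<in>P k. - u j) = 0"
      by (simp add: sum_negf 1(2))
    ultimately show ?thesis
      using S_I[of "\<lambda>j. - u j" "- h"] 1(1,3) by (simp add: M_uminus)
  qed
  have Pr_add: "Pr (a + b)" if "Pr a" "Pr b" for a b
    using that S_add unfolding Pr_def sc_add(2) by simp
  have Pr_mult: "Pr (c * a)" if "c \<in> R k" "Pr a" for a c
  proof -
    have "sc a (sc c v) \<in> S" if "v \<in> M k W" for v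
      using \<open>Pr a\<close> M_sc[OF that \<open>c \<in> R k\<close>] unfolding Pr_def by blast
    then show ?thesis
      by (simp add: Pr_def mult.commute)
  qed
  have Pr_D: "sc a v \<in> S" if "Pr a" "v \<in> M k W" for a v
    using that by (auto simp: Pr_def)
  have Pr1: "Pr (1 / (x - t i))" if i: "i \<in> P k" for i
    unfolding Pr_def
  proof
    fix v
    assume v: "v \<in> M k W"
    \<comment> \<open>A single pole violates sum zero. Since \<open>u\<close> is free of
      \<open>x\<close>, \<open>F.tw u\<close> has simple poles with residues
      \<open>A (Suc k) j u\<close>, whose sum is \<open>v\<close>; subtracting them restores the
      condition.\<close>
    obtain u where u: "u \<in> M k W" "(\<Sum>j\<in>P k. A (Suc k) j u) + sc (of_int 0) u = v"
      using invertible_solve[OF invertible_infinity fin v] .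
    define y where "y j = (if j = i then v else 0) - A (Suc k) j u" for j
    have y1: "\<forall>j\<in>P k. y j \<in> M k W"
      using v u(1) by (auto simp: y_def intro!: M_diff AM M_0 M_uminus)
    have y2: "(\<Sum>j\<in>P k. y j) = 0"
      unfolding y_def sum_subtractf using u(2) i by simp
    have "F.tw (sc 1 u) = sc 0 u + (\<Sum>j\<in>P k. sc (1 / (x - t j)) (A (Suc k) j u))"
      using F.tw_sc[of u 1] Dv[OF u(1)] by (simp add: x_def)
    moreover have "(\<Sum>j\<in>P k. sc (1 / (x - t j)) (y j)) =
        sc (1 / (x - t i)) v - (\<Sum>j\<in>P k. sc (1 / (x - t j)) (A (Suc k) j u))"
    proof -
      have "(\<Sum>j\<in>P k. sc (1 / (x - t j)) (if j = i then v else 0)) =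
          (\<Sum>j\<in>P k. if j = i then sc (1 / (x - t i)) v else 0)"
        by (rule sum.cong) auto
      then show ?thesis
        unfolding y_def sc_diff sum_subtractf using i by simp
    qed
    ultimately have "sc (1 / (x - t i)) v = (\<Sum>j\<in>P k. sc (1 / (x - t j)) (y j)) + F.tw u"
      by simp
    then show "sc (1 / (x - t i)) v \<in> S"
      using S_I[of y u] y1 y2 M_mono[OF u(1), of "Suc k"] by simp
  qed
  have Pr_pole: "Pr (1 / (x - t j) ^ Suc m)" if j: "j \<in> P k" for j m
    using j
  proof (induction m rule: less_induct)
    case (less m)
    show ?case
    proof (cases m)
      case 0
      then show ?thesis
        using Pr1[OF j] by simp
    next
      case (Suc m')
      show ?thesis
        unfolding Pr_def
      proof
        fix v
        assume v: "v \<in> M k W"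
        \<comment> \<open>The shift by \<open>m\<close> comes from differentiating
          \<open>1 / (x - t j) ^ m\<close>. With this \<open>u\<close> the pole of order
          \<open>Suc m\<close> in the twisted derivative has coefficient exactly \<open>v\<close>,
          and the other terms have order at most \<open>m\<close> at \<open>t j\<close>.\<close>
        obtain u where u: "u \<in> M k W" "A (Suc k) j u - sc (of_int (int m)) u = v"
          using invertible_solve[OF invertible_pole[OF j] fin v] .
        have neq: "x \<noteq> t j"
          unfolding x_def by (rule x_neq[OF k j])
        have split: "P k = insert j (P k - {j})"
          using j by auto
        have dd: "D (Suc k) (1 / (x - t j) ^ m) = - of_nat m / (x - t j) ^ Suc m"
          using neq F.d_z[OF j] Suc
          by (simp add: D.d_inverse_power D.d_diff x_def del: power_Suc)
        have "F.tw (sc (1 / (x - t j) ^ m) u) = sc (- of_nat m / (x - t j) ^ Suc m) u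
            + (\<Sum>i\<in>P k. sc (1 / (x - t j) ^ m / (x - t i)) (A (Suc k) i u))"
          using F.tw_sc[of u "1 / (x - t j) ^ m"] Dv[OF u(1)] dd by (simp add: x_def)
        also have "\<dots> = sc (1 / (x - t j) ^ Suc m) v
            + (\<Sum>i\<in>P k - {j}. sc (1 / ((x - t j) ^ m * (x - t i))) (A (Suc k) i u))"
          by (subst split, subst sum.insert)
            (auto simp: fun_eq_iff sum_apply_fun diff_divide_distrib mult_ac simp flip: u(2))
        finally have eq: "sc (1 / (x - t j) ^ Suc m) v = F.tw (sc (1 / (x - t j) ^ m) u)
            + - (\<Sum>i\<in>P k - {j}. sc (1 / ((x - t j) ^ m * (x - t i))) (A (Suc k) i u))"
          by simp
        have "Pr (1 / ((x - t j) ^ m * (x - t i)))" if i: "i \<in> P k - {j}" for i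
        proof (rule partial_fractions_pole[where C = "R k" and Pr = Pr])
          show "Pr (1 / (x - t j) ^ l)" if "1 \<le> l" "l \<le> m" for l
            using less.IH[of "l - 1"] that j by simp
          show "x \<noteq> t i" "1 / (t j - t i) \<in> R k" "- 1 / (t j - t i) \<in> R k" "t j \<noteq> t i" "Pr (1 / (x - t i))"
            using i j x_neq[OF k] k R_inv[of j k i] R_inv_uminus[of j k i] t_inj[of k] Pr1
            by (auto simp: x_def inj_on_def)
        qed (use neq Pr_add Pr_mult in auto)
        then show "sc (1 / (x - t j) ^ Suc m) v \<in> S"
          unfolding eq using u(1) j M_mono[OF u(1), of "Suc k"]
          by (intro S_add S_uminus S_sum S_tw Pr_D AM M_sc poleR) auto
      qed
    qed
  qed
  have Pr_power: "Pr (x ^ m)" for m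
  proof (induction m rule: less_induct)
    case (less m)
    show ?case
      unfolding Pr_def
    proof
      fix v
      assume v: "v \<in> M k W"
      \<comment> \<open>At infinity the same device uses \<open>x ^ Suc m\<close>: differentiation
        contributes \<open>Suc m\<close>, the leading parts of \<open>x ^ Suc m / (x - t i)\<close>
        contribute the residues, and the rest reduces to powers below \<open>m\<close> and simple
        poles.\<close>
      obtain u where u: "u \<in> M k W" "(\<Sum>j\<in>P k. A (Suc k) j u) + sc (of_int (int (Suc m))) u = v"
        using invertible_solve[OF invertible_infinity fin v] .
      have quot: "x ^ Suc m / (x - t i) = x ^ m + t i * (x ^ m / (x - t i))" if "i \<in> P k" for i
        using x_neq[OF k that] by (simp add: x_def field_simps)
      have "F.tw (sc (x ^ Suc m) u) = sc (of_nat (Suc m) * x ^ m) u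
          + (\<Sum>i\<in>P k. sc (x ^ Suc m / (x - t i)) (A (Suc k) i u))"
        using F.tw_sc[of u "x ^ Suc m"] Dv[OF u(1)] by (simp add: x_def D.d_power del: power_Suc of_nat_Suc)
      also have "(\<Sum>i\<in>P k. sc (x ^ Suc m / (x - t i)) (A (Suc k) i u)) =
          (\<Sum>i\<in>P k. sc (x ^ m) (A (Suc k) i u) + sc (t i * (x ^ m / (x - t i))) (A (Suc k) i u))"
        by (rule sum.cong) (simp_all only: quot sc_add)
      also have "sc (of_nat (Suc m) * x ^ m) u + \<dots> = sc (x ^ m) v
          + (\<Sum>i\<in>P k. sc (t i * (x ^ m / (x - t i))) (A (Suc k) i u))"
        unfolding sum.distrib by (simp flip: u(2) add: sc_add sc_sum mult_ac del: of_nat_Suc)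
      finally have eq: "sc (x ^ m) v = F.tw (sc (x ^ Suc m) u)
            + - (\<Sum>i\<in>P k. sc (t i * (x ^ m / (x - t i))) (A (Suc k) i u))"
        by (simp only: add.assoc add.right_inverse add_0_right)
      have "Pr (x ^ m / (x - t i))" if i: "i \<in> P k" for i
        using i x_neq[OF k i] less.IH Pr1[OF i]
        by (intro partial_fractions_power[where C = "R k" and Pr = Pr])
          (auto simp: x_def intro: R_coord Pr_add Pr_mult)
      then show "sc (x ^ m) v \<in> S"
        unfolding eq using u(1) M_mono[OF u(1), of "Suc k"]
        by (intro S_add S_uminus S_sum S_tw Pr_D AM M_sc R_power xR Pr_mult R_coord) auto
    qed
  qed
  have Pr_PF: "Pr a" if "PF k a" for a
    using that
    by (induction rule: PF.induct) (use Pr_power Pr_pole Pr_add Pr_mult in \<open>auto simp: x_def\<close>)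
  have "f \<in> vecs W (R (Suc k))"
    using assms by (simp add: M_def)
  then have "f = (\<Sum>w\<in>W. sc (f w) (unit_vec w))"
    by (rule vecs_expand[OF fin])
  also have "\<dots> \<in> S"
  proof (rule S_sum)
    fix w
    assume "w \<in> W"
    then have "unit_vec w \<in> M k W"
      by (auto simp: M_def intro: unit_vec_vecs R_0 R_1)
    then show "sc (f w) (unit_vec w) \<in> S"
      using R_Suc_PF[OF M_in[OF assms] k] Pr_PF Pr_D by blast
  qed
  finally show ?thesis
    unfolding S_def x_def tw_eq_nab by blast
qed

end

end

section \<open>The induced system on the base\<close>

context simplicial
begin

definition dv :: "nat \<Rightarrow> ('i \<Rightarrow> 'e) \<Rightarrow> 'i \<Rightarrow> 'e" where
  "dv i f = (\<lambda>w. D i (f w))"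

lemma dv_apply [simp]: "dv i f w = D i (f w)"
  by (simp add: dv_def)

lemma dv_sc: "dv i (sc a f) = sc (D i a) f + sc a (dv i f)"
  and dv_sum: "dv i (\<Sum>a\<in>S. F a) = (\<Sum>a\<in>S. dv i (F a))"
  by (simp_all add: fun_eq_iff D.d_add D.d_minus D.d_mult sum_apply_fun D.d_sum)

text \<open>A family with sum zero indexed by \<open>P k\<close> is stored without its entry at 0. Prefixing the index
  of the entry to a word keeps the type of vectors fixed while the rank grows.\<close>

definition full :: "nat \<Rightarrow> (nat list \<Rightarrow> 'e) \<Rightarrow> nat \<Rightarrow> nat list \<Rightarrow> 'e" where
  "full k v j = (if j = 0 then - (\<Sum>l\<in>P k - {0}. (\<lambda>w. v (l # w))) else (\<lambda>w. v (j # w)))"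

definition pack :: "nat \<Rightarrow> (nat \<Rightarrow> nat list \<Rightarrow> 'e) \<Rightarrow> nat list \<Rightarrow> 'e" where
  "pack k u w = (case w of [] \<Rightarrow> 0 | l # w' \<Rightarrow> if l \<in> P k - {0} then u l w' else 0)"

definition words :: "nat \<Rightarrow> nat list set \<Rightarrow> nat list set" where
  "words k W = {l # w | l w. l \<in> P k - {0} \<and> w \<in> W}"

lemma finite_words: "finite W \<Longrightarrow> finite (words k W)"
proof -
  assume "finite W"
  moreover have "words k W = (\<lambda>(l, w). l # w) ` ((P k - {0}) \<times> W)"
    by (auto simp: words_def)
  ultimately show ?thesis
    by simp
qed

lemma sum_P_0: "(\<Sum>l\<in>P k. u l) = u 0 + (\<Sum>l\<in>P k - {0}. u l)"
  by (simp add: sum.remove P_0)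

text \<open>Sum zero is what allows the suppressed entry at 0 to be recovered.\<close>

lemma full_pack:
  assumes "(\<Sum>l\<in>P k. u l) = 0" "l \<in> P k"
  shows "full k (pack k u) l = u l"
proof -
  have "(\<Sum>l\<in>P k - {0}. (\<lambda>w. pack k u (l # w))) = (\<Sum>l\<in>P k - {0}. u l)"
    by (rule sum.cong) (auto simp: pack_def)
  then show ?thesis
    using assms unfolding sum_P_0
    by (auto simp: full_def pack_def neg_eq_iff_add_eq_0 add.commute)
qed

lemma pack_full: "v \<in> vecs (words k W) S \<Longrightarrow> pack k (full k v) = v"
  by (auto simp: fun_eq_iff pack_def full_def vecs_def words_def split: list.splits)

lemma pack_vecs:
  assumes "\<And>l. l \<in> P k \<Longrightarrow> u l \<in> vecs W S"
  shows "pack k u \<in> vecs (words k W) S"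
  using assms by (fastforce simp: vecs_def words_def pack_def split: list.splits)

lemma full_sum: "(\<Sum>l\<in>P k. full k v l) = 0"
proof -
  have "(\<Sum>l\<in>P k - {0}. full k v l) = (\<Sum>l\<in>P k - {0}. (\<lambda>w. v (l # w)))"
    by (rule sum.cong) (auto simp: full_def)
  then show ?thesis
    by (simp add: sum_P_0 full_def)
qed

lemma full_vecs:
  assumes "v \<in> vecs (words k W) S" "l \<in> P k" "0 \<in> S"
    "\<And>a b. a \<in> S \<Longrightarrow> b \<in> S \<Longrightarrow> a + b \<in> S" "\<And>a. a \<in> S \<Longrightarrow> - a \<in> S"
  shows "full k v l \<in> vecs W S"
proof -
  have *: "(\<lambda>w. v (j # w)) \<in> vecs W S" if "j \<in> P k - {0}" for j
    using assms(1) that by (auto simp: vecs_def words_def)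
  have "(\<Sum>l\<in>P k - {0}. (\<lambda>w. v (l # w))) \<in> vecs W S"
    by (rule vecs_sum[OF assms(3,4) *])
  then have "- (\<Sum>l\<in>P k - {0}. (\<lambda>w. v (l # w))) \<in> vecs W S"
    using assms(5) by (auto simp: vecs_def)
  then show ?thesis
    using * assms(2) by (auto simp: full_def)
qed

lemma full_UNIV: "v \<in> vecs (words k W) UNIV \<Longrightarrow> l \<in> P k \<Longrightarrow> full k v l \<in> vecs W UNIV"
  by (erule full_vecs) auto

lemma full_K: "v \<in> vecs (words k W) K \<Longrightarrow> l \<in> P k \<Longrightarrow> full k v l \<in> vecs W K"
  by (erule full_vecs) (auto intro: K_0 K_add K_uminus)

lemma full_M: "v \<in> M m (words k W) \<Longrightarrow> l \<in> P k \<Longrightarrow> full k v l \<in> M m W"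
  unfolding M_def by (erule full_vecs) (auto intro: R_0 R_add R_uminus)

lemma full_add: "full k (v + w) l = full k v l + full k w l"
  by (auto simp: full_def fun_eq_iff sum_apply_fun sum.distrib)

lemma full_sc: "full k (sc c v) l = sc c (full k v l)"
  by (auto simp: full_def fun_eq_iff sum_apply_fun sum_distrib_left)

lemma full_0: "full k 0 l = 0"
  by (auto simp: full_def fun_eq_iff sum_apply_fun)

lemma full_minus: "full k (- v) l = - full k v l"
  by (auto simp: full_def fun_eq_iff sum_apply_fun sum_negf)

lemma full_diff: "full k (v - w) l = full k v l - full k w l"
  using full_add[of k v "- w" l] full_minus[of k w l] by simp

lemma full_setsum: "full k (\<Sum>a\<in>S. F a) l = (\<Sum>a\<in>S. full k (F a) l)"
proof (induction S rule: infinite_finite_induct)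
  case (insert a S)
  then show ?case
    unfolding sum.insert[OF insert(1,2)] full_add by simp
qed (simp_all add: full_def fun_eq_iff sum_apply_fun)

lemma full_dv: "full k (dv i v) l = dv i (full k v l)"
  by (auto simp: full_def fun_eq_iff sum_apply_fun D.d_minus D.d_sum)

lemma full_eqI:
  assumes "v \<in> vecs (words k W) S" "v' \<in> vecs (words k W) T" "\<And>l. l \<in> P k \<Longrightarrow> full k v l = full k v' l"
  shows "v = v'"
proof -
  have "pack k (full k v) = pack k (full k v')"
    using assms(3) by (auto simp: pack_def fun_eq_iff split: list.splits)
  then show ?thesis
    using assms(1,2) by (simp only: pack_full)
qed

text \<open>With \<open>x = t (Suc k)\<close>, this is the coefficient of
  \<open>1 / ((x - t i) * (x - t j))\<close> in the derivative of a fibre form in direction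
  \<open>i\<close>, once the exact term of \<open>gauss_manin\<close> has been added. It is
  antisymmetric in \<open>i\<close> and \<open>j\<close>.\<close>

definition comm_term where
  "comm_term k A u i j = A (Suc k) j (u i) - A (Suc k) i (u j)"

text \<open>A product of two simple poles equals
  \<open>(1 / (x - t i) - 1 / (x - t j)) / (t i - t j)\<close>. Hence the correction enters with
  opposite signs at the entries \<open>i\<close> and \<open>j\<close>, and the factor
  \<open>1 / (t i - t j)\<close> is supplied by the induced connection.\<close>

definition bterm where
  "bterm k A i j u l = A i j (u l) + ((if l = i then comm_term k A u i j else 0)
     - (if l = j then comm_term k A u i j else 0))"

text \<open>The residues of the connection induced on the cohomology of the fibres: a family \<open>u\<close> with
  sum zero stands for the class of \<open>\<Sum>\<^sub>l u\<^sub>l dx / (x - t\<^sub>l)\<close>.\<close>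

definition fibre_op where
  "fibre_op k A i j v = pack k (bterm k A i j (full k v))"

section \<open>Residues of the induced system\<close>

context
  fixes k W A
  assumes g: "nonresonant (Suc k) (W :: nat list set) A" and k: "k < n"
begin

lemma linA: "i \<in> P (Suc k) \<Longrightarrow> j \<in> P (Suc k) \<Longrightarrow> linop K W (A i j)"
  by (rule nonresonant_lin[OF g])

lemma in_P: "i \<in> P k \<Longrightarrow> i \<in> P (Suc k)" "Suc k \<in> P (Suc k)"
  by (auto simp: P_Suc)

text \<open>The two corrections cancel in the sum, so the induced residues preserve families of sum
  zero.\<close>

lemma bterm_sum:
  assumes "i \<in> P k" "j \<in> P k" "(\<Sum>l\<in>P k. u l) = 0"
  shows "(\<Sum>l\<in>P k. bterm k A i j u l) = 0"
proof -
  have "(\<Sum>l\<in>P k. A i j (u l)) = A i j (\<Sum>l\<in>P k. u l)"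
    using linop_sum[OF linA[of i j], of u "P k"] in_P assms by simp
  also have "\<dots> = 0"
    unfolding assms(3) by (rule linop_0[OF linA]) (use assms in_P in auto)
  finally show ?thesis
    using assms(1,2) by (simp add: bterm_def sum.distrib sum_subtractf)
qed

lemma full_op:
  assumes "i \<in> P k" "j \<in> P k" "l \<in> P k"
  shows "full k (fibre_op k A i j v) l = bterm k A i j (full k v) l"
  unfolding fibre_op_def by (rule full_pack[OF bterm_sum[OF assms(1,2) full_sum] assms(3)])

lemma comm_term_lin:
  assumes "i \<in> P k" "j \<in> P k"
  shows "comm_term k A (full k (v + w)) i j = comm_term k A (full k v) i j + comm_term k A (full k w) i j"
    and "comm_term k A (full k (sc c v)) i j = sc c (comm_term k A (full k v) i j)"
  using linop_add[OF linA[of "Suc k" i]] linop_add[OF linA[of "Suc k" j]]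
    linop_sc[OF linA[of "Suc k" i]] linop_sc[OF linA[of "Suc k" j]] in_P assms
  by (simp_all add: comm_term_def full_add full_sc sc_diff)

lemma op_vecs:
  assumes "i \<in> P k" "j \<in> P k"
  shows "fibre_op k A i j v \<in> vecs (words k W) UNIV"
  unfolding fibre_op_def
proof (rule pack_vecs)
  fix l
  have "A a b f \<in> vecs W UNIV" if "a \<in> P (Suc k)" "b \<in> P (Suc k)" for a b f
    by (rule linop_UNIV[OF linA[OF that]])
  then show "bterm k A i j (full k v) l \<in> vecs W UNIV"
    using assms in_P by (simp add: bterm_def comm_term_def vecs_def)
qed

lemma op_lin:
  assumes ij: "i \<in> P k" "j \<in> P k"
  shows "linop K (words k W) (fibre_op k A i j)"
  unfolding linop_def
proof (intro conjI allI ballI impI)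
  have lin: "linop K W (A i j)"
    using linA in_P ij by blast
  fix v w c
  show "fibre_op k A i j (v + w) = fibre_op k A i j v + fibre_op k A i j w"
    unfolding fibre_op_def bterm_def comm_term_lin[OF ij] unfolding full_add linop_add[OF lin]
    by (auto simp: fun_eq_iff pack_def split: list.splits)
  show "fibre_op k A i j (sc c v) = sc c (fibre_op k A i j v)"
    unfolding fibre_op_def bterm_def comm_term_lin[OF ij] unfolding full_sc linop_sc[OF lin]
    by (auto simp: fun_eq_iff pack_def algebra_simps split: list.splits)
  show "fibre_op k A i j v \<in> vecs (words k W) K" if v: "v \<in> vecs (words k W) K"
    unfolding fibre_op_def
  proof (rule pack_vecs)
    fix l
    assume l: "l \<in> P k"
    have 1: "A a b (full k v c) \<in> vecs W K" if "a \<in> P (Suc k)" "b \<in> P (Suc k)" "c \<in> P k" for a b c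
      by (rule linop_K[OF linA[OF that(1,2)] full_K[OF v that(3)]])
    have K_diff: "a - b \<in> K" if "a \<in> K" "b \<in> K" for a b
      using K_add[OF that(1) K_uminus[OF that(2)]] by simp
    have 2: "comm_term k A (full k v) i j \<in> vecs W K"
      using 1[of "Suc k" j i] 1[of "Suc k" i j] ij in_P
      by (auto simp: comm_term_def vecs_def intro: K_diff)
    show "bterm k A i j (full k v) l \<in> vecs W K"
      using 1[of i j l] 2 ij l in_P
      by (auto simp: bterm_def vecs_def intro!: K_add K_diff K_0 K_uminus)
  qed
  show "fibre_op k A i j v w = 0" if "w \<notin> words k W" for w
    using op_vecs[OF ij, of v] that by (simp add: vecs_def)
qed

lemma op_sym:
  assumes "i \<in> P k" "j \<in> P k"
  shows "fibre_op k A i j = fibre_op k A j i"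
proof -
  have "A i j = A j i"
    by (rule nonresonant_sym[OF g]) (use assms in_P in auto)
  then have "bterm k A i j u = bterm k A j i u" for u
    by (auto simp: bterm_def comm_term_def fun_eq_iff)
  then have "bterm k A i j = bterm k A j i"
    by (rule ext)
  then show ?thesis
    unfolding fibre_op_def[abs_def] by (simp only:)
qed

lemma op_diag: "i \<in> P k \<Longrightarrow> fibre_op k A i i v = 0"
  using nonresonant_diag[OF g, of i] in_P
  by (auto simp: fibre_op_def bterm_def fun_eq_iff pack_def split: list.splits)

lemma residue_sum_A_insert:
  assumes "I \<subseteq> P k"
  shows "residue_sum A (insert (Suc k) I) f = residue_sum A I f + sc 2 (\<Sum>j\<in>I. A (Suc k) j f)"
proof (rule residue_sum_insert)
  show "A j (Suc k) f = A (Suc k) j f" if "j \<in> I" for j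
    using nonresonant_sym[OF g, of j "Suc k"] that assms in_P by auto
  show "finite I"
    by (rule finite_subset[OF assms finite_P])
qed (use assms nonresonant_diag[OF g, of "Suc k" f] Suc_notin_P[OF k] in_P in auto)

text \<open>Summing over both orders of each pair doubles the antisymmetric corrections. At entries
  \<open>l \<in> I\<close> they enlarge the partial sum of \<open>A\<close> by the new point, up to
  a term in the sum of the entries over \<open>I\<close>: this is the block triangular form.\<close>

lemma full_tot:
  assumes I: "I \<subseteq> P k" and l: "l \<in> P k"
  shows "full k (residue_sum (fibre_op k A) I v) l =
    (if l \<in> I then residue_sum A (insert (Suc k) I) (full k v l) - sc 2 (A (Suc k) l (\<Sum>j\<in>I. full k v j))
     else residue_sum A I (full k v l))"
proof -
  let ?u = "full k v" and ?C = "comm_term k A (full k v)"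
  have finI: "finite I"
    by (rule finite_subset[OF I finite_P])
  have "full k (residue_sum (fibre_op k A) I v) l = (\<Sum>i\<in>I. \<Sum>j\<in>I. bterm k A i j ?u l)"
    unfolding residue_sum_def full_setsum by (intro sum.cong refl full_op l) (use I in auto)
  also have "\<dots> = residue_sum A I (?u l) + ((\<Sum>i\<in>I. \<Sum>j\<in>I. if l = i then ?C i j else 0)
      - (\<Sum>i\<in>I. \<Sum>j\<in>I. if l = j then ?C i j else 0))"
    by (simp only: bterm_def sum.distrib sum_subtractf residue_sum_def)
  also have "(\<Sum>i\<in>I. \<Sum>j\<in>I. if l = i then ?C i j else 0) = (\<Sum>i\<in>I. if l = i then (\<Sum>j\<in>I. ?C i j) else 0)"
    by (rule sum.cong) auto
  also have "\<dots> = (if l \<in> I then (\<Sum>j\<in>I. ?C l j) else 0)"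
    using finI by simp
  also have "(\<Sum>i\<in>I. \<Sum>j\<in>I. if l = j then ?C i j else 0) = (if l \<in> I then (\<Sum>i\<in>I. ?C i l) else 0)"
    using finI by simp
  finally have eq: "full k (residue_sum (fibre_op k A) I v) l = residue_sum A I (?u l) +
    ((if l \<in> I then (\<Sum>j\<in>I. ?C l j) else 0) - (if l \<in> I then (\<Sum>i\<in>I. ?C i l) else 0))" .
  show ?thesis
  proof (cases "l \<in> I")
    case True
    have "(\<Sum>i\<in>I. ?C i l) = - (\<Sum>j\<in>I. ?C l j)"
      by (simp add: comm_term_def flip: sum_negf)
    moreover have "A (Suc k) l (\<Sum>j\<in>I. ?u j) = (\<Sum>j\<in>I. A (Suc k) l (?u j))"
      by (rule linop_sum[OF linA]) (use l in_P in auto)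
    then have "(\<Sum>j\<in>I. ?C l j) = (\<Sum>j\<in>I. A (Suc k) j (?u l)) - A (Suc k) l (\<Sum>j\<in>I. ?u j)"
      by (simp only: comm_term_def sum_subtractf)
    moreover have "(a - b) - - (a - b) = sc 2 a - sc 2 b" for a b :: "nat list \<Rightarrow> 'e"
      by (simp add: fun_eq_iff algebra_simps)
    ultimately show ?thesis
      using True by (simp only: eq residue_sum_A_insert[OF I] if_True add_diff_eq)
  next
    case False
    then show ?thesis
      by (simp only: eq if_False diff_self add_0_right)
  qed
qed

text \<open>For \<open>I = P k\<close> every entry lies in \<open>I\<close>. Its diagonal block is
  the total sum one level up, and the coupling term contains the sum of all entries; both
  vanish.\<close>

lemma op_total: "residue_sum (fibre_op k A) (P k) v = 0"
proof (rule full_eqI)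
  have "linop K (words k W) (residue_sum (fibre_op k A) (P k))"
    by (rule residue_sum_lin) (rule op_lin)
  then show "residue_sum (fibre_op k A) (P k) v \<in> vecs (words k W) UNIV"
    by (rule linop_UNIV)
  show "(0 :: nat list \<Rightarrow> 'e) \<in> vecs (words k W) UNIV"
    by (rule vecs_0) simp
  fix l
  assume l: "l \<in> P k"
  have "A (Suc k) l 0 = 0"
    by (rule linop_0[OF linA]) (use l in_P in auto)
  then show "full k (residue_sum (fibre_op k A) (P k) v) l = full k 0 l"
    using l nonresonant_total[OF g] by (simp add: full_tot full_sum full_0 flip: P_Suc)
qed

text \<open>The sum over \<open>I\<close> of the unknown family solves the equation for \<open>A\<^sub>I\<close>. Once it is known, the
  entries outside \<open>I\<close> solve the equation for \<open>A\<^sub>I\<close> and those in \<open>I\<close> the one for \<open>A\<^sub>I\<^sub>\<union>\<^sub>x\<close>.\<close>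

lemma op_invertible:
  assumes I: "I \<subseteq> P k" "2 \<le> card I" "card I \<le> k + 1"
  shows "invertible (words k W) (\<lambda>f. residue_sum (fibre_op k A) I f - sc (2 * of_int m) f)"
proof -
  let ?c = "2 * of_int m :: 'e" and ?I' = "insert (Suc k) I"
  let ?T1 = "\<lambda>f. residue_sum A I f - sc ?c f" and ?T2 = "\<lambda>f. residue_sum A ?I' f - sc ?c f"
  have finI: "finite I"
    by (rule finite_subset[OF I(1) finite_P])
  have "Suc k \<notin> I"
    using Suc_notin_P[OF k] I(1) by auto
  then have card': "2 \<le> card ?I'" "card ?I' \<le> Suc k + 1"
    using I finI by auto
  have sub: "I \<subseteq> P (Suc k)" "?I' \<subseteq> P (Suc k)"
    using I(1) by (auto simp: P_Suc)
  obtain G1 where G1: "linop K W G1" "\<And>f. f \<in> vecs W UNIV \<Longrightarrow> ?T1 (G1 f) = f"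
      "\<And>f. f \<in> vecs W UNIV \<Longrightarrow> G1 (?T1 f) = f"
    using nonresonant_inv[OF g sub(1) I(2)] I(3) unfolding invertible_def by fastforce
  obtain G2 where G2: "linop K W G2" "\<And>f. f \<in> vecs W UNIV \<Longrightarrow> ?T2 (G2 f) = f"
      "\<And>f. f \<in> vecs W UNIV \<Longrightarrow> G2 (?T2 f) = f"
    using nonresonant_inv[OF g sub(2) card'] unfolding invertible_def by fastforce
  have linT: "linop K W (residue_sum A I)" "linop K W (residue_sum A ?I')"
    using sub by (auto intro!: residue_sum_lin linA)
  have linAk: "linop K W (A (Suc k) l)" if "l \<in> P k" for l
    using that in_P linA by blast
  have T12: "?T2 f = ?T1 f + sc 2 (\<Sum>j\<in>I. A (Suc k) j f)" for f
    by (simp add: residue_sum_A_insert[OF I(1)])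
  \<comment> \<open>Adding the equations for the entries in \<open>I\<close> cancels the coupling
    against the terms with the new point, which leaves \<open>?T1\<close> acting on the sum of the
    unknowns.\<close>
  define sm where "sm u = G1 (\<Sum>j\<in>I. u j)" for u :: "nat \<Rightarrow> nat list \<Rightarrow> 'e"
  define y where "y u l = (if l \<in> I then G2 (u l + sc 2 (A (Suc k) l (sm u))) else G1 (u l))"
    for u :: "nat \<Rightarrow> nat list \<Rightarrow> 'e" and l
  define G where "G v = pack k (y (full k v))" for v
  have sum_in: "(\<Sum>j\<in>J. full k v j) \<in> vecs W UNIV" if "v \<in> vecs (words k W) UNIV" "J \<subseteq> P k" for v J
    using that by (intro vecs_sum full_UNIV) auto
  have sm_in: "sm u \<in> vecs W UNIV" for u
    unfolding sm_def by (rule linop_UNIV[OF G1(1)])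
  \<comment> \<open>The entries in \<open>I\<close> are computed from a predicted sum. They do add
    up to it, and the others add up to its negative, so the family has sum zero and survives
    packing.\<close>
  have y_sum: "(\<Sum>l\<in>I. y (full k v) l) = sm (full k v)" "(\<Sum>l\<in>P k. y (full k v) l) = 0"
    if v: "v \<in> vecs (words k W) UNIV" for v
  proof -
    let ?u = "full k v"
    have "(\<Sum>l\<in>I. y ?u l) = (\<Sum>l\<in>I. G2 (?u l + sc 2 (A (Suc k) l (sm ?u))))"
      by (rule sum.cong) (auto simp: y_def)
    also have "\<dots> = G2 (\<Sum>l\<in>I. ?u l + sc 2 (A (Suc k) l (sm ?u)))"
      by (rule linop_sum[OF G2(1), symmetric])
    also have "(\<Sum>l\<in>I. ?u l + sc 2 (A (Suc k) l (sm ?u))) = ?T2 (sm ?u)"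
      unfolding T12 using G1(2)[OF sum_in[OF v I(1)]]
      by (simp only: sum.distrib sc_sum sm_def)
    also have "G2 (?T2 (sm ?u)) = sm ?u"
      by (rule G2(3)[OF sm_in])
    finally show 1: "(\<Sum>l\<in>I. y ?u l) = sm ?u" .
    have "(\<Sum>l\<in>P k - I. y ?u l) = (\<Sum>l\<in>P k - I. G1 (?u l))"
      by (rule sum.cong) (auto simp: y_def)
    also have "\<dots> = G1 (\<Sum>l\<in>P k - I. ?u l)"
      by (rule linop_sum[OF G1(1), symmetric])
    also have "(\<Sum>l\<in>P k - I. ?u l) = - (\<Sum>l\<in>I. ?u l)"
      using sum.subset_diff[OF I(1) finite_P, of ?u] full_sum[of k v]
      by (metis eq_neg_iff_add_eq_0)
    also have "G1 (- (\<Sum>l\<in>I. ?u l)) = - sm ?u"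
      unfolding sm_def by (rule linop_minus[OF G1(1)])
    finally show "(\<Sum>l\<in>P k. y ?u l) = 0"
      using sum.subset_diff[OF I(1) finite_P, of "y ?u"] 1 by simp
  qed
  have fullG: "full k (G v) l = y (full k v) l" if "v \<in> vecs (words k W) UNIV" "l \<in> P k" for v l
    unfolding G_def by (rule full_pack[OF y_sum(2)[OF that(1)] that(2)])
  have y_in: "y u l \<in> vecs W UNIV" for u l
    using linop_UNIV[OF G1(1)] linop_UNIV[OF G2(1)] by (simp add: y_def)
  have G_in: "G v \<in> vecs (words k W) UNIV" for v
    unfolding G_def by (rule pack_vecs[OF y_in])
  have linB: "linop K (words k W) (residue_sum (fibre_op k A) I)"
    by (rule residue_sum_lin) (use I(1) op_lin in auto)
  let ?L = "\<lambda>f. residue_sum (fibre_op k A) I f - sc ?c f"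
  have L_in: "?L v \<in> vecs (words k W) UNIV" if "v \<in> vecs (words k W) UNIV" for v
    using linop_UNIV[OF linB, of v] that by (auto simp: vecs_def)
  have fullL: "full k (?L v) l = (if l \<in> I then ?T2 (full k v l) - sc 2 (A (Suc k) l (\<Sum>j\<in>I. full k v j))
      else ?T1 (full k v l))" if "l \<in> P k" for v l
    unfolding full_diff full_sc full_tot[OF I(1) that] by auto
  have LG: "?L (G v) = v" if v: "v \<in> vecs (words k W) UNIV" for v
  proof (rule full_eqI[OF L_in[OF G_in] v])
    fix l
    assume l: "l \<in> P k"
    let ?u = "full k v"
    have "(\<Sum>j\<in>I. full k (G v) j) = (\<Sum>j\<in>I. y ?u j)"
      by (rule sum.cong) (use fullG[OF v] I(1) in auto)
    then have S: "(\<Sum>j\<in>I. full k (G v) j) = sm ?u"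
      by (simp only: y_sum(1)[OF v])
    show "full k (?L (G v)) l = full k v l"
    proof (cases "l \<in> I")
      case True
      have in2: "?u l + sc 2 (A (Suc k) l (sm ?u)) \<in> vecs W UNIV"
        using full_UNIV[OF v l] linop_UNIV[OF linAk[OF l], of "sm ?u"] by (auto simp: vecs_def)
      have "full k (?L (G v)) l = ?T2 (G2 (?u l + sc 2 (A (Suc k) l (sm ?u)))) - sc 2 (A (Suc k) l (sm ?u))"
        unfolding fullL[OF l] S fullG[OF v l] using True by (simp only: if_True y_def)
      then show ?thesis
        unfolding G2(2)[OF in2] by (simp only: add_diff_cancel_right')
    next
      case False
      have "full k (?L (G v)) l = ?T1 (G1 (?u l))"
        unfolding fullL[OF l] fullG[OF v l] using False by (simp only: if_False y_def)
      then show ?thesis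
        by (simp only: G1(2)[OF full_UNIV[OF v l]])
    qed
  qed
  have GL: "G (?L v) = v" if v: "v \<in> vecs (words k W) UNIV" for v
  proof (rule full_eqI[OF G_in v])
    fix l
    assume l: "l \<in> P k"
    let ?u = "full k v"
    let ?S = "\<Sum>j\<in>I. ?u j"
    have "(\<Sum>j\<in>I. full k (?L v) j) = (\<Sum>j\<in>I. ?T2 (?u j) - sc 2 (A (Suc k) j ?S))"
      by (rule sum.cong) (use fullL I(1) in auto)
    also have "\<dots> = (\<Sum>j\<in>I. ?T2 (?u j)) - sc 2 (\<Sum>j\<in>I. A (Suc k) j ?S)"
      by (simp only: sum_subtractf sc_sum)
    also have "(\<Sum>j\<in>I. ?T2 (?u j)) = ?T2 ?S"
      by (simp only: sum_subtractf linop_sum[OF linT(2)] sc_sum)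
    also have "?T2 ?S - sc 2 (\<Sum>j\<in>I. A (Suc k) j ?S) = ?T1 ?S"
      unfolding T12 by (simp only: add_diff_cancel_right')
    finally have S: "sm (full k (?L v)) = ?S"
      unfolding sm_def by (simp only: G1(3)[OF sum_in[OF v I(1)]])
    show "full k (G (?L v)) l = full k v l"
      unfolding fullG[OF L_in[OF v] l] y_def S unfolding fullL[OF l]
      using G1(3)[OF full_UNIV[OF v l]] G2(3)[OF full_UNIV[OF v l]] by simp
  qed
  have linG: "linop K (words k W) G"
    unfolding linop_def
  proof (intro conjI allI ballI impI)
    have sm_add: "sm (\<lambda>l. u l + u' l) = sm u + sm u'" for u u'
      unfolding sm_def sum.distrib by (rule linop_add[OF G1(1)])
    have sm_sc: "sm (\<lambda>l. sc c (u l)) = sc c (sm u)" for u c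
      unfolding sm_def sc_sum[symmetric] by (rule linop_sc[OF G1(1)])
    fix v w c
    have "y (full k (v + w)) l = y (full k v) l + y (full k w) l" if "l \<in> P k" for l
      unfolding y_def full_add sm_add linop_add[OF G1(1)] linop_add[OF linAk[OF that]] sc_add
      by (simp add: add_ac flip: linop_add[OF G2(1)])
    then show "G (v + w) = G v + G w"
      by (auto simp: G_def pack_def fun_eq_iff split: list.splits)
    have "y (full k (sc c v)) l = sc c (y (full k v) l)" if "l \<in> P k" for l
      unfolding y_def full_sc sm_sc linop_sc[OF G1(1)] linop_sc[OF linAk[OF that]]
      by (simp add: sc_add mult.commute flip: linop_sc[OF G2(1)])
    then show "G (sc c v) = sc c (G v)"
      by (auto simp: G_def pack_def fun_eq_iff split: list.splits)
    show "G v w' = 0" if "w' \<notin> words k W" for w'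
      using G_in[of v] that by (simp add: vecs_def)
    show "G v \<in> vecs (words k W) K" if v: "v \<in> vecs (words k W) K"
      unfolding G_def
    proof (rule pack_vecs)
      fix l
      assume l: "l \<in> P k"
      have "sm (full k v) \<in> vecs W K"
        unfolding sm_def using I(1)
        by (intro linop_K[OF G1(1)] vecs_sum K_0 K_add full_K[OF v]) auto
      then have "A (Suc k) l (sm (full k v)) \<in> vecs W K"
        by (rule linop_K[OF linAk[OF l]])
      then have "full k v l + sc 2 (A (Suc k) l (sm (full k v))) \<in> vecs W K"
        using full_K[OF v l] by (auto simp: vecs_def intro: K_add K_mult two_K)
      then show "y (full k v) l \<in> vecs W K"
        unfolding y_def using linop_K[OF G2(1)] linop_K[OF G1(1) full_K[OF v l]] by auto
    qed
  qed
  show ?thesis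
    unfolding invertible_def using linG LG GL by blast
qed

end

end

section \<open>The Gauss-Manin identity and the inheritance of nonresonance\<close>

context simplicial
begin

definition fibre_form :: "nat \<Rightarrow> (nat list \<Rightarrow> 'e) \<Rightarrow> nat list \<Rightarrow> 'e" where
  "fibre_form k v = (\<Sum>j\<in>P k. sc (1 / (t (Suc k) - t j)) (full k v j))"

lemma kz_dv: "kz k A i f = dv i f + (\<Sum>j\<in>P k - {i}. sc (1 / (t i - t j)) (A i j f))"
  by (simp only: kz_def dv_def)

lemma fibre_form_add: "fibre_form k (v + w) = fibre_form k v + fibre_form k w"
  by (simp add: fibre_form_def full_add sc_add sum.distrib)

lemma fibre_form_sc: "fibre_form k (sc c v) = sc c (fibre_form k v)"
  by (simp only: fibre_form_def full_sc sc_sum sc_simps mult.commute)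

lemma fibre_form_0: "fibre_form k 0 = 0"
  using fibre_form_sc[of k 0 0] by simp

lemma fibre_form_diff: "fibre_form k (v - w) = fibre_form k v - fibre_form k w"
  by (simp add: fibre_form_def full_diff sc_diff sum_subtractf)

lemma fibre_form_sum: "fibre_form k (\<Sum>a\<in>S. F a) = (\<Sum>a\<in>S. fibre_form k (F a))"
proof (induction S rule: infinite_finite_induct)
  case (insert a S)
  then show ?case
    unfolding sum.insert[OF insert(1,2)] fibre_form_add by simp
next
  case (infinite S)
  show ?case
    unfolding sum.infinite[OF infinite] by (rule fibre_form_0)
next
  case empty
  show ?case
    unfolding sum.empty by (rule fibre_form_0)
qed

lemma fibre_form_M:
  assumes "v \<in> M k (words k W)" "k < n"
  shows "fibre_form k v \<in> M (Suc k) W"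
  unfolding fibre_form_def
proof (intro M_sum M_sc)
  fix j
  assume j: "j \<in> P k"
  show "full k v j \<in> M (Suc k) W"
    by (rule M_mono[OF full_M[OF assms(1) j]]) simp
  show "1 / (t (Suc k) - t j) \<in> R (Suc k)"
    using j Suc_notin_P[OF assms(2)] by (intro R_inv) (auto simp: P_Suc)
qed

context
  fixes k W A
  assumes g: "nonresonant (Suc k) (W :: nat list set) A" and k: "k < n"
begin

text \<open>Besides uniqueness of representatives this transports identities: two families on the
  base agree as soon as their fibre forms differ by an element exact in the last direction.\<close>

lemma fibre_form_inj:
  assumes v: "v \<in> M k (words k W)" and h: "h \<in> M (Suc k) W"
    and eq: "fibre_form k v = kz (Suc k) A (Suc k) h"
  shows "v = 0"
proof (rule full_eqI)
  show "v \<in> vecs (words k W) UNIV" "(0 :: nat list \<Rightarrow> 'e) \<in> vecs (words k W) UNIV"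
    using M_vecs[OF v] by (auto intro: vecs_0)
  show "full k v l = full k 0 l" if "l \<in> P k" for l
    using fibre_independent[OF g k full_M[OF v] full_sum h _ that] eq by (simp only: fibre_form_def full_0)
qed

text \<open>The induced system is the Gauss-Manin connection. Moving \<open>t i\<close> moves the
  pole there, so the derivative in direction \<open>i\<close> acquires a double pole. The exact term
  is chosen to cancel it, which leaves products of two simple poles to be split by partial
  fractions.\<close>

lemma gauss_manin:
  assumes i: "i \<in> {1..k}" and v: "v \<in> M k (words k W)"
  shows "fibre_form k (kz k (fibre_op k A) i v) = kz (Suc k) A i (fibre_form k v) +
    kz (Suc k) A (Suc k) (sc (1 / (t (Suc k) - t i)) (full k v i))"
proof -
  define e where "e j = 1 / (t (Suc k) - t j)" for j
  define u where "u = full k v"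
  define C where "C = comm_term k A u i"
  let ?Pi = "P k - {i}"
  have iP: "i \<in> P k" "i \<in> {1..n}" "i \<noteq> Suc k"
    using i k by (auto simp: P_def)
  have PSi: "P (Suc k) - {i} = insert (Suc k) ?Pi" "Suc k \<notin> ?Pi"
    using iP Suc_notin_P[OF k] by (auto simp: P_Suc)
  have PSk: "P (Suc k) - {Suc k} = P k"
    using Suc_notin_P[OF k] by (auto simp: P_Suc)
  have PiP: "insert i ?Pi = P k"
    using iP by auto
  have lin: "linop K W (A a b)" if "a \<in> P (Suc k)" "b \<in> P (Suc k)" for a b
    by (rule nonresonant_lin[OF g that])
  have in_P: "j \<in> P (Suc k)" "Suc k \<in> P (Suc k)" if "j \<in> P k" for j
    using that by (auto simp: P_Suc)
  have neq: "t (Suc k) \<noteq> t j" if "j \<in> P k" for j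
    by (rule x_neq[OF k that])
  have PSn: "P (Suc k) \<subseteq> P n"
    using k by (intro P_mono) simp
  have Sn: "Suc k \<in> P n"
    using k by (simp add: P_def)
  have in_Pn: "j \<in> P n" if "j \<in> P k" for j
    using PSn k that by (auto simp: P_Suc P_def)
  have De: "D l (e j) = - (D l (t (Suc k)) - D l (t j)) * (e j * e j)" if "j \<in> P k" for l j
    unfolding e_def using that PSn in_P[OF that] Suc_notin_P[OF k] by (intro D_inv) auto
  have Die: "D i (e j) = (if j = i then e i * e i else 0)" if "j \<in> P k" for j
    using De[OF that, of i] D_t'[OF iP(2) Sn] D_t'[OF iP(2) in_Pn[OF that]] iP(3) by auto
  have Dke: "D (Suc k) (e i) = - (e i * e i)"
    using De[OF iP(1), of "Suc k"] D_t'[OF _ Sn, of "Suc k"] D_t'[OF _ in_Pn[OF iP(1)], of "Suc k"] iP(3) k by auto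
  have Dku: "dv (Suc k) (u i) = 0"
  proof
    fix w
    show "dv (Suc k) (u i) w = 0 w"
      using M_in[OF full_M[OF v iP(1)], of w] k by (auto simp: u_def intro: D_vanish[of _ k])
  qed
  have F: "fibre_form k v = (\<Sum>j\<in>P k. sc (e j) (u j))"
    by (simp add: fibre_form_def e_def u_def)
  have 1: "dv i (fibre_form k v) = sc (e i * e i) (u i) + (\<Sum>j\<in>P k. sc (e j) (dv i (u j)))"
  proof -
    have "(\<Sum>j\<in>P k. sc (D i (e j)) (u j)) = (\<Sum>j\<in>P k. if j = i then sc (e i * e i) (u i) else 0)"
      by (rule sum.cong) (auto simp: Die)
    then show ?thesis
      using iP(1) by (simp add: F dv_sum dv_sc sum.distrib)
  qed
  have AF: "A a b (fibre_form k v) = (\<Sum>j\<in>P k. sc (e j) (A a b (u j)))" if "a \<in> P (Suc k)" "b \<in> P (Suc k)" for a b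
    unfolding F linop_sum[OF lin[OF that]] linop_sc[OF lin[OF that]] ..
  have 2: "(\<Sum>l\<in>?Pi. sc (1 / (t i - t l)) (A i l (fibre_form k v))) =
      (\<Sum>j\<in>P k. sc (e j) (\<Sum>l\<in>?Pi. sc (1 / (t i - t l)) (A i l (u j))))"
  proof -
    have "(\<Sum>l\<in>?Pi. sc (1 / (t i - t l)) (A i l (fibre_form k v))) =
        (\<Sum>l\<in>?Pi. sc (1 / (t i - t l)) (\<Sum>j\<in>P k. sc (e j) (A i l (u j))))"
      by (rule sum.cong) (use AF in_P iP in auto)
    also have "\<dots> = (\<Sum>j\<in>P k. \<Sum>l\<in>?Pi. sc (1 / (t i - t l)) (sc (e j) (A i l (u j))))"
      unfolding sc_sum by (rule sum.swap)
    finally show ?thesis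
      by (simp only: sc_sum sc_simps mult.commute)
  qed
  have 3: "sc (1 / (t i - t (Suc k))) (A i (Suc k) (fibre_form k v)) =
      - (\<Sum>j\<in>P k. sc (e i * e j) (A (Suc k) i (u j)))"
  proof -
    have "1 / (t i - t (Suc k)) = - e i"
      unfolding e_def by (metis minus_diff_eq minus_divide_right)
    moreover have "A i (Suc k) = A (Suc k) i"
      by (rule nonresonant_sym[OF g]) (use in_P iP in auto)
    ultimately show ?thesis
      using AF[OF in_P(2)[OF iP(1)] in_P(1)[OF iP(1)]]
      by (simp only: sc_minus sc_sum sc_simps mult_minus_left sum_negf)
  qed
  \<comment> \<open>The exact term brings the opposite of the double pole in \<open>1\<close>,
    together with the products in which \<open>A (Suc k) j\<close> acts on \<open>u i\<close>, one
    half of \<open>comm_term\<close>.\<close>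
  have 4: "kz (Suc k) A (Suc k) (sc (e i) (u i)) = - sc (e i * e i) (u i)
      + (\<Sum>j\<in>P k. sc (e i * e j) (A (Suc k) j (u i)))"
  proof -
    have "(\<Sum>j\<in>P k. sc (1 / (t (Suc k) - t j)) (A (Suc k) j (sc (e i) (u i)))) =
        (\<Sum>j\<in>P k. sc (e i * e j) (A (Suc k) j (u i)))"
    proof (rule sum.cong)
      fix j
      assume "j \<in> P k"
      then have "A (Suc k) j (sc (e i) (u i)) = sc (e i) (A (Suc k) j (u i))"
        using in_P by (intro linop_sc[OF lin]) auto
      then show "sc (1 / (t (Suc k) - t j)) (A (Suc k) j (sc (e i) (u i))) = sc (e i * e j) (A (Suc k) j (u i))"
        by (simp add: e_def mult.commute)
    qed simp
    moreover have "dv (Suc k) (sc (e i) (u i)) = - sc (e i * e i) (u i)"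
      by (simp add: dv_sc Dku Dke sc_minus)
    ultimately show ?thesis
      unfolding kz_dv PSk by (simp only:)
  qed
  have 5: "kz (Suc k) A i (fibre_form k v) = sc (e i * e i) (u i) + (\<Sum>j\<in>P k. sc (e j) (dv i (u j)))
      + (- (\<Sum>j\<in>P k. sc (e i * e j) (A (Suc k) i (u j)))
        + (\<Sum>j\<in>P k. sc (e j) (\<Sum>l\<in>?Pi. sc (1 / (t i - t l)) (A i l (u j)))))"
    unfolding kz_dv PSi(1) using PSi(2) by (simp only: 1 2 3 sum.insert finite_P finite_Diff simp_thms)
  have C: "(\<Sum>j\<in>P k. sc (e i * e j) (A (Suc k) j (u i))) - (\<Sum>j\<in>P k. sc (e i * e j) (A (Suc k) i (u j)))
      = (\<Sum>j\<in>?Pi. sc (e i * e j) (C j))"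
  proof -
    have "C i = 0"
      by (simp add: C_def comm_term_def)
    then have "(\<Sum>j\<in>?Pi. sc (e i * e j) (C j)) = (\<Sum>j\<in>P k. sc (e i * e j) (C j))"
      using sum.remove[OF finite_P iP(1), of "\<lambda>j. sc (e i * e j) (C j)"] by simp
    then show ?thesis
      by (simp add: C_def comm_term_def sc_diff sum_subtractf)
  qed
  have 6: "fibre_form k (kz k (fibre_op k A) i v) = (\<Sum>j\<in>P k. sc (e j) (dv i (u j)))
      + (\<Sum>j\<in>P k. sc (e j) (\<Sum>l\<in>?Pi. sc (1 / (t i - t l)) (A i l (u j))))
      + (\<Sum>j\<in>?Pi. sc (e i * e j) (C j))"
  proof -
    have fn: "full k (kz k (fibre_op k A) i v) j = dv i (u j)
        + ((\<Sum>l\<in>?Pi. sc (1 / (t i - t l)) (A i l (u j)))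
        + ((\<Sum>l\<in>?Pi. if j = i then sc (1 / (t i - t l)) (C l) else 0)
         - (\<Sum>l\<in>?Pi. if j = l then sc (1 / (t i - t l)) (C l) else 0)))" if "j \<in> P k" for j
    proof -
      have "full k (\<Sum>l\<in>?Pi. sc (1 / (t i - t l)) (fibre_op k A i l v)) j =
          (\<Sum>l\<in>?Pi. sc (1 / (t i - t l)) (bterm k A i l u j))"
        unfolding full_setsum full_sc u_def
        by (rule sum.cong) (use full_op[OF g k iP(1) _ that] in auto)
      also have "\<dots> = (\<Sum>l\<in>?Pi. sc (1 / (t i - t l)) (A i l (u j))
          + ((if j = i then sc (1 / (t i - t l)) (C l) else 0)
           - (if j = l then sc (1 / (t i - t l)) (C l) else 0)))"
        by (rule sum.cong) (auto simp: bterm_def C_def sc_add sc_diff sc_minus)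
      finally show ?thesis
        unfolding kz_dv full_add full_dv u_def[symmetric]
        by (simp only: sum.distrib sum_subtractf)
    qed
    have "(\<Sum>j\<in>P k. sc (e j) (\<Sum>l\<in>?Pi. if j = i then sc (1 / (t i - t l)) (C l) else 0)) =
        (\<Sum>l\<in>?Pi. sc (e i * (1 / (t i - t l))) (C l))"
    proof -
      have "(\<Sum>j\<in>P k. sc (e j) (\<Sum>l\<in>?Pi. if j = i then sc (1 / (t i - t l)) (C l) else 0)) =
         (\<Sum>j\<in>P k. if j = i then sc (e i) (\<Sum>l\<in>?Pi. sc (1 / (t i - t l)) (C l)) else 0)"
        by (rule sum.cong) auto
      then show ?thesis
        using iP(1) by (simp add: sc_sum)
    qed
    moreover have "(\<Sum>j\<in>P k. sc (e j) (\<Sum>l\<in>?Pi. if j = l then sc (1 / (t i - t l)) (C l) else 0)) =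
        (\<Sum>l\<in>?Pi. sc (e l * (1 / (t i - t l))) (C l))"
    proof -
      have "(\<Sum>j\<in>P k. sc (e j) (\<Sum>l\<in>?Pi. if j = l then sc (1 / (t i - t l)) (C l) else 0)) =
         (\<Sum>j\<in>P k. if j \<in> ?Pi then sc (e j * (1 / (t i - t j))) (C j) else 0)"
        by (rule sum.cong) auto
      also have "\<dots> = (\<Sum>j\<in>?Pi. sc (e j * (1 / (t i - t j))) (C j))"
        by (rule sum.mono_neutral_cong_right) auto
      finally show ?thesis .
    qed
    \<comment> \<open>Since \<open>(e i - e l) / (t i - t l) = e i * e l\<close>, the two placements
      of \<open>C\<close> recombine to the product of poles.\<close>
    moreover have "(\<Sum>l\<in>?Pi. sc (e i * (1 / (t i - t l))) (C l)) - (\<Sum>l\<in>?Pi. sc (e l * (1 / (t i - t l))) (C l))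
       = (\<Sum>l\<in>?Pi. sc (e i * e l) (C l))"
      unfolding sum_subtractf[symmetric] sc_diff[symmetric]
    proof (rule sum.cong)
      fix l
      assume l: "l \<in> ?Pi"
      have "t i \<noteq> t l"
        using l iP PSn in_P by (intro t_neq) auto
      then have "e i * (1 / (t i - t l)) - e l * (1 / (t i - t l)) = e i * e l"
        using neq[OF iP(1)] neq[of l] l by (simp add: e_def divide_simps)
      then show "sc (e i * (1 / (t i - t l)) - e l * (1 / (t i - t l))) (C l) = sc (e i * e l) (C l)"
        by simp
    qed simp
    moreover have "fibre_form k (kz k (fibre_op k A) i v) =
      (\<Sum>j\<in>P k. sc (e j) (dv i (u j)
        + ((\<Sum>l\<in>?Pi. sc (1 / (t i - t l)) (A i l (u j)))
        + ((\<Sum>l\<in>?Pi. if j = i then sc (1 / (t i - t l)) (C l) else 0)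
         - (\<Sum>l\<in>?Pi. if j = l then sc (1 / (t i - t l)) (C l) else 0)))))"
      unfolding fibre_form_def by (rule sum.cong) (auto simp only: e_def fn)
    ultimately show ?thesis
      by (simp only: sc_add sc_diff sum.distrib sum_subtractf add.assoc)
  qed
  have grp: "a + b + c = (x + a + (- z + b)) + (- x + y)" if "y - z = c" for a b c x y z :: "nat list \<Rightarrow> 'e"
    using that by (simp add: fun_eq_iff algebra_simps)
  show ?thesis
    unfolding 6 5 unfolding u_def[symmetric] e_def[symmetric] 4 by (rule grp[OF C])
qed

text \<open>Only commutation remains to be argued. By \<open>gauss_manin\<close> the fibre form of
  the commutator differs from the commutator upstairs, which is 0, by an element exact in the last
  direction; \<open>fibre_form_inj\<close> concludes.\<close>

lemma nonresonant_fibre: "nonresonant k (words k W) (fibre_op k A)"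
proof -
  let ?B = "fibre_op k A"
  have fin: "finite (words k W)"
    by (rule finite_words[OF nonresonant_fin[OF g]])
  have linB: "linop K (words k W) (?B i j)" if "i \<in> P k" "j \<in> P k" for i j
    by (rule op_lin[OF g k that])
  have linA: "linop K W (A i j)" if "i \<in> P (Suc k)" "j \<in> P (Suc k)" for i j
    by (rule nonresonant_lin[OF g that])
  have nabA_M: "kz (Suc k) A i f \<in> M (Suc k) W" if "f \<in> M (Suc k) W" "i \<in> {1..Suc k}" for i f
    using nonresonant_fin[OF g] linA that k by (intro kz_M) (auto simp: P_def)
  have nabB_M: "kz k ?B i f \<in> M k (words k W)" if "f \<in> M k (words k W)" "i \<in> {1..k}" for i f
    using fin linB that k by (intro kz_M) (auto simp: P_def)
  have nabA_add: "kz (Suc k) A i (f + h) = kz (Suc k) A i f + kz (Suc k) A i h" if "i \<in> {1..Suc k}" for i f h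
    using linA that by (intro kz_add) (auto simp: P_def)
  have nabA_diff: "kz (Suc k) A i (f - h) = kz (Suc k) A i f - kz (Suc k) A i h" if "i \<in> {1..Suc k}" for i f h
    using linA that by (intro kz_diff) (auto simp: P_def)
  define q where "q v i = sc (1 / (t (Suc k) - t i)) (full k v i)" for v i
  have q_M: "q v i \<in> M (Suc k) W" if "v \<in> M k (words k W)" "i \<in> {1..k}" for v i
    unfolding q_def using that k
    by (intro M_sc M_mono[OF full_M] R_inv) (auto simp: P_def)
  have gm: "fibre_form k (kz k ?B i v) = kz (Suc k) A i (fibre_form k v) + kz (Suc k) A (Suc k) (q v i)"
    if "v \<in> M k (words k W)" "i \<in> {1..k}" for v i
    unfolding q_def by (rule gauss_manin[OF that(2,1)])
  have comm: "kz k ?B i (kz k ?B j v) = kz k ?B j (kz k ?B i v)"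
    if i: "i \<in> {1..k}" and j: "j \<in> {1..k}" and v: "v \<in> M k (words k W)" for i j v
  proof -
    let ?N = "kz (Suc k) A"
    \<comment> \<open>Commuting \<open>?N i\<close> past \<open>?N (Suc k)\<close> keeps all
      correction terms in the image of the single operator \<open>?N (Suc k)\<close>.\<close>
    have two: "fibre_form k (kz k ?B i (kz k ?B j v)) =
        ?N i (?N j (fibre_form k v)) + ?N (Suc k) (?N i (q v j) + q (kz k ?B j v) i)"
      if i: "i \<in> {1..k}" and j: "j \<in> {1..k}" for i j
    proof -
      have i': "i \<in> {1..Suc k}" and k': "Suc k \<in> {1..Suc k}"
        using i by auto
      have "?N i (?N (Suc k) (q v j)) = ?N (Suc k) (?N i (q v j))"
        by (rule nonresonant_comm[OF g i' k' q_M[OF v j]])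
      then show ?thesis
        unfolding gm[OF nabB_M[OF v j] i] gm[OF v j] nabA_add[OF i'] nabA_add[OF k'] by (simp only: add.assoc)
    qed
    have ij: "?N i (?N j (fibre_form k v)) = ?N j (?N i (fibre_form k v))"
      using i j by (intro nonresonant_comm[OF g] fibre_form_M[OF v k]) auto
    have "kz k ?B i (kz k ?B j v) - kz k ?B j (kz k ?B i v) = 0"
    proof (rule fibre_form_inj)
      show "kz k ?B i (kz k ?B j v) - kz k ?B j (kz k ?B i v) \<in> M k (words k W)"
        using i j v by (intro M_diff nabB_M)
      let ?h1 = "?N i (q v j) + q (kz k ?B j v) i" and ?h2 = "?N j (q v i) + q (kz k ?B i v) j"
      have "?N i (q v j) \<in> M (Suc k) W" "?N j (q v i) \<in> M (Suc k) W"
        using i j by (auto intro!: nabA_M q_M[OF v])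
      then show "?h1 - ?h2 \<in> M (Suc k) W"
        using i j v by (intro M_diff M_add q_M nabB_M)
      show "fibre_form k (kz k ?B i (kz k ?B j v) - kz k ?B j (kz k ?B i v)) = ?N (Suc k) (?h1 - ?h2)"
        unfolding fibre_form_diff two[OF i j] two[OF j i] ij by (subst nabA_diff) auto
    qed
    then show ?thesis
      by simp
  qed
  show ?thesis
    unfolding nonresonant_def
    by (intro conjI allI ballI impI fin linB op_sym[OF g k] op_diag[OF g k] op_total[OF g k]
        op_invertible[OF g k] comm)
qed

end

end

section \<open>Parke-Taylor functions\<close>

definition chain_lists :: "nat \<Rightarrow> nat list set" where
  "chain_lists k = {ys. distinct ys \<and> set ys = {1..k}}"

lemma finite_chain_lists: "finite (chain_lists k)"
proof (rule finite_subset)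
  show "chain_lists k \<subseteq> {ys. set ys \<subseteq> {1..k} \<and> length ys \<le> k}"
    by (auto simp: chain_lists_def simp flip: distinct_card)
qed (rule finite_lists_length_le, simp)

lemma chain_lists_length: "ys \<in> chain_lists k \<Longrightarrow> length ys = k"
  by (auto simp: chain_lists_def simp flip: distinct_card)

definition insert_at :: "nat \<Rightarrow> nat \<Rightarrow> nat list \<Rightarrow> nat list" where
  "insert_at x i ys = take i ys @ x # drop i ys"

text \<open>A permutation of \<open>Suc k\<close> letters is recovered from the position of its
  largest letter and the word left after deleting it.\<close>

lemma bij_betw_insert_at:
  "bij_betw (\<lambda>(ys, i). insert_at (Suc k) i ys) (chain_lists k \<times> {..k}) (chain_lists (Suc k))"
proof (rule bij_betwI')
  fix p q
  assume "p \<in> chain_lists k \<times> {..k}" "q \<in> chain_lists k \<times> {..k}"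
  then obtain ys i zs j where pq: "p = (ys, i)" "q = (zs, j)" "ys \<in> chain_lists k" "zs \<in> chain_lists k" "i \<le> k" "j \<le> k"
    by auto
  have *: "remove1 (Suc k) (insert_at (Suc k) i ys) = ys \<and> length (takeWhile (\<lambda>a. a \<noteq> Suc k) (insert_at (Suc k) i ys)) = i"
    if "ys \<in> chain_lists k" "i \<le> k" for ys i
  proof -
    have "Suc k \<notin> set (take i ys)"
      using that set_take_subset[of i ys] by (auto simp: chain_lists_def)
    moreover have "takeWhile (\<lambda>a. a \<noteq> Suc k) (take i ys @ Suc k # drop i ys) = take i ys"
      using calculation by (subst takeWhile_append2) auto
    ultimately show ?thesis
      using that chain_lists_length[OF that(1)] by (simp add: insert_at_def remove1_append)
  qed
  show "((case p of (ys, i) \<Rightarrow> insert_at (Suc k) i ys) = (case q of (ys, i) \<Rightarrow> insert_at (Suc k) i ys)) = (p = q)"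
    using *[OF pq(3,5)] *[OF pq(4,6)] by (auto simp: pq(1,2))
next
  fix p
  assume "p \<in> chain_lists k \<times> {..k}"
  then obtain ys i where p: "p = (ys, i)" "ys \<in> chain_lists k" "i \<le> k"
    by auto
  have "distinct (take i ys @ drop i ys)" "set (take i ys @ drop i ys) = {1..k}"
    using p by (simp_all add: chain_lists_def)
  then have td: "distinct (take i ys)" "distinct (drop i ys)" "set (take i ys) \<inter> set (drop i ys) = {}"
    "set (take i ys) \<union> set (drop i ys) = {1..k}"
    by (simp_all only: distinct_append set_append)
  have not_in: "Suc k \<notin> {1..k}"
    by simp
  have "Suc k \<notin> set (take i ys)" "Suc k \<notin> set (drop i ys)"
    using td(4) not_in by blast+
  moreover have "set (insert_at (Suc k) i ys) = insert (Suc k) (set (take i ys) \<union> set (drop i ys))"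
    by (simp add: insert_at_def)
  then have "set (insert_at (Suc k) i ys) = {1..Suc k}"
    using atLeastAtMostSuc_conv[of 1 k] by (simp only: td(4))
  ultimately show "(case p of (ys, i) \<Rightarrow> insert_at (Suc k) i ys) \<in> chain_lists (Suc k)"
    using td(1-3) by (simp add: p(1) chain_lists_def) (simp add: insert_at_def)
next
  fix xs
  assume xs: "xs \<in> chain_lists (Suc k)"
  then have "Suc k \<in> set xs"
    by (simp add: chain_lists_def)
  then obtain us vs where us: "xs = us @ Suc k # vs"
    by (auto dest: split_list)
  have "set (us @ vs) = set xs - {Suc k}" "distinct (us @ vs)"
    using xs by (auto simp: us chain_lists_def)
  then have "us @ vs \<in> chain_lists k"
    using xs by (auto simp: chain_lists_def)
  moreover have "length us \<le> k"
    using chain_lists_length[OF xs] us by simp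
  moreover have "xs = insert_at (Suc k) (length us) (us @ vs)"
    by (simp add: insert_at_def us)
  ultimately show "\<exists>p\<in>chain_lists k \<times> {..k}. xs = (case p of (ys, i) \<Rightarrow> insert_at (Suc k) i ys)"
    by (intro bexI[of _ "(us @ vs, length us)"]) auto
qed

lemma insert_at_chain_lists: "ys \<in> chain_lists k \<Longrightarrow> i \<le> k \<Longrightarrow> insert_at (Suc k) i ys \<in> chain_lists (Suc k)"
  using bij_betwE[OF bij_betw_insert_at[of k]] by auto

lemma chain_lists_SucE:
  assumes "xs \<in> chain_lists (Suc k)"
  obtains ys i where "ys \<in> chain_lists k" "i \<le> k" "xs = insert_at (Suc k) i ys"
  using assms unfolding bij_betw_imp_surj_on[OF bij_betw_insert_at[of k], symmetric] by auto

lemma sum_chain_lists_Suc: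
  "(\<Sum>xs\<in>chain_lists (Suc k). F xs) = (\<Sum>ys\<in>chain_lists k. \<Sum>i\<le>k. F (insert_at (Suc k) i ys))"
  unfolding sum.cartesian_product
  by (subst sum.reindex_bij_betw[OF bij_betw_insert_at, symmetric]) (simp add: case_prod_unfold)

context simplicial
begin

fun chain_prod :: "nat list \<Rightarrow> 'e" where
  "chain_prod (a # b # zs) = 1 / (t b - t a) * chain_prod (b # zs)"
| "chain_prod [a] = 1"
| "chain_prod [] = 1"

lemma chain_prod_append: "chain_prod (xs @ a # ys) = chain_prod (xs @ [a]) * chain_prod (a # ys)"
proof (induction xs)
  case (Cons b xs)
  then show ?case
    by (cases xs) (simp_all del: times_divide_eq_left)
qed simp

definition closed_chain :: "nat list \<Rightarrow> nat list" where
  "closed_chain ys = 0 # ys @ [Suc n]"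

text \<open>The Parke-Taylor factor of the cyclic order in which infinity sits between
  \<open>Suc n\<close> and 0; the two factors involving infinity are dropped.\<close>

definition PT :: "nat list \<Rightarrow> 'e" where
  "PT ys = chain_prod (closed_chain ys)"

lemma closed_chain_props:
  assumes "ys \<in> chain_lists k" "k \<le> n"
  shows "length (closed_chain ys) = k + 2" "set (closed_chain ys) = P k" "distinct (closed_chain ys)"
proof -
  have ys: "distinct ys" "set ys = {1..k}"
    using assms(1) by (simp_all add: chain_lists_def)
  show "length (closed_chain ys) = k + 2"
    by (simp add: closed_chain_def chain_lists_length[OF assms(1)])
  show "set (closed_chain ys) = P k"
    unfolding closed_chain_def P_def by (auto simp: ys(2))
  show "distinct (closed_chain ys)"
    using assms(2) by (simp add: closed_chain_def ys)
qed

lemma PT_insert_at: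
  assumes ys: "ys \<in> chain_lists k" and k: "k < n" and i: "i \<le> k"
  shows "PT (insert_at (Suc k) i ys) =
    PT ys * (1 / (t (Suc k) - t (closed_chain ys ! i)) - 1 / (t (Suc k) - t (closed_chain ys ! Suc i)))"
proof -
  let ?e = "closed_chain ys" and ?a = "closed_chain ys ! i" and ?b = "closed_chain ys ! Suc i" and ?x = "t (Suc k)"
  have e: "length ?e = k + 2" "set ?e = P k" "distinct ?e"
    using closed_chain_props[OF ys] k by auto
  have i': "i < length ?e" "Suc i < length ?e"
    using i e(1) by auto
  have P: "?a \<in> P k" "?b \<in> P k"
    using nth_mem[OF i'(1)] nth_mem[OF i'(2)] e(2) by auto
  have ab: "?a \<noteq> ?b"
    using nth_eq_iff_index_eq[OF e(3) i'] by simp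
  have split: "?e = take i ?e @ ?a # ?b # drop (Suc (Suc i)) ?e"
    using id_take_nth_drop[OF i'(1)] Cons_nth_drop_Suc[OF i'(2)] by metis
  have "closed_chain (insert_at (Suc k) i ys) = take (Suc i) ?e @ Suc k # drop (Suc i) ?e"
    using i chain_lists_length[OF ys] by (simp add: closed_chain_def insert_at_def)
  also have "\<dots> = take i ?e @ ?a # Suc k # ?b # drop (Suc (Suc i)) ?e"
    using take_Suc_conv_app_nth[OF i'(1)] Cons_nth_drop_Suc[OF i'(2)] by simp
  finally have "PT (insert_at (Suc k) i ys) = chain_prod (take i ?e @ ?a # Suc k # ?b # drop (Suc (Suc i)) ?e)"
    by (simp only: PT_def)
  also have "\<dots> = chain_prod (take i ?e @ [?a]) * chain_prod (?a # Suc k # ?b # drop (Suc (Suc i)) ?e)"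
    by (rule chain_prod_append)
  also have "\<dots> = (1 / (?x - t ?a) * (1 / (t ?b - ?x))) * (chain_prod (take i ?e @ [?a]) * chain_prod (?b # drop (Suc (Suc i)) ?e))"
    by simp
  \<comment> \<open>Partial fractions in \<open>?x\<close> bring back the factor
    \<open>1 / (t ?b - t ?a)\<close> of the neighbours that the insertion separated.\<close>
  also have "1 / (?x - t ?a) * (1 / (t ?b - ?x)) = 1 / (t ?b - t ?a) * (1 / (?x - t ?a) - 1 / (?x - t ?b))"
  proof -
    have "t ?a \<noteq> t ?b"
      using t_inj[of k] P ab k by (auto simp: inj_on_def)
    moreover have "?x \<noteq> t ?a" "?x \<noteq> t ?b"
      by (rule x_neq[OF k P(1)], rule x_neq[OF k P(2)])
    ultimately show ?thesis
      by (simp add: divide_simps) (simp add: algebra_simps)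
  qed
  also have "1 / (t ?b - t ?a) * (1 / (?x - t ?a) - 1 / (?x - t ?b)) *
      (chain_prod (take i ?e @ [?a]) * chain_prod (?b # drop (Suc (Suc i)) ?e)) =
      (1 / (?x - t ?a) - 1 / (?x - t ?b)) * (chain_prod (take i ?e @ [?a]) * chain_prod (?a # ?b # drop (Suc (Suc i)) ?e))"
    by (simp only: chain_prod.simps mult_ac)
  also have "chain_prod (take i ?e @ [?a]) * chain_prod (?a # ?b # drop (Suc (Suc i)) ?e) = PT ys"
    unfolding PT_def by (subst (3) split) (rule chain_prod_append[symmetric])
  finally show ?thesis
    by (simp only: mult.commute)
qed

text \<open>Summation by parts: \<open>d (Suc i)\<close> is the partial sum of \<open>u\<close> over the first \<open>Suc i\<close> points of the chain.\<close>

lemma chain_summation: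
  fixes d u :: "nat \<Rightarrow> nat list \<Rightarrow> 'e"
  assumes ys: "ys \<in> chain_lists k" and k: "k < n" and d: "d 0 = 0" "d (k + 2) = 0"
    and u: "\<And>i. i < k + 2 \<Longrightarrow> u (closed_chain ys ! i) = d (Suc i) - d i"
  shows "(\<Sum>i\<le>k. sc (PT (insert_at (Suc k) i ys)) (d (Suc i))) =
    sc (PT ys) (\<Sum>j\<in>P k. sc (1 / (t (Suc k) - t j)) (u j))"
proof -
  let ?e = "\<lambda>i. 1 / (t (Suc k) - t (closed_chain ys ! i))"
  have e: "length (closed_chain ys) = k + 2" "set (closed_chain ys) = P k" "distinct (closed_chain ys)"
    using closed_chain_props[OF ys] k by auto
  have "bij_betw ((!) (closed_chain ys)) {..<k + 2} (P k)"
    using bij_betw_nth[OF e(3), of "{..<k + 2}" "P k"] e(1,2) by simp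
  then have "(\<Sum>j\<in>P k. sc (1 / (t (Suc k) - t j)) (u j)) = (\<Sum>i<k + 2. sc (?e i) (u (closed_chain ys ! i)))"
    by (rule sum.reindex_bij_betw[symmetric])
  also have "\<dots> = (\<Sum>i<k + 2. sc (?e i) (d (Suc i))) - (\<Sum>i<k + 2. sc (?e i) (d i))"
    by (simp only: sum_subtractf[symmetric] sc_diff(1)[symmetric]) (simp add: u)
  also have "(\<Sum>i<k + 2. sc (?e i) (d (Suc i))) = (\<Sum>i\<le>k. sc (?e i) (d (Suc i)))"
    using d(2) by (simp add: lessThan_Suc_atMost)
  also have "(\<Sum>i<k + 2. sc (?e i) (d i)) = (\<Sum>i\<le>k. sc (?e (Suc i)) (d (Suc i)))"
    using sum.lessThan_Suc_shift[of "\<lambda>i. sc (?e i) (d i)" "Suc k"]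
    by (simp only: add_2_eq_Suc' d(1) sc_simps add_0 lessThan_Suc_atMost)
  also have "(\<Sum>i\<le>k. sc (?e i) (d (Suc i))) - (\<Sum>i\<le>k. sc (?e (Suc i)) (d (Suc i))) =
      (\<Sum>i\<le>k. sc (?e i - ?e (Suc i)) (d (Suc i)))"
    by (simp only: sum_subtractf sc_diff(2))
  finally have "sc (PT ys) (\<Sum>j\<in>P k. sc (1 / (t (Suc k) - t j)) (u j)) =
      (\<Sum>i\<le>k. sc (PT ys * (?e i - ?e (Suc i))) (d (Suc i)))"
    by (simp only: sc_sum sc_simps)
  also have "\<dots> = (\<Sum>i\<le>k. sc (PT (insert_at (Suc k) i ys)) (d (Suc i)))"
    by (rule sum.cong) (simp_all add: PT_insert_at[OF ys k])
  finally show ?thesis ..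
qed

definition chain_sum :: "nat \<Rightarrow> (nat list \<Rightarrow> nat list \<Rightarrow> 'e) \<Rightarrow> nat list \<Rightarrow> 'e" where
  "chain_sum k c = (\<Sum>ys\<in>chain_lists k. sc (PT ys) (c ys))"

lemma PT_R:
  assumes "ys \<in> chain_lists k" "k \<le> n"
  shows "PT ys \<in> R k"
proof -
  have "chain_prod zs \<in> R k" if "distinct zs" "set zs \<subseteq> P k" for zs
    using that by (induction zs rule: chain_prod.induct) (auto intro: R_1 intro!: R_mult R_inv simp del: times_divide_eq_left)
  then show ?thesis
    using closed_chain_props[OF assms] by (simp add: PT_def)
qed

lemma chain_sum_M: "(\<And>ys. ys \<in> chain_lists k \<Longrightarrow> c ys \<in> vecs W K) \<Longrightarrow> k \<le> n \<Longrightarrow> chain_sum k c \<in> M k W"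
  unfolding chain_sum_def
  by (intro M_sum M_sc PT_R) (auto simp: M_def vecs_def intro: R_const)

text \<open>Links the coefficients at two levels: \<open>d ys\<close> holds the partial sums of the
  family \<open>c ys\<close> along the chain, and its inner values are the coefficients of the
  chains obtained by insertion. Both directions of the passage use it.\<close>

lemma fibre_form_comb:
  assumes k: "k < n" and c: "\<And>ys. ys \<in> chain_lists k \<Longrightarrow> d ys 0 = 0 \<and> d ys (k + 2) = 0 \<and>
      (\<forall>i<k + 2. full k (c ys) (closed_chain ys ! i) = d ys (Suc i) - d ys i)"
    and c': "\<And>ys i. ys \<in> chain_lists k \<Longrightarrow> i \<le> k \<Longrightarrow> c' (insert_at (Suc k) i ys) = d ys (Suc i)"
  shows "fibre_form k (chain_sum k c) = chain_sum (Suc k) c'"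
proof -
  have "fibre_form k (chain_sum k c) = (\<Sum>ys\<in>chain_lists k. sc (PT ys) (fibre_form k (c ys)))"
    by (simp only: chain_sum_def fibre_form_sum fibre_form_sc)
  also have "\<dots> = (\<Sum>ys\<in>chain_lists k. \<Sum>i\<le>k. sc (PT (insert_at (Suc k) i ys)) (d ys (Suc i)))"
    unfolding fibre_form_def by (rule sum.cong, rule refl, rule chain_summation[symmetric]) (use k c in auto)
  also have "\<dots> = (\<Sum>ys\<in>chain_lists k. \<Sum>i\<le>k. sc (PT (insert_at (Suc k) i ys)) (c' (insert_at (Suc k) i ys)))"
    by (intro sum.cong refl) (simp add: c')
  also have "\<dots> = chain_sum (Suc k) c'"
    by (simp only: chain_sum_def sum_chain_lists_Suc)
  finally show ?thesis .
qed

text \<open>The coefficients upstairs are the partial sums of the family along each chain. Every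
  longer chain arises by exactly one insertion, so they are well defined.\<close>

lemma chain_sum_lift:
  assumes k: "k < n" and c: "\<And>ys. ys \<in> chain_lists k \<Longrightarrow> c ys \<in> vecs (words k W) K"
  shows "\<exists>c'. (\<forall>xs\<in>chain_lists (Suc k). c' xs \<in> vecs W K) \<and> fibre_form k (chain_sum k c) = chain_sum (Suc k) c'"
proof -
  define d where "d ys m = (\<Sum>i<m. full k (c ys) (closed_chain ys ! i))" for ys m
  define ix where "ix = the_inv_into (chain_lists k \<times> {..k}) (\<lambda>(ys, i). insert_at (Suc k) i ys)"
  define c' where "c' xs = (case ix xs of (ys, i) \<Rightarrow> d ys (Suc i))" for xs
  have ix: "ix (insert_at (Suc k) i ys) = (ys, i)" if "ys \<in> chain_lists k" "i \<le> k" for ys i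
    using the_inv_into_f_f[OF bij_betw_imp_inj_on[OF bij_betw_insert_at], of "(ys, i)" k] that by (simp add: ix_def)
  have dK: "d ys m \<in> vecs W K" if "ys \<in> chain_lists k" "m \<le> k + 2" for ys m
    unfolding d_def
  proof (intro vecs_sum K_0 K_add)
    fix i
    assume "i \<in> {..<m}"
    then have "closed_chain ys ! i \<in> P k"
      using closed_chain_props[OF that(1)] k that(2) nth_mem[of i "closed_chain ys"] by auto
    then show "full k (c ys) (closed_chain ys ! i) \<in> vecs W K"
      by (rule full_K[OF c[OF that(1)]])
  qed
  have "fibre_form k (chain_sum k c) = chain_sum (Suc k) c'"
  proof (rule fibre_form_comb[OF k, of d])
    show "c' (insert_at (Suc k) i ys) = d ys (Suc i)" if "ys \<in> chain_lists k" "i \<le> k" for ys i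
      by (simp add: c'_def ix that)
    fix ys
    assume ys: "ys \<in> chain_lists k"
    have e: "length (closed_chain ys) = k + 2" "set (closed_chain ys) = P k" "distinct (closed_chain ys)"
      using closed_chain_props[OF ys] k by auto
    have "bij_betw ((!) (closed_chain ys)) {..<k + 2} (P k)"
      using bij_betw_nth[OF e(3), of "{..<k + 2}" "P k"] e(1,2) by simp
    then have "d ys (k + 2) = (\<Sum>j\<in>P k. full k (c ys) j)"
      unfolding d_def by (rule sum.reindex_bij_betw)
    then have "d ys (k + 2) = 0"
      by (simp only: full_sum)
    then show "d ys 0 = 0 \<and> d ys (k + 2) = 0 \<and>
        (\<forall>i<k + 2. full k (c ys) (closed_chain ys ! i) = d ys (Suc i) - d ys i)"
      by (auto simp: d_def)
  qed
  moreover have "c' xs \<in> vecs W K" if xs: "xs \<in> chain_lists (Suc k)" for xs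
  proof -
    obtain ys i where "ys \<in> chain_lists k" "i \<le> k" "xs = insert_at (Suc k) i ys"
      by (rule chain_lists_SucE[OF xs])
    then show ?thesis
      using dK[of ys "Suc i"] by (simp add: c'_def ix)
  qed
  ultimately show ?thesis
    by blast
qed

text \<open>Reverses the preceding passage by taking successive differences along each chain. The
  last clause is injectivity: vanishing differences and a vanishing initial value make all partial
  sums 0.\<close>

lemma chain_sum_descend:
  assumes k: "k < n" and c': "\<And>xs. xs \<in> chain_lists (Suc k) \<Longrightarrow> c' xs \<in> vecs W K"
  shows "\<exists>c. (\<forall>ys\<in>chain_lists k. c ys \<in> vecs (words k W) K) \<and> fibre_form k (chain_sum k c) = chain_sum (Suc k) c' \<and>
    ((\<forall>ys\<in>chain_lists k. c ys = 0) \<longrightarrow> (\<forall>xs\<in>chain_lists (Suc k). c' xs = 0))"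
proof -
  \<comment> \<open>The two boundary values 0 make the differences telescope to 0. Slot
    \<open>i\<close> of the insertion belongs to the partial sum with index \<open>Suc i\<close>,
    hence \<open>m - 1\<close>.\<close>
  define d where "d ys m = (if m = 0 \<or> m = k + 2 then 0 else c' (insert_at (Suc k) (m - 1) ys))" for ys m
  define u where "u ys j = (\<Sum>i<k + 2. if closed_chain ys ! i = j then d ys (Suc i) - d ys i else 0)" for ys j
  define c where "c ys = pack k (u ys)" for ys
  have ins_chain: "insert_at (Suc k) i ys \<in> chain_lists (Suc k)" if "ys \<in> chain_lists k" "i \<le> k" for ys i
    by (rule insert_at_chain_lists[OF that])
  have dK: "d ys m \<in> vecs W K" if "ys \<in> chain_lists k" "m \<le> k + 2" for ys m
    using c'[OF ins_chain[OF that(1), of "m - 1"]] that(2) by (auto simp: d_def intro: vecs_0 K_0)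
  have K_diff: "a - b \<in> K" if "a \<in> K" "b \<in> K" for a b
    using K_add[OF that(1) K_uminus[OF that(2)]] by simp
  have uK: "u ys j \<in> vecs W K" if "ys \<in> chain_lists k" for ys j
    unfolding u_def
  proof (intro vecs_sum K_0 K_add)
    fix i
    assume "i \<in> {..<k + 2}"
    then show "(if closed_chain ys ! i = j then d ys (Suc i) - d ys i else 0) \<in> vecs W K"
      using dK[OF that, of "Suc i"] dK[OF that, of i] by (auto simp: vecs_def intro: K_diff K_0)
  qed
  have u: "u ys (closed_chain ys ! i) = d ys (Suc i) - d ys i" if "ys \<in> chain_lists k" "i < k + 2" for ys i
  proof -
    have e: "length (closed_chain ys) = k + 2" "distinct (closed_chain ys)"
      using closed_chain_props[OF that(1)] k by auto
    have "closed_chain ys ! j = closed_chain ys ! i \<longleftrightarrow> j = i" if "j < k + 2" for j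
      using nth_eq_iff_index_eq[OF e(2)] that \<open>i < k + 2\<close> unfolding e(1) by blast
    then have "u ys (closed_chain ys ! i) = (\<Sum>j<k + 2. if j = i then d ys (Suc j) - d ys j else 0)"
      unfolding u_def by (intro sum.cong refl) auto
    also have "\<dots> = d ys (Suc i) - d ys i"
      using that(2) by (simp only: sum.delta finite_lessThan lessThan_iff if_True)
    finally show ?thesis .
  qed
  have d0: "d ys 0 = 0" "d ys (k + 2) = 0" for ys
    by (simp_all add: d_def)
  have full_c: "full k (c ys) (closed_chain ys ! i) = d ys (Suc i) - d ys i" if ys: "ys \<in> chain_lists k" and i: "i < k + 2" for ys i
  proof -
    have e: "length (closed_chain ys) = k + 2" "set (closed_chain ys) = P k" "distinct (closed_chain ys)"
      using closed_chain_props[OF ys] k by auto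
    have "bij_betw ((!) (closed_chain ys)) {..<k + 2} (P k)"
      using bij_betw_nth[OF e(3), of "{..<k + 2}" "P k"] e(1,2) by simp
    then have "(\<Sum>j\<in>P k. u ys j) = (\<Sum>i<k + 2. u ys (closed_chain ys ! i))"
      by (rule sum.reindex_bij_betw[symmetric])
    also have "\<dots> = (\<Sum>i<k + 2. d ys (Suc i) - d ys i)"
      by (rule sum.cong) (auto simp: u[OF ys])
    also have "\<dots> = 0"
      unfolding sum_lessThan_telescope d0 by simp
    finally have sum0: "(\<Sum>j\<in>P k. u ys j) = 0" .
    have "closed_chain ys ! i \<in> P k"
      using i nth_mem[of i "closed_chain ys"] by (simp only: e)
    from full_pack[OF sum0 this] show ?thesis
      by (simp only: c_def u[OF ys i])
  qed
  have "fibre_form k (chain_sum k c) = chain_sum (Suc k) c'"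
  proof (rule fibre_form_comb[OF k, of d])
    show "c' (insert_at (Suc k) i ys) = d ys (Suc i)" if "ys \<in> chain_lists k" "i \<le> k" for ys i
      using that by (simp add: d_def)
    show "d ys 0 = 0 \<and> d ys (k + 2) = 0 \<and> (\<forall>i<k + 2. full k (c ys) (closed_chain ys ! i) = d ys (Suc i) - d ys i)"
      if "ys \<in> chain_lists k" for ys
      using full_c[OF that] d0 by blast
  qed
  moreover have "c' xs = 0" if c0: "\<forall>ys\<in>chain_lists k. c ys = 0" and xs: "xs \<in> chain_lists (Suc k)" for xs
  proof -
    obtain ys i where ys: "ys \<in> chain_lists k" "i \<le> k" "xs = insert_at (Suc k) i ys"
      by (rule chain_lists_SucE[OF xs])
    have "d ys m = 0" if "m \<le> k + 2" for m
      using that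
    proof (induction m)
      case (Suc m)
      have "d ys (Suc m) - d ys m = full k (c ys) (closed_chain ys ! m)"
        using full_c[OF ys(1), of m] Suc.prems by simp
      also have "\<dots> = 0"
        unfolding c0[rule_format, OF ys(1)] by (rule full_0)
      finally show ?case
        using Suc by simp
    qed (rule d0)
    from this[of "Suc i"] show ?thesis
      using ys by (simp add: d_def)
  qed
  moreover have "c ys \<in> vecs (words k W) K" if "ys \<in> chain_lists k" for ys
    unfolding c_def by (rule pack_vecs[OF uK[OF that]])
  ultimately show ?thesis
    by blast
qed

definition kz_image :: "nat \<Rightarrow> nat list set \<Rightarrow> (nat \<Rightarrow> nat \<Rightarrow> (nat list \<Rightarrow> 'e) \<Rightarrow> nat list \<Rightarrow> 'e) \<Rightarrow> (nat list \<Rightarrow> 'e) set" where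
  "kz_image k W A = {\<Sum>i\<in>{1..k}. kz k A i (g i) | g. \<forall>i\<in>{1..k}. g i \<in> M k W}"

text \<open>Both halves pass to the base: fibre forms represent everything modulo the last operator,
  the Gauss-Manin identity relates the images of the other operators, and the chain coefficients
  correspond. As the coefficients are vectors over \<open>K\<close>, this describes the whole
  cokernel over \<open>K\<close>.\<close>

theorem PT_basis:
  assumes "nonresonant k W A" "k \<le> n"
  shows "(\<forall>f\<in>M k W. \<exists>c b. (\<forall>ys\<in>chain_lists k. c ys \<in> vecs W K) \<and> b \<in> kz_image k W A \<and> f = chain_sum k c + b) \<and>
    (\<forall>c. (\<forall>ys\<in>chain_lists k. c ys \<in> vecs W K) \<longrightarrow> chain_sum k c \<in> kz_image k W A \<longrightarrow> (\<forall>ys\<in>chain_lists k. c ys = 0))"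
  using assms
proof (induction k arbitrary: W A)
  case 0
  \<comment> \<open>With no variables the differences of distinct points are 1 and -1, so the ring
    is \<open>K\<close> itself.\<close>
  have R0: "a \<in> K" if "a \<in> R 0" for a
    using that
  proof (induction rule: R.induct)
    case (R_inv i j)
    then have "t i - t j = 1 \<or> t i - t j = - 1"
      by (auto simp: P_def t_0 t_last)
    then show ?case
      using K_1 K_uminus[OF K_1] by auto
  qed (auto simp: P_def t_0 t_last K_0 K_1 K_add K_mult)
  have ch: "chain_lists 0 = {[]}"
    by (auto simp: chain_lists_def)
  have chain_sum: "chain_sum 0 c = c []" for c
    by (simp add: chain_sum_def ch PT_def closed_chain_def t_0 t_last)
  have kz_image: "kz_image 0 W A = {0}"
    by (auto simp: kz_image_def)
  have M0: "f \<in> vecs W K" if "f \<in> M 0 W" for f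
    using that by (auto simp: M_def vecs_def intro: R0)
  show ?case
    unfolding chain_sum kz_image ch
  proof (intro conjI ballI allI impI)
    show "\<exists>c b. (\<forall>ys\<in>{[]}. c ys \<in> vecs W K) \<and> b \<in> {0} \<and> f = c [] + b" if "f \<in> M 0 W" for f
      by (intro exI[of _ "\<lambda>_. f"] exI[of _ 0]) (simp add: M0[OF that])
  qed auto
next
  case (Suc k)
  note g = Suc.prems(1)
  have k: "k < n"
    using Suc.prems(2) by simp
  let ?B = "fibre_op k A" and ?N = "kz (Suc k) A"
  note gB = nonresonant_fibre[OF g k]
  note IH = Suc.IH[OF gB less_imp_le[OF k]]
  have linA: "linop K W (A i j)" if "i \<in> P (Suc k)" "j \<in> P (Suc k)" for i j
    by (rule nonresonant_lin[OF g that])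
  have iP: "i \<in> P (Suc k)" if "i \<in> {1..Suc k}" for i
    using that by (auto simp: P_def)
  have nabA_add: "?N i (f + h) = ?N i f + ?N i h" if "i \<in> {1..Suc k}" for i f h
    by (rule kz_add[where W = W]) (rule linA[OF iP[OF that]])
  have nabA_diff: "?N i (f - h) = ?N i f - ?N i h" if "i \<in> {1..Suc k}" for i f h
    by (rule kz_diff[where W = W]) (rule linA[OF iP[OF that]])
  have nabA_sum: "?N (Suc k) (\<Sum>a\<in>S. F a) = (\<Sum>a\<in>S. ?N (Suc k) (F a))" for F :: "nat \<Rightarrow> nat list \<Rightarrow> 'e" and S :: "nat set"
  proof (induction S rule: infinite_finite_induct)
    case (insert a S)
    then show ?case
      unfolding sum.insert[OF insert(1,2)] by (subst nabA_add) auto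
  next
    case (infinite S)
    show ?case
      unfolding sum.infinite[OF infinite] by (rule kz_0[where W = W], rule linA[OF iP]) auto
  next
    case empty
    show ?case
      unfolding sum.empty by (rule kz_0[where W = W], rule linA[OF iP]) auto
  qed
  have nabA_M: "?N i f \<in> M (Suc k) W" if "f \<in> M (Suc k) W" "i \<in> {1..Suc k}" for i f
    using nonresonant_fin[OF g] linA that k iP by (intro kz_M) auto
  have nabB_M: "kz k ?B i f \<in> M k (words k W)" if "f \<in> M k (words k W)" "i \<in> {1..k}" for i f
    using finite_words[OF nonresonant_fin[OF g]] op_lin[OF g k] that k by (intro kz_M) (auto simp: P_def)
  define q where "q v i = sc (1 / (t (Suc k) - t i)) (full k v i)" for v i
  have q_M: "q v i \<in> M (Suc k) W" if "v \<in> M k (words k W)" "i \<in> {1..k}" for v i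
    unfolding q_def using that k
    by (intro M_sc M_mono[OF full_M] R_inv) (auto simp: P_def)
  have gm: "fibre_form k (kz k ?B i v) = ?N i (fibre_form k v) + ?N (Suc k) (q v i)"
    if "i \<in> {1..k}" "v \<in> M k (words k W)" for v i
    unfolding q_def by (rule gauss_manin[OF g k that])
  have surj: "\<exists>v h. v \<in> M k (words k W) \<and> h \<in> M (Suc k) W \<and> f = fibre_form k v + ?N (Suc k) h"
    if f: "f \<in> M (Suc k) W" for f
  proof -
    obtain u h where u: "\<forall>j\<in>P k. u j \<in> M k W" "(\<Sum>j\<in>P k. u j) = 0" "h \<in> M (Suc k) W"
      "f = (\<Sum>j\<in>P k. sc (1 / (t (Suc k) - t j)) (u j)) + ?N (Suc k) h"
      using fibre_spanning[OF g k f] by blast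
    have "pack k u \<in> M k (words k W)"
      unfolding M_def by (rule pack_vecs) (use u(1) in \<open>auto simp: M_def\<close>)
    moreover have "fibre_form k (pack k u) = (\<Sum>j\<in>P k. sc (1 / (t (Suc k) - t j)) (u j))"
      unfolding fibre_form_def by (rule sum.cong) (simp_all add: full_pack[OF u(2)])
    ultimately show ?thesis
      using u(3,4) by metis
  qed
  have set_split: "{1..Suc k} = insert (Suc k) {1..k}"
    by auto
  have sum_split: "(\<Sum>i\<in>{1..Suc k}. F i) = F (Suc k) + (\<Sum>i\<in>{1..k}. F i)" for F :: "nat \<Rightarrow> nat list \<Rightarrow> 'e"
    unfolding set_split by (subst sum.insert) auto
  show ?case
  proof (intro conjI ballI allI impI)
    fix f
    assume "f \<in> M (Suc k) W"
    from surj[OF this] obtain v h where vh: "v \<in> M k (words k W)" "h \<in> M (Suc k) W"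
      "f = fibre_form k v + ?N (Suc k) h"
      by blast
    obtain c b where cb: "\<forall>ys\<in>chain_lists k. c ys \<in> vecs (words k W) K" "b \<in> kz_image k (words k W) ?B" "v = chain_sum k c + b"
      using IH vh(1) by blast
    obtain g' where g': "\<forall>i\<in>{1..k}. g' i \<in> M k (words k W)" "b = (\<Sum>i\<in>{1..k}. kz k ?B i (g' i))"
      using cb(2) unfolding kz_image_def by blast
    obtain c' where c': "\<forall>xs\<in>chain_lists (Suc k). c' xs \<in> vecs W K" "fibre_form k (chain_sum k c) = chain_sum (Suc k) c'"
      using chain_sum_lift[OF k] cb(1) by metis
    \<comment> \<open>Every application of \<open>gauss_manin\<close> leaves an exact correction;
      all of them are collected in the component for the last direction.\<close>
    define g2 where "g2 i = (if i = Suc k then h + (\<Sum>i\<in>{1..k}. q (g' i) i) else fibre_form k (g' i))" for i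
    have "fibre_form k b = (\<Sum>i\<in>{1..k}. fibre_form k (kz k ?B i (g' i)))"
      by (simp only: g'(2) fibre_form_sum)
    also have "\<dots> = (\<Sum>i\<in>{1..k}. ?N i (g2 i) + ?N (Suc k) (q (g' i) i))"
      by (rule sum.cong) (use g'(1) in \<open>auto simp: gm g2_def\<close>)
    also have "\<dots> = (\<Sum>i\<in>{1..k}. ?N i (g2 i)) + ?N (Suc k) (\<Sum>i\<in>{1..k}. q (g' i) i)"
      by (simp only: sum.distrib nabA_sum)
    finally have "fibre_form k b = \<dots>" .
    moreover have "?N (Suc k) (g2 (Suc k)) = ?N (Suc k) h + ?N (Suc k) (\<Sum>i\<in>{1..k}. q (g' i) i)"
      unfolding g2_def if_P[OF refl] by (rule nabA_add) simp
    ultimately have "f = chain_sum (Suc k) c' + (\<Sum>i\<in>{1..Suc k}. ?N i (g2 i))"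
      unfolding vh(3) cb(3) fibre_form_add c'(2) sum_split by (simp only: add_ac)
    moreover have "g2 i \<in> M (Suc k) W" if "i \<in> {1..Suc k}" for i
      using that g'(1) vh(2) by (auto simp: g2_def intro!: M_add M_sum q_M fibre_form_M[OF _ k])
    ultimately show "\<exists>c b. (\<forall>ys\<in>chain_lists (Suc k). c ys \<in> vecs W K) \<and> b \<in> kz_image (Suc k) W A \<and> f = chain_sum (Suc k) c + b"
      using c'(1) unfolding kz_image_def by blast
  next
    fix c' xs
    assume c': "\<forall>ys\<in>chain_lists (Suc k). c' ys \<in> vecs W K" and ex: "chain_sum (Suc k) c' \<in> kz_image (Suc k) W A"
      and xs: "xs \<in> chain_lists (Suc k)"
    obtain c where c: "\<forall>ys\<in>chain_lists k. c ys \<in> vecs (words k W) K" "fibre_form k (chain_sum k c) = chain_sum (Suc k) c'"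
      "(\<forall>ys\<in>chain_lists k. c ys = 0) \<longrightarrow> (\<forall>xs\<in>chain_lists (Suc k). c' xs = 0)"
      using chain_sum_descend[OF k, of c' W] c' by auto
    obtain g' where g': "\<forall>i\<in>{1..Suc k}. g' i \<in> M (Suc k) W" "chain_sum (Suc k) c' = (\<Sum>i\<in>{1..Suc k}. ?N i (g' i))"
      using ex unfolding kz_image_def by blast
    \<comment> \<open>Each primitive is a fibre form plus an exact element. By commutation the
      latter contributes only to the last direction, so the relation becomes one between fibre
      forms.\<close>
    have "\<forall>i\<in>{1..k}. \<exists>v h. v \<in> M k (words k W) \<and> h \<in> M (Suc k) W \<and> g' i = fibre_form k v + ?N (Suc k) h"
      using g'(1) surj by auto
    then obtain v h where v: "\<And>i. i \<in> {1..k} \<Longrightarrow> v i \<in> M k (words k W)"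
      and h: "\<And>i. i \<in> {1..k} \<Longrightarrow> h i \<in> M (Suc k) W"
      and g'_eq: "\<And>i. i \<in> {1..k} \<Longrightarrow> g' i = fibre_form k (v i) + ?N (Suc k) (h i)"
      by metis
    have step: "?N i (g' i) = fibre_form k (kz k ?B i (v i)) + ?N (Suc k) (?N i (h i) - q (v i) i)"
      if i: "i \<in> {1..k}" for i
    proof -
      have i': "i \<in> {1..Suc k}" and k': "Suc k \<in> {1..Suc k}"
        using i by auto
      have "?N i (g' i) = ?N i (fibre_form k (v i)) + ?N (Suc k) (?N i (h i))"
        unfolding g'_eq[OF i] nabA_add[OF i'] nonresonant_comm[OF g i' k' h[OF i]] ..
      then show ?thesis
        unfolding gm[OF i v[OF i]] nabA_diff[OF k'] by simp
    qed
    \<comment> \<open>The candidate relation on the base; its fibre form is exact in the last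
      direction, so it must hold.\<close>
    define w where "w = chain_sum k c - (\<Sum>i\<in>{1..k}. kz k ?B i (v i))"
    have combM: "chain_sum k c \<in> M k (words k W)"
      using c(1) k by (intro chain_sum_M) auto
    have "w = 0"
    proof (rule fibre_form_inj[OF g k])
      show "w \<in> M k (words k W)"
        unfolding w_def by (intro M_diff combM M_sum nabB_M v)
      show "g' (Suc k) + (\<Sum>i\<in>{1..k}. ?N i (h i) - q (v i) i) \<in> M (Suc k) W"
        using g'(1) by (intro M_add M_sum M_diff nabA_M q_M h v) auto
      have "chain_sum (Suc k) c' = ?N (Suc k) (g' (Suc k)) + (\<Sum>i\<in>{1..k}. fibre_form k (kz k ?B i (v i))
          + ?N (Suc k) (?N i (h i) - q (v i) i))"
        unfolding g'(2) sum_split by (simp add: step)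
      then show "fibre_form k w = ?N (Suc k) (g' (Suc k) + (\<Sum>i\<in>{1..k}. ?N i (h i) - q (v i) i))"
        unfolding w_def fibre_form_diff c(2) fibre_form_sum
        by (subst nabA_add) (auto simp: nabA_sum sum.distrib)
    qed
    then have "chain_sum k c \<in> kz_image k (words k W) ?B"
      unfolding kz_image_def w_def using v by (auto intro!: exI[of _ v])
    then show "c' xs = 0"
      using IH c(1,3) xs by blast
  qed
qed

end

section \<open>Systems of rank one\<close>

locale weighted = simplicial +
  fixes S :: "nat \<Rightarrow> nat \<Rightarrow> 'a"
  assumes S_K: "i \<in> P n \<Longrightarrow> j \<in> P n \<Longrightarrow> S i j \<in> K"
    and S_sym: "i \<in> P n \<Longrightarrow> j \<in> P n \<Longrightarrow> S i j = S j i"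
    and S_diag: "i \<in> P n \<Longrightarrow> S i i = 0"
    and S_total: "(\<Sum>i\<in>P n. \<Sum>j\<in>P n. S i j) = 0"
    and S_generic: "I \<subseteq> P n \<Longrightarrow> 2 \<le> card I \<Longrightarrow> card I \<le> n + 1 \<Longrightarrow>
      (\<Sum>i\<in>I. \<Sum>j\<in>I. S i j) \<noteq> 2 * of_int m"
begin

text \<open>Scalars are vectors indexed by the empty word alone; the words that index the induced
  systems grow from it.\<close>

definition scalar_op :: "nat \<Rightarrow> nat \<Rightarrow> (nat list \<Rightarrow> 'a) \<Rightarrow> nat list \<Rightarrow> 'a" where
  "scalar_op i j f w = (if w = [] then S i j * f w else 0)"

text \<open>The component of the connection form along the coordinate \<open>t i\<close>, as
  \<open>omega_single\<close> confirms.\<close>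

definition log_coeff :: "nat \<Rightarrow> 'a" where
  "log_coeff i = (\<Sum>j\<in>P n - {i}. S i j / (t i - t j))"

lemma scalar_op_lin: "i \<in> P n \<Longrightarrow> j \<in> P n \<Longrightarrow> linop K {[]} (scalar_op i j)"
  using S_K[of i j] by (auto simp: linop_def scalar_op_def fun_eq_iff vecs_def algebra_simps intro: K_mult)

lemma residue_sum_sop: "residue_sum scalar_op I f w = (if w = [] then (\<Sum>i\<in>I. \<Sum>j\<in>I. S i j) * f w else 0)"
  by (simp add: residue_sum_def sum_apply_fun scalar_op_def sum_distrib_right)

lemma kz_sop: "kz n scalar_op i f w = (if w = [] then D i (f []) + log_coeff i * f [] else D i (f w))"
  by (simp add: kz_def sum_apply_fun scalar_op_def log_coeff_def sum_distrib_right)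

lemma D_S: "i \<in> P n \<Longrightarrow> j \<in> P n \<Longrightarrow> D l (S i j) = 0"
  by (rule D_K[OF S_K])

text \<open>The value is symmetric in \<open>i\<close> and \<open>j\<close>: the connection form is
  closed, which makes the operators commute in rank one.\<close>

lemma D_om:
  assumes i: "i \<in> {1..n}" and j: "j \<in> {1..n}" and "i \<noteq> j"
  shows "D i (log_coeff j) = S i j / (t i - t j)\<^sup>2"
proof -
  have iP: "i \<in> P n" "j \<in> P n"
    using i j by (auto simp: P_def)
  have "D i (S j l / (t j - t l)) = (if l = i then S i j / (t i - t j)\<^sup>2 else 0)" if l: "l \<in> P n - {j}" for l
  proof -
    have nz: "t j - t l \<noteq> 0"
      using t_neq[of j l] l iP by auto
    then have "D i (S j l / (t j - t l)) = - (S j l * (D i (t j) - D i (t l))) / (t j - t l)\<^sup>2"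
      using l iP by (simp add: D.d_divide D_S D.d_diff)
    then show ?thesis
      using l iP i \<open>i \<noteq> j\<close> S_sym[of i j] by (auto simp: D_t' power2_commute)
  qed
  then have "D i (log_coeff j) = (\<Sum>l\<in>P n - {j}. if l = i then S i j / (t i - t j)\<^sup>2 else 0)"
    unfolding log_coeff_def D.d_sum by (intro sum.cong) auto
  then show ?thesis
    using iP \<open>i \<noteq> j\<close> by simp
qed

text \<open>In rank one an operator is multiplication by a number, so invertibility over
  \<open>K\<close> only asks that the doubled partial sum of exponents not be an even
  integer.\<close>

lemma nonresonant_scalar: "nonresonant n {[]} scalar_op"
  unfolding nonresonant_def
proof (intro conjI ballI allI impI)
  show "linop K {[]} (scalar_op i j)" if "i \<in> P n" "j \<in> P n" for i j
    by (rule scalar_op_lin[OF that])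
  show "scalar_op i j = scalar_op j i" if "i \<in> P n" "j \<in> P n" for i j
    using S_sym[OF that] by (auto simp: scalar_op_def fun_eq_iff)
  show "scalar_op i i f = 0" if "i \<in> P n" for i f
    using S_diag[OF that] by (auto simp: scalar_op_def fun_eq_iff)
  show "residue_sum scalar_op (P n) f = 0" for f
    by (auto simp: residue_sum_sop fun_eq_iff S_total)
  show "invertible {[]} (\<lambda>f. residue_sum scalar_op I f - sc (2 * of_int m) f)"
    if I: "I \<subseteq> P n" "2 \<le> card I" "card I \<le> n + 1" for I m
  proof -
    let ?s = "(\<Sum>i\<in>I. \<Sum>j\<in>I. S i j) - 2 * of_int m"
    define G :: "(nat list \<Rightarrow> 'a) \<Rightarrow> nat list \<Rightarrow> 'a" where
      "G f w = (if w = [] then 1 / ?s * f w else 0)" for f w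
    have nz: "?s \<noteq> 0"
      using S_generic[OF I] by simp
    have sum_K: "(\<Sum>a\<in>J. F a) \<in> K" if "\<And>a. a \<in> J \<Longrightarrow> F a \<in> K" for J :: "nat set" and F
      using that by (induction J rule: infinite_finite_induct) (auto intro: K_0 K_add)
    have "of_nat l \<in> K" for l
      by (induction l) (auto intro: K_0 K_1 K_add)
    then have "of_nat l \<in> K" "- of_nat l \<in> K" for l
      by (auto intro: K_uminus)
    then have "of_int m \<in> K"
      by (cases m rule: int_cases2) simp_all
    then have "- (2 * of_int m) \<in> K"
      by (intro K_uminus K_mult two_K)
    moreover have "(\<Sum>i\<in>I. \<Sum>j\<in>I. S i j) \<in> K"
      using I(1) by (intro sum_K S_K) auto
    ultimately have "?s \<in> K"
      using K_add by fastforce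
    then have "1 / ?s \<in> K"
      by (rule K_inverse)
    then have "linop K {[]} G"
      by (auto simp: linop_def G_def fun_eq_iff vecs_def distrib_left mult.left_commute simp del: times_divide_eq_left intro: K_mult)
    moreover have "residue_sum scalar_op I (G f) - sc (2 * of_int m) (G f) = f \<and> G (residue_sum scalar_op I f - sc (2 * of_int m) f) = f"
      if "f \<in> vecs {[]} UNIV" for f
    proof -
      have "f w = 0" if "w \<noteq> []" for w
        using \<open>f \<in> _\<close> that by (simp add: vecs_def)
      moreover have "(\<Sum>i\<in>I. \<Sum>j\<in>I. S i j) * (1 / ?s * a) - 2 * of_int m * (1 / ?s * a) = a"
        "1 / ?s * ((\<Sum>i\<in>I. \<Sum>j\<in>I. S i j) * a - 2 * of_int m * a) = a" for a
      proof -
        have "s * (1 / (s - c) * a) - c * (1 / (s - c) * a) = a \<and> 1 / (s - c) * (s * a - c * a) = a"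
          if "s - c \<noteq> 0" for s c :: 'a
          using that by (simp flip: diff_divide_distrib left_diff_distrib)
        then show "(\<Sum>i\<in>I. \<Sum>j\<in>I. S i j) * (1 / ?s * a) - 2 * of_int m * (1 / ?s * a) = a"
          "1 / ?s * ((\<Sum>i\<in>I. \<Sum>j\<in>I. S i j) * a - 2 * of_int m * a) = a"
          using nz by blast+
      qed
      ultimately show ?thesis
        by (auto simp: fun_eq_iff residue_sum_sop G_def simp del: times_divide_eq_left)
    qed
    ultimately show ?thesis
      unfolding invertible_def by blast
  qed
  show "kz n scalar_op i (kz n scalar_op j f) = kz n scalar_op j (kz n scalar_op i f)"
    if i: "i \<in> {1..n}" and j: "j \<in> {1..n}" and f: "f \<in> M n {[]}" for i j f
  proof
    fix w
    have fw: "D i (D j (f w)) = D j (D i (f w))" for w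
      by (rule D_commute[OF M_in[OF f] i j])
    have "D i (log_coeff j) = D j (log_coeff i)"
    proof (cases "i = j")
      case False
      then show ?thesis
        using i j S_sym[of i j] by (simp add: D_om power2_commute P_def)
    qed simp
    then show "kz n scalar_op i (kz n scalar_op j f) w = kz n scalar_op j (kz n scalar_op i f) w"
      using fw by (simp add: kz_sop D.d_add D.d_mult algebra_simps)
  qed
qed simp

text \<open>This is \<open>PT_basis\<close> for the index set \<open>{[]}\<close>, read off at the
  empty word.\<close>

theorem scalar_PT_spanning:
  assumes "a \<in> R n"
  shows "\<exists>c b. (\<forall>ys\<in>chain_lists n. c ys \<in> K) \<and> (\<forall>i\<in>{1..n}. b i \<in> R n) \<and>
    a = (\<Sum>ys\<in>chain_lists n. c ys * PT ys) + (\<Sum>i\<in>{1..n}. D i (b i) + log_coeff i * b i)"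
proof -
  define f where "f = (\<lambda>w::nat list. if w = [] then a else 0)"
  have "f \<in> M n {[]}"
    using assms by (simp add: f_def M_def vecs_def)
  then obtain c b where cb: "\<forall>ys\<in>chain_lists n. c ys \<in> vecs {[]} K" "b \<in> kz_image n {[]} scalar_op" "f = chain_sum n c + b"
    using conjunct1[OF PT_basis[OF nonresonant_scalar order_refl]] by blast
  obtain g where g: "\<forall>i\<in>{1..n}. g i \<in> M n {[]}" "b = (\<Sum>i\<in>{1..n}. kz n scalar_op i (g i))"
    using cb(2) unfolding kz_image_def by blast
  have "a = f []"
    by (simp add: f_def)
  also have "\<dots> = (\<Sum>ys\<in>chain_lists n. c ys [] * PT ys) + (\<Sum>i\<in>{1..n}. D i (g i []) + log_coeff i * g i [])"
    by (simp add: cb(3) g(2) chain_sum_def sum_apply_fun kz_sop mult.commute)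
  finally show ?thesis
    using cb(1) g(1) by (intro exI[of _ "\<lambda>ys. c ys []"] exI[of _ "\<lambda>i. g i []"]) (simp add: vecs_def M_def)
qed

theorem scalar_PT_independent:
  assumes "\<And>ys. ys \<in> chain_lists n \<Longrightarrow> c ys \<in> K" "\<And>i. i \<in> {1..n} \<Longrightarrow> b i \<in> R n"
    and eq: "(\<Sum>ys\<in>chain_lists n. c ys * PT ys) = (\<Sum>i\<in>{1..n}. D i (b i) + log_coeff i * b i)"
    and "ys \<in> chain_lists n"
  shows "c ys = 0"
proof -
  define emb where "emb a = (\<lambda>w::nat list. if w = [] then a else 0)" for a :: 'a
  have "chain_sum n (\<lambda>ys. emb (c ys)) w = (\<Sum>i\<in>{1..n}. kz n scalar_op i (emb (b i))) w" for w
    using eq by (cases "w = []") (simp_all add: chain_sum_def sum_apply_fun kz_sop emb_def mult.commute)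
  then have "chain_sum n (\<lambda>ys. emb (c ys)) = (\<Sum>i\<in>{1..n}. kz n scalar_op i (emb (b i)))"
    by (rule ext)
  moreover have "emb (b i) \<in> M n {[]}" if "i \<in> {1..n}" for i
    using assms(2)[OF that] by (simp add: emb_def M_def vecs_def)
  ultimately have "chain_sum n (\<lambda>ys. emb (c ys)) \<in> kz_image n {[]} scalar_op"
    unfolding kz_image_def by (intro CollectI exI[of _ "\<lambda>i. emb (b i)"] conjI ballI)
  moreover have "\<forall>ys\<in>chain_lists n. emb (c ys) \<in> vecs {[]} K"
    using assms(1) by (simp add: emb_def vecs_def)
  ultimately have "emb (c ys) = 0"
    using conjunct2[OF PT_basis[OF nonresonant_scalar order_refl], rule_format, of "\<lambda>ys. emb (c ys)" ys] assms(4)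
    by simp
  from fun_cong[OF this, of "[]"] show ?thesis
    by (simp add: emb_def)
qed

end

section \<open>Rational functions in the simplicial coordinates\<close>

lemma poly_deriv_const: "poly_deriv i (Poly_Mapping.single 0 c) = 0"
  by (simp add: poly_deriv_single)

lemma poly_deriv_1: "poly_deriv i 1 = 0"
  using poly_deriv_const[of i 1] by simp

lemma derivation_ratfun_deriv: "derivation (ratfun_deriv i)"
proof
  fix f g :: cratfun
  obtain a b where f: "f = Fract a b" "b \<noteq> 0"
    by (cases f) auto
  obtain c d where g: "g = Fract c d" "d \<noteq> 0"
    by (cases g) auto
  show "ratfun_deriv i (f + g) = ratfun_deriv i f + ratfun_deriv i g"
    using f(2) g(2)
    by (simp add: f(1) g(1) ratfun_deriv_Fract eq_fract poly_deriv_mult poly_deriv_add)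
      (simp add: algebra_simps)
  show "ratfun_deriv i (f * g) = ratfun_deriv i f * g + f * ratfun_deriv i g"
    using f(2) g(2)
    by (simp add: f(1) g(1) ratfun_deriv_Fract eq_fract poly_deriv_mult poly_deriv_add)
      (simp add: algebra_simps)
qed

lemma ratfun_const_simps [simp]: "ratfun_const 0 = 0" "ratfun_const 1 = 1"
  by (simp_all add: ratfun_const_def Zero_fract_def One_fract_def)

lemma ratfun_const_add: "ratfun_const (a + b) = ratfun_const a + ratfun_const b"
  by (simp add: ratfun_const_def single_add)

lemma ratfun_const_mult: "ratfun_const (a * b) = ratfun_const a * ratfun_const b"
  by (simp add: ratfun_const_def mult_single)

lemma ratfun_const_uminus: "ratfun_const (- a) = - ratfun_const a"
  using ratfun_const_add[of a "- a"] by (simp add: add_eq_0_iff)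

lemma ratfun_const_inverse: "ratfun_const (1 / a) = 1 / ratfun_const a"
proof (cases "a = 0")
  case False
  then have "ratfun_const (1 / a) * ratfun_const a = 1"
    by (simp flip: ratfun_const_mult)
  then show ?thesis
    by (metis mult_zero_right nonzero_eq_divide_eq zero_neq_one)
qed simp

lemma ratfun_const_inj: "ratfun_const a = ratfun_const b \<longleftrightarrow> a = b"
proof
  assume "ratfun_const a = ratfun_const b"
  then have "Poly_Mapping.single (0 :: nat \<Rightarrow>\<^sub>0 nat) a * 1 = Poly_Mapping.single 0 b * 1"
    unfolding ratfun_const_def by (subst (asm) eq_fract) simp_all
  from arg_cong[OF this, of "\<lambda>p. Poly_Mapping.lookup p 0"] show "a = b"
    by simp
qed simp

lemma ratfun_const_sum: "ratfun_const (\<Sum>a\<in>A. f a) = (\<Sum>a\<in>A. ratfun_const (f a))"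
  by (induction A rule: infinite_finite_induct) (simp_all add: ratfun_const_add)

lemma ratfun_const_of_nat: "ratfun_const (of_nat m) = of_nat m"
  by (induction m) (simp_all add: ratfun_const_add)

lemma ratfun_deriv_coord:
  assumes "i \<in> {1..n}" "j \<in> {1..n}"
  shows "ratfun_deriv i (coord n j) = (if i = j then 1 else 0)"
proof -
  have "coord n j = Fract (Poly_Mapping.single (Poly_Mapping.single j 1) 1) 1"
    using assms by (simp add: coord_def)
  then show ?thesis
    by (simp add: ratfun_deriv_Fract poly_deriv_single poly_deriv_1 lookup_single when_def
        One_fract_def Zero_fract_def)
qed

definition subfield_set :: "complex set \<Rightarrow> bool" where
  "subfield_set K \<longleftrightarrow> 0 \<in> K \<and> 1 \<in> K \<and> (\<forall>a\<in>K. \<forall>b\<in>K. a + b \<in> K \<and> a * b \<in> K) \<and>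
    (\<forall>a\<in>K. - a \<in> K \<and> 1 / a \<in> K)"

lemma simplicial_coord:
  assumes "subfield_set K"
  shows "simplicial (ratfun_const ` K) n (coord n) ratfun_deriv"
proof (rule simplicial.intro)
  show "derivation (ratfun_deriv i)" for i
    by (rule derivation_ratfun_deriv)
  show "m = 0" if "(of_nat m :: cratfun) = 0" for m
    using that ratfun_const_inj[of "of_nat m" 0] by (simp add: ratfun_const_of_nat)
  show "ratfun_deriv i a = 0" if "a \<in> ratfun_const ` K" for a i
    using that by (auto simp: ratfun_const_def ratfun_deriv_Fract poly_deriv_const poly_deriv_1 Zero_fract_def)
  show "ratfun_deriv i (coord n j) = (if i = j then 1 else 0)" if "i \<in> {1..n}" "j \<in> {1..n}" for i j
    by (rule ratfun_deriv_coord[OF that])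
  show "coord n 0 = 0" "coord n (Suc n) = 1"
    by (simp_all add: coord_def)
  show "0 \<in> ratfun_const ` K" "1 \<in> ratfun_const ` K"
    using assms unfolding subfield_set_def by (metis ratfun_const_simps imageI)+
  fix a b
  assume "a \<in> ratfun_const ` K"
  then obtain a' where a: "a = ratfun_const a'" "a' \<in> K"
    by blast
  show "- a \<in> ratfun_const ` K"
    using assms a unfolding subfield_set_def by (metis ratfun_const_uminus imageI)
  show "1 / a \<in> ratfun_const ` K"
    using assms a unfolding subfield_set_def by (metis ratfun_const_inverse imageI)
  assume "b \<in> ratfun_const ` K"
  then obtain b' where b: "b = ratfun_const b'" "b' \<in> K"
    by blast
  show "a + b \<in> ratfun_const ` K"
    using assms a b unfolding subfield_set_def by (metis ratfun_const_add imageI)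
  show "a * b \<in> ratfun_const ` K"
    using assms a b unfolding subfield_set_def by (metis ratfun_const_mult imageI)
qed

section \<open>The coordinate ring as a localisation\<close>

lemma poly_over_single:
  assumes "c \<in> K" "0 \<in> K" "Poly_Mapping.keys m \<subseteq> {1..n}"
  shows "Poly_Mapping.single m c \<in> poly_over n K"
  using assms by (auto simp: poly_over_def lookup_single when_def)

lemma poly_over_add:
  assumes "subfield_set K" "p \<in> poly_over n K" "q \<in> poly_over n K"
  shows "p + q \<in> poly_over n K"
proof -
  have "Poly_Mapping.keys m \<subseteq> {1..n}" if "m \<in> Poly_Mapping.keys (p + q)" for m
  proof -
    have "m \<in> Poly_Mapping.keys p \<or> m \<in> Poly_Mapping.keys q"
      using that Poly_Mapping.keys_add[of p q] by blast
    then show ?thesis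
      using assms(2,3) unfolding poly_over_def by blast
  qed
  moreover have "Poly_Mapping.lookup (p + q) m \<in> K" for m
    using assms by (simp add: poly_over_def lookup_add subfield_set_def)
  ultimately show ?thesis
    by (simp add: poly_over_def)
qed

lemma poly_over_sum:
  assumes "subfield_set K" "\<And>a. a \<in> A \<Longrightarrow> f a \<in> poly_over n K"
  shows "(\<Sum>a\<in>A. f a) \<in> poly_over n K"
  using assms(2)
proof (induction A rule: infinite_finite_induct)
  case (insert a A)
  then show ?case
    by (simp add: poly_over_add[OF assms(1)])
qed (use assms(1) in \<open>auto simp: poly_over_def subfield_set_def\<close>)

lemma poly_over_mult:
  assumes K: "subfield_set K" and p: "p \<in> poly_over n K" and q: "q \<in> poly_over n K"
  shows "p * q \<in> poly_over n K"
proof -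
  have "p * q = (\<Sum>m\<in>Poly_Mapping.keys p. \<Sum>l\<in>Poly_Mapping.keys q.
      Poly_Mapping.single (m + l) (Poly_Mapping.lookup p m * Poly_Mapping.lookup q l))"
    by (subst (1) sum_single_lookup[of p, symmetric], subst (1) sum_single_lookup[of q, symmetric])
      (simp only: sum_product mult_single)
  moreover have "Poly_Mapping.single (m + l) (Poly_Mapping.lookup p m * Poly_Mapping.lookup q l) \<in> poly_over n K"
    if "m \<in> Poly_Mapping.keys p" "l \<in> Poly_Mapping.keys q" for m l
  proof (rule poly_over_single)
    have "Poly_Mapping.keys m \<subseteq> {1..n}" "Poly_Mapping.keys l \<subseteq> {1..n}"
      using p q that by (auto simp: poly_over_def)
    then show "Poly_Mapping.keys (m + l) \<subseteq> {1..n}"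
      using Poly_Mapping.keys_add[of m l] by blast
  qed (use K p q in \<open>auto simp: poly_over_def subfield_set_def\<close>)
  ultimately show ?thesis
    by (auto intro!: poly_over_sum[OF K])
qed

lemma Fract_1_add: "Fract (p + q) 1 = Fract p 1 + Fract q 1"
  and Fract_1_mult: "Fract (p * q) 1 = Fract p 1 * Fract q 1"
  by simp_all

definition polyfuns :: "nat \<Rightarrow> complex set \<Rightarrow> cratfun set" where
  "polyfuns n K = (\<lambda>p. Fract p 1) ` poly_over n K"

definition pairs :: "nat \<Rightarrow> (nat \<times> nat) set" where
  "pairs n = {(i, j). i < j \<and> j \<le> n + 1}"

lemma finite_pairs: "finite (pairs n)"
  by (rule finite_subset[of _ "{..n + 1} \<times> {..n + 1}"]) (auto simp: pairs_def)

context
  fixes K :: "complex set" and n :: nat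
  assumes K: "subfield_set K"
begin

interpretation S: simplicial "ratfun_const ` K" n "coord n" ratfun_deriv
  by (rule simplicial_coord[OF K])

lemma polyfuns_add: "a \<in> polyfuns n K \<Longrightarrow> b \<in> polyfuns n K \<Longrightarrow> a + b \<in> polyfuns n K"
  unfolding polyfuns_def by (auto simp flip: Fract_1_add intro!: imageI poly_over_add[OF K])

lemma polyfuns_mult: "a \<in> polyfuns n K \<Longrightarrow> b \<in> polyfuns n K \<Longrightarrow> a * b \<in> polyfuns n K"
  unfolding polyfuns_def by (auto simp flip: Fract_1_mult intro!: imageI poly_over_mult[OF K])

lemma polyfuns_const: "c \<in> K \<Longrightarrow> ratfun_const c \<in> polyfuns n K"
  unfolding polyfuns_def ratfun_const_def
  using K by (intro imageI poly_over_single) (auto simp: subfield_set_def)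

lemma polyfuns_diff: "a \<in> polyfuns n K \<Longrightarrow> b \<in> polyfuns n K \<Longrightarrow> a - b \<in> polyfuns n K"
  using polyfuns_add[of a "ratfun_const (- 1) * b"] polyfuns_mult[of "ratfun_const (- 1)" b] polyfuns_const[of "- 1"] K
  by (simp add: subfield_set_def ratfun_const_uminus)

lemma polyfuns_1: "1 \<in> polyfuns n K"
  using polyfuns_const[of 1] K by (simp add: subfield_set_def)

lemma polyfuns_prod: "(\<And>a. a \<in> A \<Longrightarrow> f a \<in> polyfuns n K) \<Longrightarrow> prod f A \<in> polyfuns n K"
  by (induction A rule: infinite_finite_induct) (auto intro: polyfuns_1 polyfuns_mult)

lemma polyfuns_coord: "i \<in> S.P n \<Longrightarrow> coord n i \<in> polyfuns n K"
proof -
  assume i: "i \<in> S.P n"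
  have 01: "0 \<in> K" "1 \<in> K"
    using K by (auto simp: subfield_set_def)
  show ?thesis
  proof (cases "i \<in> {1..n}")
    case True
    then show ?thesis
      using 01 unfolding polyfuns_def coord_def by (auto intro!: imageI poly_over_single)
  next
    case False
    then have "i = 0 \<or> i = Suc n"
      using i by (auto simp: S.P_def)
    then show ?thesis
      using polyfuns_const[OF 01(1)] polyfuns_1 by (auto simp: coord_def)
  qed
qed

lemma pairs_P: "(i, j) \<in> pairs n \<Longrightarrow> i \<in> S.P n \<and> j \<in> S.P n \<and> i \<noteq> j"
  by (auto simp: pairs_def S.P_def)

lemma discr_pairs: "discr n = (\<Prod>(i, j)\<in>pairs n. coord n j - coord n i)"
  by (simp add: discr_def pairs_def)

lemma discr_nz: "discr n \<noteq> 0"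
  unfolding discr_pairs using finite_pairs pairs_P S.t_neq by (fastforce simp: prod_zero_iff)

lemma discr_polyfuns: "discr n \<in> polyfuns n K"
  unfolding discr_pairs using pairs_P
  by (auto intro!: polyfuns_prod polyfuns_diff polyfuns_coord)

lemma ring_def': "M0_coordinate_ring n K = {a / discr n ^ r |a r. a \<in> polyfuns n K}"
  by (auto simp: M0_coordinate_ring_def polyfuns_def)

lemma ringI: "a \<in> polyfuns n K \<Longrightarrow> a / discr n ^ r \<in> M0_coordinate_ring n K"
  unfolding ring_def' by blast

lemma polyfuns_power: "a \<in> polyfuns n K \<Longrightarrow> a ^ r \<in> polyfuns n K"
  by (induction r) (auto intro: polyfuns_1 polyfuns_mult)

text \<open>Inverse differences need the most care: the inverse of one factor of
  \<open>discr n\<close> is the product of the others divided by \<open>discr n\<close>.\<close>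

lemma R_subset_ring: "a \<in> S.R n \<Longrightarrow> a \<in> M0_coordinate_ring n K"
proof (induction rule: S.R.induct)
  case (R_const c)
  then show ?case
    using ringI[of c 0] polyfuns_const by auto
next
  case (R_coord i)
  then show ?case
    using ringI[of "coord n i" 0] polyfuns_coord by auto
next
  case (R_inv i j)
  have inv: "1 / (coord n b - coord n a) \<in> M0_coordinate_ring n K \<and>
      - (1 / (coord n b - coord n a)) \<in> M0_coordinate_ring n K" if ab: "(a, b) \<in> pairs n" for a b
  proof -
    let ?q = "\<Prod>(i, j)\<in>pairs n - {(a, b)}. coord n j - coord n i"
    have q: "?q \<in> polyfuns n K"
      using pairs_P by (auto intro!: polyfuns_prod polyfuns_diff polyfuns_coord)
    have "discr n = (coord n b - coord n a) * ?q"
      unfolding discr_pairs by (subst prod.remove[OF finite_pairs ab]) (simp only: prod.case)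
    moreover have "coord n b - coord n a \<noteq> 0"
      using pairs_P[OF ab] S.t_neq[of b a] by auto
    ultimately have eq: "1 / (coord n b - coord n a) = ?q / discr n ^ 1"
      using discr_nz by (simp add: field_simps)
    have "ratfun_const (- 1) * ?q \<in> polyfuns n K"
      using K q by (intro polyfuns_mult polyfuns_const) (auto simp: subfield_set_def)
    then show ?thesis
      unfolding eq using ringI[OF q, of 1] ringI[of "ratfun_const (- 1) * ?q" 1]
      by (simp add: ratfun_const_uminus)
  qed
  consider "(i, j) \<in> pairs n" | "(j, i) \<in> pairs n"
    using R_inv by (fastforce simp: pairs_def S.P_def)
  then show ?case
  proof cases
    case 1
    have "1 / (coord n i - coord n j) = - (1 / (coord n j - coord n i))"
      by (metis minus_diff_eq minus_divide_right)
    then show ?thesis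
      using inv[OF 1] by simp
  next
    case 2
    then show ?thesis
      using inv by blast
  qed
next
  case (R_add a b)
  then obtain p q r s where
    p: "p \<in> polyfuns n K" "a = p / discr n ^ r" and q: "q \<in> polyfuns n K" "b = q / discr n ^ s"
    unfolding ring_def' by blast
  have "a + b = (p * discr n ^ s + q * discr n ^ r) / discr n ^ (r + s)"
    using discr_nz by (simp add: p(2) q(2) add_frac_eq power_add)
  then show ?case
    using p(1) q(1) by (simp only:) (intro ringI polyfuns_add polyfuns_mult polyfuns_power discr_polyfuns)
next
  case (R_mult a b)
  then obtain p q r s where
    p: "p \<in> polyfuns n K" "a = p / discr n ^ r" and q: "q \<in> polyfuns n K" "b = q / discr n ^ s"
    unfolding ring_def' by blast
  have "a * b = (p * q) / discr n ^ (r + s)"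
    by (simp add: p(2) q(2) power_add)
  then show ?case
    using p(1) q(1) by (simp only:) (intro ringI polyfuns_mult)
qed

text \<open>Induction on the total degree, splitting off one variable that occurs in the
  monomial.\<close>

lemma monomial_R: "Poly_Mapping.keys m \<subseteq> {1..n} \<Longrightarrow> Fract (Poly_Mapping.single m 1) 1 \<in> S.R n"
proof (induction "\<Sum>i\<in>{1..n}. Poly_Mapping.lookup m i" arbitrary: m rule: less_induct)
  case less
  show ?case
  proof (cases "Poly_Mapping.keys m = {}")
    case True
    then have "m = 0"
      by simp
    then show ?thesis
      using S.R_1[of n] by (simp add: One_fract_def)
  next
    case False
    then obtain i where i: "i \<in> Poly_Mapping.keys m"
      by blast
    define l where "l = m - Poly_Mapping.single i 1"
    have m: "m = Poly_Mapping.single i 1 + l"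
      unfolding l_def using i
      by (intro poly_mapping_eqI) (auto simp: lookup_add lookup_minus lookup_single when_def in_keys_iff)
    have lk: "Poly_Mapping.lookup l j \<le> Poly_Mapping.lookup m j" for j
      by (simp add: m lookup_add)
    have keys: "Poly_Mapping.keys l \<subseteq> {1..n}"
    proof
      fix j
      assume "j \<in> Poly_Mapping.keys l"
      then show "j \<in> {1..n}"
        using lk[of j] less.prems by (auto simp: in_keys_iff subset_iff)
    qed
    have iP: "i \<in> {1..n}"
      using less.prems i by blast
    have "(\<Sum>j\<in>{1..n}. Poly_Mapping.lookup l j) < (\<Sum>j\<in>{1..n}. Poly_Mapping.lookup m j)"
      by (rule sum_strict_mono_ex1) (use lk iP in \<open>auto simp: m lookup_add intro!: bexI[of _ i]\<close>)
    then have "Fract (Poly_Mapping.single l 1) 1 \<in> S.R n"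
      by (rule less.hyps[OF _ keys])
    moreover have "coord n i \<in> S.R n"
      using iP by (intro S.R_coord) (auto simp: S.P_def)
    moreover have "Fract (Poly_Mapping.single m 1) 1 = coord n i * Fract (Poly_Mapping.single l 1) 1"
      using iP by (simp add: m coord_def mult_single)
    ultimately show ?thesis
      by (simp only:) (rule S.R_mult)
  qed
qed

lemma polyfuns_R: "a \<in> polyfuns n K \<Longrightarrow> a \<in> S.R n"
proof -
  assume "a \<in> polyfuns n K"
  then obtain p where p: "p \<in> poly_over n K" "a = Fract p 1"
    by (auto simp: polyfuns_def)
  have sum: "Fract (\<Sum>m\<in>A. f m) 1 = (\<Sum>m\<in>A. Fract (f m) 1)" for A :: "(nat \<Rightarrow>\<^sub>0 nat) set" and f :: "_ \<Rightarrow> cpoly"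
    by (induction A rule: infinite_finite_induct) (simp_all add: Zero_fract_def Fract_1_add del: add_fract)
  have "a = (\<Sum>m\<in>Poly_Mapping.keys p. Fract (Poly_Mapping.single m (Poly_Mapping.lookup p m)) 1)"
    unfolding p(2) by (subst sum_single_lookup[of p, symmetric]) (rule sum)
  moreover have "Fract (Poly_Mapping.single m (Poly_Mapping.lookup p m)) 1 \<in> S.R n"
    if "m \<in> Poly_Mapping.keys p" for m
  proof -
    have "Fract (Poly_Mapping.single m (Poly_Mapping.lookup p m)) 1 =
        ratfun_const (Poly_Mapping.lookup p m) * Fract (Poly_Mapping.single m 1) 1"
      by (simp add: ratfun_const_def mult_single)
    moreover have "ratfun_const (Poly_Mapping.lookup p m) \<in> S.R n"
      using p(1) by (intro S.R_const) (auto simp: poly_over_def)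
    moreover have "Fract (Poly_Mapping.single m 1) 1 \<in> S.R n"
      using p(1) that by (intro monomial_R) (auto simp: poly_over_def)
    ultimately show ?thesis
      by (simp only:) (rule S.R_mult)
  qed
  ultimately show ?thesis
    by (simp only:) (rule S.R_sum)
qed

text \<open>One inclusion is \<open>R_subset_ring\<close>; for the other, \<open>1 / discr n\<close>
  is itself a product of generators of \<open>S.R n\<close>.\<close>

lemma coordinate_ring_eq: "M0_coordinate_ring n K = S.R n"
proof
  show "S.R n \<subseteq> M0_coordinate_ring n K"
    using R_subset_ring by blast
  have d: "1 / discr n \<in> S.R n"
  proof -
    have "1 / discr n = (\<Prod>(i, j)\<in>pairs n. 1 / (coord n j - coord n i))"
      by (simp add: discr_pairs case_prod_unfold prod_dividef)
    also have "\<dots> \<in> S.R n"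
      using pairs_P by (auto intro!: S.R_prod S.R_inv)
    finally show ?thesis .
  qed
  have "a * (1 / discr n) ^ r \<in> S.R n" if "a \<in> polyfuns n K" for a r
    by (rule S.R_mult[OF polyfuns_R[OF that] S.R_power[OF d]])
  then show "M0_coordinate_ring n K \<subseteq> S.R n"
    unfolding ring_def' by (auto simp: power_one_over)
qed

end

section \<open>Forms of top degree\<close>

lemma minus_ring_of_type: "\<ominus>\<^bsub>ring_of_type_algebra\<^esub> a = - (a :: complex)"
proof -
  interpret ring "ring_of_type_algebra :: complex ring"
    by (rule ring_from_type_algebra)
  have "a \<oplus>\<^bsub>ring_of_type_algebra\<^esub> (\<ominus>\<^bsub>ring_of_type_algebra\<^esub> a) = \<zero>\<^bsub>ring_of_type_algebra\<^esub>"
    by (rule r_neg) (simp add: ring_of_type_algebra_def)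
  then show ?thesis
    by (simp add: ring_of_type_algebra_def eq_neg_iff_add_eq_0 add.commute)
qed

lemma inv_ring_of_type:
  assumes "a \<noteq> (0 :: complex)"
  shows "inv\<^bsub>ring_of_type_algebra\<^esub> a = 1 / a"
proof -
  interpret field "ring_of_type_algebra :: complex ring"
    by (rule field_from_type_algebra)
  have "a \<in> Units ring_of_type_algebra"
    using assms unfolding field_Units by (simp add: ring_of_type_algebra_def)
  then have "a \<otimes>\<^bsub>ring_of_type_algebra\<^esub> inv\<^bsub>ring_of_type_algebra\<^esub> a = \<one>\<^bsub>ring_of_type_algebra\<^esub>"
    by (rule Units_r_inv)
  then show ?thesis
    using assms by (simp add: ring_of_type_algebra_def field_simps)
qed

lemma Q_dR_simps [simp]:
  "a \<oplus>\<^bsub>Q_dR n s\<^esub> b = a + b" "a \<otimes>\<^bsub>Q_dR n s\<^esub> b = a * b"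
  "\<zero>\<^bsub>Q_dR n s\<^esub> = 0" "\<one>\<^bsub>Q_dR n s\<^esub> = 1"
  by (simp_all add: Q_dR_def ring_of_type_algebra_def)

lemma field_Q_dR: "field (Q_dR n s)"
proof -
  interpret field "ring_of_type_algebra :: complex ring"
    by (rule field_from_type_algebra)
  show ?thesis
    unfolding Q_dR_def by (rule generate_field_is_field) (simp add: ring_of_type_algebra_def)
qed

lemma subfield_set_Q_dR: "subfield_set (carrier (Q_dR n s))"
proof -
  let ?R = "ring_of_type_algebra :: complex ring"
  let ?G = "generate_field ?R {s i j |i j. i \<in> {1..n+3} \<and> j \<in> {1..n+3}}"
  have carrier: "carrier (Q_dR n s) = ?G"
    by (simp add: Q_dR_def)
  have ops: "a \<oplus>\<^bsub>?R\<^esub> b = a + b" "a \<otimes>\<^bsub>?R\<^esub> b = a * b" "\<zero>\<^bsub>?R\<^esub> = 0" "\<one>\<^bsub>?R\<^esub> = 1" for a b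
    by (simp_all add: ring_of_type_algebra_def)
  have 1: "1 \<in> ?G"
    using generate_field.one[of ?R] by (simp only: ops)
  have m: "- a \<in> ?G" if "a \<in> ?G" for a
    using generate_field.a_inv[OF that] by (simp only: minus_ring_of_type)
  have p: "a + b \<in> ?G" "a * b \<in> ?G" if "a \<in> ?G" "b \<in> ?G" for a b
    using generate_field.eng_add[OF that] generate_field.eng_mult[OF that] by (simp_all only: ops)
  \<comment> \<open>Zero is not among the introduction rules of \<open>generate_field\<close>; it
    arises as \<open>1 + (- 1)\<close>.\<close>
  have 0: "0 \<in> ?G"
    using p(1)[OF 1 m[OF 1]] by simp
  have i: "1 / a \<in> ?G" if "a \<in> ?G" for a
  proof (cases "a = 0")
    case False
    then have "inv\<^bsub>?R\<^esub> a \<in> ?G"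
      using that by (intro generate_field.m_inv) (auto simp: ops)
    then show ?thesis
      using False by (simp add: inv_ring_of_type)
  qed (use 0 in simp)
  show ?thesis
    unfolding subfield_set_def carrier by (intro conjI ballI 0 1 m p i)
qed

lemma s_in_Q_dR: "i \<in> {1..n+3} \<Longrightarrow> j \<in> {1..n+3} \<Longrightarrow> s i j \<in> carrier (Q_dR n s)"
  unfolding Q_dR_def by (auto intro: generate_field.incl)

text \<open>The coordinate \<open>t\<^sub>0 = 0\<close> belongs to the marked point \<open>n + 3\<close>.\<close>

definition node :: "nat \<Rightarrow> nat \<Rightarrow> nat" where
  "node n i = (if i = 0 then n + 3 else i)"

definition node_exponent :: "nat \<Rightarrow> (nat \<Rightarrow> nat \<Rightarrow> complex) \<Rightarrow> nat \<Rightarrow> nat \<Rightarrow> complex" where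
  "node_exponent n s i j = s (node n i) (node n j)"

lemma sum_symmetric:
  fixes f :: "nat \<Rightarrow> nat \<Rightarrow> complex"
  assumes "finite I" "\<And>i. i \<in> I \<Longrightarrow> f i i = 0" "\<And>i j. i \<in> I \<Longrightarrow> j \<in> I \<Longrightarrow> f i j = f j i"
  shows "(\<Sum>i\<in>I. \<Sum>j\<in>I. f i j) = 2 * (\<Sum>(i, j)\<in>{(i, j). i \<in> I \<and> j \<in> I \<and> i < j}. f i j)"
proof -
  let ?L = "{(i, j). i \<in> I \<and> j \<in> I \<and> i < j}" and ?U = "{(i, j). i \<in> I \<and> j \<in> I \<and> j < i}"
  let ?E = "{(i, j). i \<in> I \<and> j \<in> I \<and> i = j}"
  have split: "I \<times> I = ?L \<union> (?U \<union> ?E)"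
    by auto
  have fin: "finite ?L" "finite ?U" "finite ?E"
    by (rule finite_subset[of _ "I \<times> I"]; use assms(1) in auto)+
  have "(\<Sum>i\<in>I. \<Sum>j\<in>I. f i j) = (\<Sum>(i, j)\<in>I \<times> I. f i j)"
    by (simp add: sum.cartesian_product)
  also have "\<dots> = (\<Sum>(i, j)\<in>?L. f i j) + ((\<Sum>(i, j)\<in>?U. f i j) + (\<Sum>(i, j)\<in>?E. f i j))"
    unfolding split using fin by (subst sum.union_disjoint; (subst sum.union_disjoint)?; auto)
  also have "(\<Sum>(i, j)\<in>?E. f i j) = 0"
    by (rule sum.neutral) (use assms(2) in auto)
  also have "(\<Sum>(i, j)\<in>?U. f i j) = (\<Sum>(i, j)\<in>?L. f i j)"
    by (rule sum.reindex_bij_witness[of _ prod.swap prod.swap]) (use assms(3) in auto)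
  finally show ?thesis
    by simp
qed

section \<open>Exponents at the finite marked points\<close>

context
  fixes n :: nat and s :: "nat \<Rightarrow> nat \<Rightarrow> complex"
  assumes adm: "admissible n s" and gen: "generic n s"
begin

abbreviation (input) "KK \<equiv> carrier (Q_dR n s)"
abbreviation (input) "HH \<equiv> dR_cohomology n s n"

interpretation S: simplicial "ratfun_const ` KK" n "coord n" ratfun_deriv
  by (rule simplicial_coord[OF subfield_set_Q_dR])

lemma node_range: "i \<in> S.P n \<Longrightarrow> node n i \<in> {1..n+3} \<and> node n i \<noteq> n + 2"
  by (auto simp: S.P_def node_def)

lemma node_inj: "inj_on (node n) (S.P n)"
  by (auto simp: inj_on_def S.P_def node_def)

text \<open>The point \<open>n + 2\<close> is infinity, the one marked point without a
  coordinate.\<close>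

lemma node_image: "node n ` S.P n = {1..n+3} - {n+2}"
proof
  show "node n ` S.P n \<subseteq> {1..n+3} - {n+2}"
    using node_range by auto
  show "{1..n+3} - {n+2} \<subseteq> node n ` S.P n"
  proof
    fix i
    assume i: "i \<in> {1..n+3} - {n+2}"
    show "i \<in> node n ` S.P n"
    proof (cases "i = n + 3")
      case True
      then show ?thesis
        by (intro image_eqI[of _ _ 0]) (auto simp: node_def S.P_def)
    next
      case False
      then show ?thesis
        using i by (intro image_eqI[of _ _ i]) (auto simp: node_def S.P_def)
    qed
  qed
qed

lemma node_exponent_K: "i \<in> S.P n \<Longrightarrow> j \<in> S.P n \<Longrightarrow> node_exponent n s i j \<in> KK"
  unfolding node_exponent_def by (rule s_in_Q_dR) (use node_range in blast)+

lemma s_sym: "i \<in> {1..n+3} \<Longrightarrow> j \<in> {1..n+3} \<Longrightarrow> s i j = s j i"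
  and s_diag: "i \<in> {1..n+3} \<Longrightarrow> s i i = 0"
  and s_row: "i \<in> {1..n+3} \<Longrightarrow> (\<Sum>j\<in>{1..n+3}. s i j) = 0"
  using adm unfolding admissible_def by blast+

lemma node_exponent_sym: "i \<in> S.P n \<Longrightarrow> j \<in> S.P n \<Longrightarrow> node_exponent n s i j = node_exponent n s j i"
  unfolding node_exponent_def using node_range by (intro s_sym) blast+

lemma node_exponent_diag: "i \<in> S.P n \<Longrightarrow> node_exponent n s i i = 0"
  unfolding node_exponent_def using node_range by (intro s_diag) blast

lemma node_exponent_sum: "I \<subseteq> S.P n \<Longrightarrow> (\<Sum>i\<in>I. \<Sum>j\<in>I. node_exponent n s i j) = (\<Sum>i\<in>node n ` I. \<Sum>j\<in>node n ` I. s i j)"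
  using inj_on_subset[OF node_inj] by (simp add: sum.reindex node_exponent_def)

text \<open>Omitting the point \<open>n + 2\<close> from every row sum leaves minus its own row,
  whose sum is again 0.\<close>

lemma node_exponent_total: "(\<Sum>i\<in>S.P n. \<Sum>j\<in>S.P n. node_exponent n s i j) = 0"
proof -
  let ?J = "{1..n+3} - {n+2}"
  have split: "(\<Sum>j\<in>{1..n+3}. f j) = f (n + 2) + (\<Sum>j\<in>?J. f j)" for f :: "nat \<Rightarrow> complex"
    by (rule sum.remove) auto
  have 1: "(\<Sum>j\<in>?J. s i j) = - s (n + 2) i" if "i \<in> {1..n+3}" for i
    using s_row[OF that] split[of "s i"] s_sym[OF that, of "n + 2"] by (simp add: add_eq_0_iff)
  have "(\<Sum>i\<in>?J. \<Sum>j\<in>?J. s i j) = (\<Sum>i\<in>?J. - s (n + 2) i)"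
    by (rule sum.cong) (use 1 in auto)
  also have "\<dots> = - (\<Sum>i\<in>?J. s (n + 2) i)"
    by (rule sum_negf)
  also have "\<dots> = 0"
    using 1[of "n + 2"] s_diag[of "n + 2"] by simp
  finally show ?thesis
    by (simp add: node_exponent_sum node_image)
qed

text \<open>At most \<open>n + 1\<close> of the \<open>n + 3\<close> points leave a complement of at
  least two, so genericity applies. Ordered pairs count everything twice, whence the even
  integers.\<close>

lemma node_exponent_generic:
  assumes I: "I \<subseteq> S.P n" "2 \<le> card I" "card I \<le> n + 1"
  shows "(\<Sum>i\<in>I. \<Sum>j\<in>I. node_exponent n s i j) \<noteq> 2 * of_int m"
proof -
  let ?J = "node n ` I"
  have J: "?J \<subseteq> {1..n+3}"
    using node_range I(1) by blast
  have cJ: "card ?J = card I"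
    by (rule card_image[OF inj_on_subset[OF node_inj I(1)]])
  have "card ({1..n+3} - ?J) = n + 3 - card I"
    using card_Diff_subset[OF _ J] cJ finite_subset[OF J] by simp
  then have "(\<Sum>(i, j)\<in>{(i, j). i \<in> ?J \<and> j \<in> ?J \<and> i < j}. s i j) \<notin> \<int>"
    using gen J cJ I unfolding generic_def by force
  moreover have "(\<Sum>i\<in>?J. \<Sum>j\<in>?J. s i j) = 2 * (\<Sum>(i, j)\<in>{(i, j). i \<in> ?J \<and> j \<in> ?J \<and> i < j}. s i j)"
  proof (rule sum_symmetric)
    show "finite ?J"
      by (rule finite_subset[OF J]) simp
    show "s i i = 0" if "i \<in> ?J" for i
      by (rule s_diag[OF subsetD[OF J that]])
    show "s i j = s j i" if "i \<in> ?J" "j \<in> ?J" for i j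
      by (rule s_sym[OF subsetD[OF J that(1)] subsetD[OF J that(2)]])
  qed
  ultimately show ?thesis
    unfolding node_exponent_sum[OF I(1)] by auto
qed

definition exponent :: "nat \<Rightarrow> nat \<Rightarrow> cratfun" where
  "exponent i j = ratfun_const (node_exponent n s i j)"

lemma exponent_K: "i \<in> S.P n \<Longrightarrow> j \<in> S.P n \<Longrightarrow> exponent i j \<in> ratfun_const ` KK"
  unfolding exponent_def by (intro imageI node_exponent_K)

lemma exponent_sym: "i \<in> S.P n \<Longrightarrow> j \<in> S.P n \<Longrightarrow> exponent i j = exponent j i"
  unfolding exponent_def using node_exponent_sym by simp

lemma exponent_diag: "i \<in> S.P n \<Longrightarrow> exponent i i = 0"
  unfolding exponent_def using node_exponent_diag by simp

lemma ratfun_const_of_int: "ratfun_const (of_int m) = of_int m"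
  by (cases m rule: int_cases2) (simp_all add: ratfun_const_of_nat ratfun_const_uminus)

lemma exponent_total: "(\<Sum>i\<in>S.P n. \<Sum>j\<in>S.P n. exponent i j) = 0"
  unfolding exponent_def by (simp add: node_exponent_total flip: ratfun_const_sum)

lemma exponent_generic:
  assumes "I \<subseteq> S.P n" "2 \<le> card I" "card I \<le> n + 1"
  shows "(\<Sum>i\<in>I. \<Sum>j\<in>I. exponent i j) \<noteq> 2 * of_int m"
proof -
  have "2 * of_int m = ratfun_const (2 * of_int m)"
    using ratfun_const_of_int[of "2 * m"] by simp
  then show ?thesis
    unfolding exponent_def using node_exponent_generic[OF assms, of m]
    by (simp add: ratfun_const_inj flip: ratfun_const_sum)
qed

lemma weighted_exponent: "weighted (ratfun_const ` KK) n (coord n) ratfun_deriv exponent"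
  by (intro weighted.intro weighted_axioms.intro S.simplicial_axioms exponent_K exponent_sym exponent_diag
      exponent_total exponent_generic)

interpretation S: weighted "ratfun_const ` KK" n "coord n" ratfun_deriv exponent
  by (rule weighted_exponent)

lemma ring_eq: "M0_coordinate_ring n (KK) = S.R n"
  by (rule coordinate_ring_eq[OF subfield_set_Q_dR])

section \<open>The connection in terms of coefficients\<close>

lemma deriv_coord_off:
  assumes "i \<in> S.P n" "j \<notin> {1..n}"
  shows "ratfun_deriv j (coord n i) = 0"
proof (cases "i \<in> {1..n}")
  case True
  then have "i \<noteq> j"
    using assms(2) by auto
  moreover have "coord n i = Fract (Poly_Mapping.single (Poly_Mapping.single i 1) 1) 1"
    using True by (simp add: coord_def)
  ultimately show ?thesis
    by (simp add: ratfun_deriv_Fract poly_deriv_single poly_deriv_1 lookup_single when_def Zero_fract_def)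
next
  case False
  then have "i = 0 \<or> i = Suc n"
    using assms(1) by (auto simp: S.P_def)
  then show ?thesis
    by (auto simp: S.t_0 S.t_last[simplified])
qed

lemma deriv_off:
  assumes "a \<in> S.R n" "j \<notin> {1..n}"
  shows "ratfun_deriv j a = 0"
  using assms(1)
proof (induction rule: S.R.induct)
  case (R_coord i)
  then show ?case
    by (rule deriv_coord_off[OF _ assms(2)])
next
  case (R_inv i l)
  then show ?case
    using deriv_coord_off[OF _ assms(2)] by (subst S.D_inv) auto
qed (auto simp: S.D_K S.D.d_add S.D.d_mult)

lemma dlog_single: "dlog f {j} = ratfun_deriv j f / f"
proof -
  have empty: "{i. i = j \<and> i < j} = {}"
    by auto
  show ?thesis
    by (simp add: dlog_def ext_deriv_def empty)
qed

lemma dlog_off: "(\<And>j. J \<noteq> {j}) \<Longrightarrow> dlog f J = 0"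
proof -
  assume J: "\<And>j. J \<noteq> {j}"
  have "J - {j} \<noteq> {}" if "j \<in> J" for j
    using that J[of j] by blast
  then have "ext_deriv (\<lambda>I. if I = {} then f else 0) J = 0"
    unfolding ext_deriv_def by (intro sum.neutral) auto
  then show ?thesis
    by (simp add: dlog_def)
qed

lemma omega_pairs: "omega n s J = (\<Sum>(a, b)\<in>pairs n. ratfun_const (s0 n s a b) * dlog (coord n b - coord n a) J)"
  by (simp add: omega_def pairs_def)

lemma pairs_range: "(a, b) \<in> pairs n \<Longrightarrow> a \<in> S.P n \<and> b \<in> S.P n \<and> a < b"
  by (auto simp: pairs_def S.P_def)

lemma coord_diff_R: "(a, b) \<in> pairs n \<Longrightarrow> coord n b - coord n a \<in> S.R n"
  using pairs_range by (intro S.R_diff S.R_coord) auto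

lemma omega_off:
  assumes "\<And>j. j \<in> {1..n} \<Longrightarrow> J \<noteq> {j}"
  shows "omega n s J = 0"
proof -
  have "dlog (coord n b - coord n a) J = 0" if "(a, b) \<in> pairs n" for a b
  proof (cases "\<exists>j. J = {j}")
    case True
    then obtain j where "J = {j}" "j \<notin> {1..n}"
      using assms by blast
    then show ?thesis
      by (simp add: dlog_single deriv_off[OF coord_diff_R[OF that]])
  qed (auto intro: dlog_off)
  then show ?thesis
    unfolding omega_pairs by (intro sum.neutral) auto
qed

text \<open>A pair contributes to the component at \<open>j\<close> only if it contains
  \<open>j\<close>. Reversing a pair changes neither its exponent nor its logarithmic derivative, so
  the pairs below and above \<open>j\<close> fit one formula.\<close>

lemma omega_single:
  assumes j: "j \<in> {1..n}"
  shows "omega n s {j} = S.log_coeff j"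
proof -
  define G where "G l = exponent j l / (coord n j - coord n l)" for l
  have jP: "j \<in> S.P n"
    using j by (auto simp: S.P_def)
  have fin: "finite (pairs n)"
    by (rule finite_pairs)
  have summand: "ratfun_const (s0 n s a b) * dlog (coord n b - coord n a) {j} =
      (if b = j then G a else 0) + (if a = j then G b else 0)" if ab: "(a, b) \<in> pairs n" for a b
  proof -
    note r = pairs_range[OF ab]
    \<comment> \<open>For \<open>a = 0\<close> the definitions of \<open>s0\<close> and
      \<open>node_exponent\<close> take the two arguments of \<open>s\<close> in opposite order;
      symmetry reconciles them.\<close>
    have s0: "ratfun_const (s0 n s a b) = exponent a b"
      using s_sym[of b "n + 3"] r by (auto simp: s0_def exponent_def node_exponent_def node_def S.P_def)
    have d: "ratfun_deriv j (coord n b - coord n a) = (if j = b then 1 else 0) - (if j = a then 1 else 0)"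
      using S.D_t'[OF j] r by (simp add: S.D.d_diff)
    consider "b = j" "a \<noteq> j" | "a = j" "b \<noteq> j" | "a \<noteq> j" "b \<noteq> j"
      using r by blast
    then show ?thesis
    proof cases
      case 1
      then show ?thesis
        using r exponent_sym[of a b] s0 d by (simp add: dlog_single G_def)
    next
      case 2
      have "- 1 / (coord n b - coord n j) = 1 / (coord n j - coord n b)"
        using minus_divide_divide[of 1 "coord n j - coord n b"] by simp
      then show ?thesis
        using 2 s0 d by (simp add: dlog_single G_def)
    next
      case 3
      then show ?thesis
        using d by (simp add: dlog_single)
    qed
  qed
  have "omega n s {j} = (\<Sum>x\<in>pairs n. (if snd x = j then G (fst x) else 0) + (if fst x = j then G (snd x) else 0))"
    unfolding omega_pairs
  proof (rule sum.cong)
    fix x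
    assume "x \<in> pairs n"
    then show "(case x of (a, b) \<Rightarrow> ratfun_const (s0 n s a b) * dlog (coord n b - coord n a) {j}) =
        (if snd x = j then G (fst x) else 0) + (if fst x = j then G (snd x) else 0)"
      by (cases x) (simp only: prod.case fst_conv snd_conv summand)
  qed simp
  also have "\<dots> = (\<Sum>x\<in>{x \<in> pairs n. snd x = j}. G (fst x)) + (\<Sum>x\<in>{x \<in> pairs n. fst x = j}. G (snd x))"
    using fin by (simp add: sum.distrib sum.inter_filter)
  also have "(\<Sum>x\<in>{x \<in> pairs n. snd x = j}. G (fst x)) = (\<Sum>a\<in>{..<j}. G a)"
    by (rule sum.reindex_bij_witness[of _ "\<lambda>a. (a, j)" fst]) (use j in \<open>auto simp: pairs_def\<close>)
  also have "(\<Sum>x\<in>{x \<in> pairs n. fst x = j}. G (snd x)) = (\<Sum>b\<in>{j<..n + 1}. G b)"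
    by (rule sum.reindex_bij_witness[of _ "\<lambda>b. (j, b)" snd]) (use j in \<open>auto simp: pairs_def\<close>)
  also have "(\<Sum>a\<in>{..<j}. G a) + (\<Sum>b\<in>{j<..n + 1}. G b) = (\<Sum>l\<in>{..<j} \<union> {j<..n + 1}. G l)"
    by (rule sum.union_disjoint[symmetric]) auto
  also have "{..<j} \<union> {j<..n + 1} = S.P n - {j}"
    using j by (auto simp: S.P_def)
  finally show ?thesis
    unfolding G_def S.log_coeff_def .
qed

lemma forms_R: "\<alpha> \<in> forms n (KK) k \<Longrightarrow> \<alpha> I \<in> S.R n"
proof -
  assume "\<alpha> \<in> forms n (KK) k"
  then have "if I \<subseteq> {1..n} \<and> card I = k then \<alpha> I \<in> S.R n else \<alpha> I = 0"
    unfolding forms_def ring_eq by blast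
  then show ?thesis
    using S.R_0 by (auto split: if_splits)
qed

lemma forms_off: "\<alpha> \<in> forms n (KK) k \<Longrightarrow> \<not> (I \<subseteq> {1..n} \<and> card I = k) \<Longrightarrow> \<alpha> I = 0"
  unfolding forms_def by (metis (mono_tags, lifting) mem_Collect_eq)

text \<open>The connection form has degree one, so only singletons contribute to the wedge product,
  and their sign is that of the exterior derivative.\<close>

lemma nabla_eq:
  assumes \<alpha>: "\<alpha> \<in> forms n (KK) k"
  shows "nabla n s \<alpha> J = (if J \<subseteq> {1..n} then
    (\<Sum>j\<in>J. (-1) ^ card {i \<in> J. i < j} * (ratfun_deriv j (\<alpha> (J - {j})) + S.log_coeff j * \<alpha> (J - {j}))) else 0)"
proof (cases "finite J")
  case False
  \<comment> \<open>For an infinite index set all sums involved are 0 by convention.\<close>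
  then have "infinite (Pow J)" "\<not> J \<subseteq> {1..n}"
    using finite_subset by (auto simp: finite_Pow_iff)
  then show ?thesis
    using False by (simp add: nabla_def ext_deriv_def wedge_def)
next
  case True
  have w: "wedge (omega n s) \<alpha> J = (\<Sum>j\<in>J. (-1) ^ card {i \<in> J. i < j} * omega n s {j} * \<alpha> (J - {j}))"
  proof -
    have "wedge (omega n s) \<alpha> J = (\<Sum>I\<in>(\<lambda>j. {j}) ` J.
        (-1) ^ card {(i, j). i \<in> I \<and> j \<in> J - I \<and> j < i} * omega n s I * \<alpha> (J - I))"
      unfolding wedge_def
    proof (rule sum.mono_neutral_right)
      show "\<forall>I\<in>Pow J - (\<lambda>j. {j}) ` J.
          (-1) ^ card {(i, j). i \<in> I \<and> j \<in> J - I \<and> j < i} * omega n s I * \<alpha> (J - I) = 0"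
      proof
        fix I
        assume "I \<in> Pow J - (\<lambda>j. {j}) ` J"
        then have "omega n s I = 0"
          by (intro omega_off) auto
        then show "(-1) ^ card {(i, j). i \<in> I \<and> j \<in> J - I \<and> j < i} * omega n s I * \<alpha> (J - I) = 0"
          by simp
      qed
    qed (use True in auto)
    also have "\<dots> = (\<Sum>j\<in>J. (-1) ^ card {(i, l). i \<in> {j} \<and> l \<in> J - {j} \<and> l < i} * omega n s {j} * \<alpha> (J - {j}))"
      by (subst sum.reindex) (auto simp: inj_on_def)
    also have "\<dots> = (\<Sum>j\<in>J. (-1) ^ card {i \<in> J. i < j} * omega n s {j} * \<alpha> (J - {j}))"
    proof (rule sum.cong)
      fix j
      assume "j \<in> J"
      have "{(i, l). i \<in> {j} \<and> l \<in> J - {j} \<and> l < i} = Pair j ` {i \<in> J. i < j}"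
        by auto
      then show "(-1) ^ card {(i, l). i \<in> {j} \<and> l \<in> J - {j} \<and> l < i} * omega n s {j} * \<alpha> (J - {j}) =
          (-1) ^ card {i \<in> J. i < j} * omega n s {j} * \<alpha> (J - {j})"
        by (simp add: card_image inj_on_def)
    qed simp
    finally show ?thesis .
  qed
  have eq: "nabla n s \<alpha> J = (\<Sum>j\<in>J. (-1) ^ card {i \<in> J. i < j} *
      (ratfun_deriv j (\<alpha> (J - {j})) + omega n s {j} * \<alpha> (J - {j})))"
    by (simp add: nabla_def ext_deriv_def w distrib_left mult.assoc flip: sum.distrib)
  show ?thesis
  proof (cases "J \<subseteq> {1..n}")
    case True
    then show ?thesis
      unfolding eq using omega_single by (auto intro!: sum.cong)
  next
    case False
    have "ratfun_deriv j (\<alpha> (J - {j})) + omega n s {j} * \<alpha> (J - {j}) = 0" if "j \<in> J" for j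
    proof (cases "j \<in> {1..n}")
      case True
      then have "\<not> J - {j} \<subseteq> {1..n}"
        using False by blast
      then have "\<alpha> (J - {j}) = 0"
        by (intro forms_off[OF \<alpha>]) simp
      then show ?thesis
        by simp
    next
      case False
      then have "omega n s {j} = 0"
        by (intro omega_off) auto
      then show ?thesis
        using deriv_off[OF forms_R[OF \<alpha>] False] by simp
    qed
    then show ?thesis
      unfolding eq using False by simp
  qed
qed

definition top_form :: "cratfun \<Rightarrow> dform" where
  "top_form a = (\<lambda>I. if I = {1..n} then a else 0)"

lemma top_form_apply [simp]: "top_form a {1..n} = a"
  by (simp add: top_form_def)

lemma top_form_inj: "top_form a = top_form b \<longleftrightarrow> a = b"
  by (metis top_form_apply)

lemma top_form_index: "I \<subseteq> {1..n} \<and> card I = n \<longleftrightarrow> I = {1..n}"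
  using card_subset_eq[of "{1..n}" I] by auto

lemma forms_top_form: "forms n (KK) n = top_form ` S.R n"
proof
  show "top_form ` S.R n \<subseteq> forms n (KK) n"
    unfolding forms_def ring_eq top_form_index top_form_def by (simp add: image_subset_iff)
  show "forms n (KK) n \<subseteq> top_form ` S.R n"
  proof
    fix \<alpha>
    assume \<alpha>: "\<alpha> \<in> forms n (KK) n"
    have "\<alpha> I = top_form (\<alpha> {1..n}) I" for I
      using forms_off[OF \<alpha>, of I] unfolding top_form_index by (auto simp: top_form_def)
    then have "\<alpha> = top_form (\<alpha> {1..n})"
      by (rule ext)
    then show "\<alpha> \<in> top_form ` S.R n"
      using forms_R[OF \<alpha>] by blast
  qed
qed

text \<open>The coefficients of exact forms in top degree, in the shape of \<open>kz_image\<close>.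
  The signs of the exterior derivative are absorbed into \<open>b\<close>, as
  \<open>coboundaries_top\<close> justifies.\<close>

definition exact :: "cratfun set" where
  "exact = {\<Sum>i\<in>{1..n}. ratfun_deriv i (b i) + S.log_coeff i * b i | b. \<forall>i\<in>{1..n}. b i \<in> S.R n}"

lemma exactI: "(\<And>i. i \<in> {1..n} \<Longrightarrow> b i \<in> S.R n) \<Longrightarrow>
    (\<Sum>i\<in>{1..n}. ratfun_deriv i (b i) + S.log_coeff i * b i) \<in> exact"
  unfolding exact_def by blast

lemma exact_0: "0 \<in> exact"
  using exactI[of "\<lambda>_. 0"] S.R_0 by simp

lemma exact_add: "a \<in> exact \<Longrightarrow> b \<in> exact \<Longrightarrow> a + b \<in> exact"
proof -
  assume "a \<in> exact" "b \<in> exact"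
  then obtain f g where f: "\<And>i. i \<in> {1..n} \<Longrightarrow> f i \<in> S.R n" "a = (\<Sum>i\<in>{1..n}. ratfun_deriv i (f i) + S.log_coeff i * f i)"
    and g: "\<And>i. i \<in> {1..n} \<Longrightarrow> g i \<in> S.R n" "b = (\<Sum>i\<in>{1..n}. ratfun_deriv i (g i) + S.log_coeff i * g i)"
    unfolding exact_def by blast
  have "a + b = (\<Sum>i\<in>{1..n}. ratfun_deriv i (f i + g i) + S.log_coeff i * (f i + g i))"
    unfolding f(2) g(2) sum.distrib[symmetric] by (rule sum.cong) (auto simp: S.D.d_add algebra_simps)
  then show ?thesis
    using f(1) g(1) by (simp only:) (rule exactI, rule S.R_add)
qed

lemma exact_scale: "c \<in> KK \<Longrightarrow> a \<in> exact \<Longrightarrow> ratfun_const c * a \<in> exact"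
proof -
  assume c: "c \<in> KK" and "a \<in> exact"
  then obtain f where f: "\<And>i. i \<in> {1..n} \<Longrightarrow> f i \<in> S.R n" "a = (\<Sum>i\<in>{1..n}. ratfun_deriv i (f i) + S.log_coeff i * f i)"
    unfolding exact_def by blast
  have cK: "ratfun_const c \<in> ratfun_const ` KK"
    using c by blast
  have "ratfun_const c * a = (\<Sum>i\<in>{1..n}. ratfun_deriv i (ratfun_const c * f i) + S.log_coeff i * (ratfun_const c * f i))"
    unfolding f(2) sum_distrib_left by (rule sum.cong) (auto simp: S.D.d_mult S.D_K[OF cK] algebra_simps)
  then show ?thesis
    using f(1) by (simp only:) (intro exactI S.R_mult S.R_const[OF cK])
qed

lemma exact_uminus: "a \<in> exact \<Longrightarrow> - a \<in> exact"
  using exact_scale[of "- 1" a] subfield_set_Q_dR[of n s] by (simp add: subfield_set_def ratfun_const_uminus)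

lemma cocycles_top: "dR_cocycles n s n = top_form ` S.R n"
proof -
  have "nabla n s \<alpha> = (\<lambda>_. 0)" if \<alpha>: "\<alpha> \<in> forms n (KK) n" for \<alpha>
  proof
    fix J
    have "\<alpha> (J - {j}) = 0" if "j \<in> J" "J \<subseteq> {1..n}" for j
    proof (rule forms_off[OF \<alpha>])
      show "\<not> (J - {j} \<subseteq> {1..n} \<and> card (J - {j}) = n)"
        unfolding top_form_index using that by blast
    qed
    then show "nabla n s \<alpha> J = 0"
      unfolding nabla_eq[OF \<alpha>] by (auto intro!: sum.neutral)
  qed
  then show ?thesis
    unfolding dR_cocycles_def a_kernel_def' dR_forms_def by (auto simp: forms_top_form)
qed

text \<open>Forms of degree \<open>n - 1\<close> correspond to families \<open>b\<close> through the
  index sets omitting one element. For \<open>n = 0\<close> the coboundaries are 0 by definition and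
  \<open>exact\<close> contains only the empty sum.\<close>

lemma coboundaries_top: "dR_coboundaries n s n = top_form ` exact"
proof (cases "n = 0")
  case True
  have "exact = {0}"
    unfolding exact_def using True by auto
  moreover have "top_form 0 = (\<lambda>_. 0)"
    by (auto simp: top_form_def)
  ultimately show ?thesis
    using True by (simp add: dR_coboundaries_def dR_forms_def)
next
  case False
  \<comment> \<open>The sign of moving the differential of \<open>t j\<close> into its place. It is
    a constant with square 1, so it passes freely between a form and its family of
    coefficients.\<close>
  define sg where "sg j = (-1 :: cratfun) ^ card {i \<in> {1..n}. i < j}" for j :: nat
  have sg2: "sg j * sg j = 1" for j
    by (simp add: sg_def flip: power_mult_distrib)
  have sg_R: "sg j \<in> S.R n" for j
    unfolding sg_def by (intro S.R_power S.R_uminus S.R_1)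
  have sgd: "ratfun_deriv j (sg j * b) = sg j * ratfun_deriv j b" for j b
  proof -
    have "ratfun_deriv j (sg j) = 0"
      by (simp add: sg_def S.D.d_power S.D.d_minus)
    then show ?thesis
      by (simp add: S.D.d_mult)
  qed
  have kz: "nabla n s \<alpha> = top_form (\<Sum>j\<in>{1..n}. ratfun_deriv j (sg j * \<alpha> ({1..n} - {j})) + S.log_coeff j * (sg j * \<alpha> ({1..n} - {j})))"
    if \<alpha>: "\<alpha> \<in> forms n (KK) (n - 1)" for \<alpha>
  proof
    fix J
    show "nabla n s \<alpha> J = top_form (\<Sum>j\<in>{1..n}. ratfun_deriv j (sg j * \<alpha> ({1..n} - {j})) + S.log_coeff j * (sg j * \<alpha> ({1..n} - {j}))) J"
    proof (cases "J = {1..n}")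
      case True
      show ?thesis
        unfolding True nabla_eq[OF \<alpha>] top_form_apply sgd by (auto simp: sg_def algebra_simps intro!: sum.cong)
    next
      case False
      have "\<alpha> (J - {j}) = 0" if "j \<in> J" "J \<subseteq> {1..n}" for j
      proof (rule forms_off[OF \<alpha>])
        have "finite J"
          using that(2) finite_subset by blast
        then have "card J = Suc (card (J - {j}))"
          using that(1) by (rule card.remove)
        then have "card (J - {j}) = n - 1 \<Longrightarrow> card J = n"
          using \<open>n \<noteq> 0\<close> by simp
        then show "\<not> (J - {j} \<subseteq> {1..n} \<and> card (J - {j}) = n - 1)"
          using False that(2) top_form_index[of J] by auto
      qed
      then show ?thesis
        using False unfolding nabla_eq[OF \<alpha>] by (auto simp: top_form_def intro!: sum.neutral)
    qed
  qed
  have "nabla n s ` forms n (KK) (n - 1) = top_form ` exact"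
  proof
    show "nabla n s ` forms n (KK) (n - 1) \<subseteq> top_form ` exact"
    proof
      fix \<beta>
      assume "\<beta> \<in> nabla n s ` forms n (KK) (n - 1)"
      then obtain \<alpha> where \<alpha>: "\<alpha> \<in> forms n (KK) (n - 1)" "\<beta> = nabla n s \<alpha>"
        by blast
      show "\<beta> \<in> top_form ` exact"
        unfolding \<alpha>(2) kz[OF \<alpha>(1)] by (intro imageI exactI S.R_mult sg_R forms_R[OF \<alpha>(1)])
    qed
    show "top_form ` exact \<subseteq> nabla n s ` forms n (KK) (n - 1)"
    proof
      fix \<beta>
      assume "\<beta> \<in> top_form ` exact"
      then obtain b where b: "\<And>i. i \<in> {1..n} \<Longrightarrow> b i \<in> S.R n"
        and \<beta>: "\<beta> = top_form (\<Sum>i\<in>{1..n}. ratfun_deriv i (b i) + S.log_coeff i * b i)"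
        unfolding exact_def by blast
      \<comment> \<open>The complement of an index set of size \<open>n - 1\<close> has a single
        element; summing over it avoids naming that element.\<close>
      define \<alpha> where "\<alpha> I = (if I \<subseteq> {1..n} \<and> card I = n - 1
        then \<Sum>i\<in>{1..n} - I. sg i * b i else 0)" for I
      have \<alpha>: "\<alpha> \<in> forms n (KK) (n - 1)"
        unfolding forms_def ring_eq \<alpha>_def by (auto intro!: S.R_sum S.R_mult sg_R b)
      have "\<alpha> ({1..n} - {j}) = sg j * b j" if "j \<in> {1..n}" for j
      proof -
        have "{1..n} - ({1..n} - {j}) = {j}"
          using that by auto
        then show ?thesis
          using that by (simp add: \<alpha>_def)
      qed
      then have sb: "sg j * \<alpha> ({1..n} - {j}) = b j" if "j \<in> {1..n}" for j
        using that by (simp only: mult.assoc[symmetric] sg2 mult_1)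
      have "nabla n s \<alpha> = \<beta>"
        unfolding kz[OF \<alpha>] \<beta>
        by (rule arg_cong[of _ _ top_form], rule sum.cong[OF refl]) (simp only: sb)
      then show "\<beta> \<in> nabla n s ` forms n (KK) (n - 1)"
        using \<alpha> by blast
    qed
  qed
  then show ?thesis
    using False by (simp add: dR_coboundaries_def dR_forms_def)
qed


section \<open>Cell forms as Parke-Taylor functions\<close>

lemma chain_prod_map:
  "S.chain_prod (map g [0..<Suc m]) = (\<Prod>k=1..m. 1 / (coord n (g k) - coord n (g (k - 1))))"
proof (induction m)
  case (Suc m)
  have "map g [0..<Suc (Suc m)] = map g [0..<m] @ g m # [g (Suc m)]"
    by simp
  then have "S.chain_prod (map g [0..<Suc (Suc m)]) = S.chain_prod (map g [0..<m] @ [g m]) * S.chain_prod [g m, g (Suc m)]"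
    by (simp only: S.chain_prod_append[of "map g [0..<m]" "g m" "[g (Suc m)]"])
  also have "map g [0..<m] @ [g m] = map g [0..<Suc m]"
    by simp
  finally show ?case
    unfolding Suc.IH by simp
qed simp

lemma bij_betw_chain:
  "bij_betw (\<lambda>\<sigma>. map \<sigma> [1..<Suc n]) {\<sigma>. \<sigma> permutes {1..n}} (chain_lists n)"
proof (rule bij_betw_imageI)
  show "inj_on (\<lambda>\<sigma>. map \<sigma> [1..<Suc n]) {\<sigma>. \<sigma> permutes {1..n}}"
  proof (rule inj_onI)
    fix \<sigma> \<tau> :: "nat \<Rightarrow> nat"
    assume p: "\<sigma> \<in> {\<sigma>. \<sigma> permutes {1..n}}" "\<tau> \<in> {\<sigma>. \<sigma> permutes {1..n}}"
      and eq: "map \<sigma> [1..<Suc n] = map \<tau> [1..<Suc n]"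
    show "\<sigma> = \<tau>"
    proof
      fix i
      show "\<sigma> i = \<tau> i"
      proof (cases "i \<in> {1..n}")
        case True
        then have "i \<in> set [1..<Suc n]"
          by (auto simp: less_Suc_eq_le)
        then show ?thesis
          using eq unfolding map_eq_conv by blast
      next
        case False
        then show ?thesis
          using p permutes_not_in[of \<sigma> "{1..n}" i] permutes_not_in[of \<tau> "{1..n}" i]
          by simp
      qed
    qed
  qed
  show "(\<lambda>\<sigma>. map \<sigma> [1..<Suc n]) ` {\<sigma>. \<sigma> permutes {1..n}} = chain_lists n"
  proof
    show "(\<lambda>\<sigma>. map \<sigma> [1..<Suc n]) ` {\<sigma>. \<sigma> permutes {1..n}} \<subseteq> chain_lists n"
    proof
      fix xs
      assume "xs \<in> (\<lambda>\<sigma>. map \<sigma> [1..<Suc n]) ` {\<sigma>. \<sigma> permutes {1..n}}"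
      then obtain \<sigma> where \<sigma>: "\<sigma> permutes {1..n}" "xs = map \<sigma> [1..<Suc n]"
        by blast
      have "{1..<Suc n} = {1..n}"
        by auto
      then show "xs \<in> chain_lists n"
        using permutes_image[OF \<sigma>(1)] permutes_inj_on[OF \<sigma>(1)]
        by (simp only: chain_lists_def \<sigma>(2) distinct_map distinct_upt set_map set_upt mem_Collect_eq simp_thms)
    qed
    show "chain_lists n \<subseteq> (\<lambda>\<sigma>. map \<sigma> [1..<Suc n]) ` {\<sigma>. \<sigma> permutes {1..n}}"
    proof
      fix xs
      assume xs: "xs \<in> chain_lists n"
      define \<sigma> where "\<sigma> i = (if i \<in> {1..n} then xs ! (i - 1) else i)" for i
      have len: "length xs = n"
        by (rule chain_lists_length[OF xs])
      have set: "set xs = {1..n}"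
        using xs by (simp add: chain_lists_def)
      have map: "map \<sigma> [1..<Suc n] = xs"
      proof (rule nth_equalityI)
        show "length (map \<sigma> [1..<Suc n]) = length xs"
          by (simp add: len del: upt_Suc)
        fix i
        assume "i < length (map \<sigma> [1..<Suc n])"
        then have "i < n"
          by (simp del: upt_Suc)
        then show "map \<sigma> [1..<Suc n] ! i = xs ! i"
          by (simp add: \<sigma>_def del: upt_Suc)
      qed
      have "bij_betw \<sigma> {1..n} {1..n}"
      proof (rule bij_betw_imageI)
        have "{1..<Suc n} = {1..n}"
          by auto
        then show "\<sigma> ` {1..n} = {1..n}"
          using arg_cong[OF map, of List.set] by (simp only: set_map set_upt set)
        then show "inj_on \<sigma> {1..n}"
          by (intro eq_card_imp_inj_on) auto
      qed
      then have "\<sigma> permutes {1..n}"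
        by (rule bij_imp_permutes) (unfold \<sigma>_def, rule if_not_P)
      then show "xs \<in> (\<lambda>\<sigma>. map \<sigma> [1..<Suc n]) ` {\<sigma>. \<sigma> permutes {1..n}}"
        using map by blast
    qed
  qed
qed

lemma cell_form_top:
  assumes "\<sigma> permutes {1..n}"
  shows "cell_form n \<sigma> = top_form (S.PT (map \<sigma> [1..<Suc n]))"
proof -
  have "\<sigma> 0 = 0" "\<sigma> (Suc n) = Suc n"
    using permutes_not_in[OF assms] by auto
  moreover have "[0..<Suc (Suc n)] = (0 # [1..<Suc n]) @ [Suc n]"
    using upt_Suc_append[of 0 "Suc n"] upt_conv_Cons[of 0 "Suc n"] by simp
  ultimately have "S.closed_chain (map \<sigma> [1..<Suc n]) = map \<sigma> [0..<Suc (Suc n)]"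
    by (simp only: S.closed_chain_def map_append list.map append_Cons)
  then have "S.PT (map \<sigma> [1..<Suc n]) = (\<Prod>k=1..Suc n. 1 / (coord n (\<sigma> k) - coord n (\<sigma> (k - 1))))"
    unfolding S.PT_def by (simp only: chain_prod_map)
  also have "\<dots> = 1 / (\<Prod>k=1..n+1. coord n (\<sigma> k) - coord n (\<sigma> (k - 1)))"
    by (simp add: prod_dividef del: prod.cl_ivl_Suc)
  finally show ?thesis
    by (simp only: cell_form_def top_form_def)
qed

section \<open>Top cohomology as functions modulo \<open>exact\<close>\<close>

definition top_class :: "cratfun \<Rightarrow> dform set" where
  "top_class a = dR_class n s n (top_form a)"

lemma top_form_add: "(\<lambda>I. top_form a I + top_form b I) = top_form (a + b)"
  by (auto simp: top_form_def)

lemma top_form_scale: "(\<lambda>I. c * top_form b I) = top_form (c * b)"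
  by (auto simp: top_form_def)

lemma top_class_eq_image: "top_class a = (\<lambda>h. top_form (h + a)) ` exact"
  unfolding top_class_def dR_class_def a_r_coset_def' coboundaries_top
  by (auto simp: dR_forms_def top_form_add)

lemma top_class_eq_iff: "top_class a = top_class b \<longleftrightarrow> a - b \<in> exact"
proof
  assume "top_class a = top_class b"
  then have "top_form a \<in> top_class b"
    unfolding top_class_eq_image using exact_0 by force
  then obtain h where "h \<in> exact" "a = h + b"
    unfolding top_class_eq_image by (auto simp: top_form_inj)
  then show "a - b \<in> exact"
    by simp
next
  assume ab: "a - b \<in> exact"
  have "top_class a \<subseteq> top_class b" if ab: "a - b \<in> exact" for a b
  proof
    fix \<beta>
    assume "\<beta> \<in> top_class a"
    then obtain h where h: "h \<in> exact" "\<beta> = top_form (h + a)"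
      unfolding top_class_eq_image by blast
    have "\<beta> = top_form ((h + (a - b)) + b)"
      by (simp add: h(2))
    then show "\<beta> \<in> top_class b"
      unfolding top_class_eq_image using exact_add[OF h(1) ab] by blast
  qed
  then show "top_class a = top_class b"
    using ab exact_uminus[OF ab] by (metis minus_diff_eq subset_antisym)
qed

lemma V_carrier: "carrier HH = top_class ` S.R n"
  by (simp add: dR_cohomology_def cocycles_top image_image top_class_def)

lemma V_zero: "\<zero>\<^bsub>HH\<^esub> = top_class 0"
  by (simp add: dR_cohomology_def coboundaries_top top_class_eq_image)

lemma V_add: "top_class a \<oplus>\<^bsub>HH\<^esub> top_class b = top_class (a + b)"
proof -
  have "top_class a \<oplus>\<^bsub>HH\<^esub> top_class b = (\<Union>h\<in>exact. \<Union>h'\<in>exact. {top_form ((h + a) + (h' + b))})"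
    by (simp add: dR_cohomology_def set_add_def' top_class_eq_image dR_forms_def top_form_add)
  also have "\<dots> = (\<lambda>h. top_form (h + (a + b))) ` exact"
  proof
    show "(\<Union>h\<in>exact. \<Union>h'\<in>exact. {top_form ((h + a) + (h' + b))}) \<subseteq> (\<lambda>h. top_form (h + (a + b))) ` exact"
    proof clarify
      fix h h'
      assume "h \<in> exact" "h' \<in> exact"
      then have "h + h' \<in> exact"
        by (rule exact_add)
      moreover have "h + a + (h' + b) = (h + h') + (a + b)"
        by simp
      ultimately show "top_form (h + a + (h' + b)) \<in> (\<lambda>h. top_form (h + (a + b))) ` exact"
        by (simp only:) (rule imageI)
    qed
    show "(\<lambda>h. top_form (h + (a + b))) ` exact \<subseteq> (\<Union>h\<in>exact. \<Union>h'\<in>exact. {top_form ((h + a) + (h' + b))})"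
    proof clarify
      fix h
      assume "h \<in> exact"
      moreover have "top_form (h + (a + b)) = top_form ((h + a) + (0 + b))"
        by (simp add: add.assoc)
      ultimately show "top_form (h + (a + b)) \<in> (\<Union>h\<in>exact. \<Union>h'\<in>exact. {top_form ((h + a) + (h' + b))})"
        using exact_0 by blast
    qed
  qed
  finally show ?thesis
    by (simp only: top_class_eq_image)
qed

text \<open>The product is a union of classes over all representatives. These classes coincide
  because \<open>exact\<close> is stable under scalars, and the union is not empty because
  \<open>exact\<close> contains 0.\<close>

lemma V_smult:
  assumes c: "c \<in> KK"
  shows "c \<odot>\<^bsub>HH\<^esub> top_class a = top_class (ratfun_const c * a)"
proof -
  have "c \<odot>\<^bsub>HH\<^esub> top_class a = (\<Union>h\<in>exact. top_class (ratfun_const c * (h + a)))"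
    by (simp add: dR_cohomology_def top_class_eq_image[of a] dR_forms_def top_form_scale flip: top_class_def)
  also have "\<dots> = (\<Union>h\<in>exact. top_class (ratfun_const c * a))"
  proof (rule SUP_cong)
    fix h
    assume "h \<in> exact"
    then show "top_class (ratfun_const c * (h + a)) = top_class (ratfun_const c * a)"
      unfolding top_class_eq_iff using exact_scale[OF c] by (simp add: algebra_simps)
  qed simp
  also have "\<dots> = top_class (ratfun_const c * a)"
    using exact_0 by blast
  finally show ?thesis .
qed

lemma const_R: "c \<in> KK \<Longrightarrow> ratfun_const c \<in> S.R n"
  by (rule S.R_const) (rule imageI)

lemma vectorspace_V: "vectorspace (Q_dR n s) HH"
proof -
  interpret Q: field "Q_dR n s"
    by (rule field_Q_dR)
  have "abelian_group HH"
  proof (rule abelian_groupI)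
    fix x y z
    assume "x \<in> carrier HH"
    then obtain a where a: "a \<in> S.R n" "x = top_class a"
      unfolding V_carrier by blast
    show "\<zero>\<^bsub>HH\<^esub> \<oplus>\<^bsub>HH\<^esub> x = x"
      by (simp add: a(2) V_zero V_add)
    have "top_class (- a) \<oplus>\<^bsub>HH\<^esub> x = \<zero>\<^bsub>HH\<^esub>"
      by (simp add: a(2) V_zero V_add)
    then show "\<exists>y\<in>carrier HH. y \<oplus>\<^bsub>HH\<^esub> x = \<zero>\<^bsub>HH\<^esub>"
      unfolding V_carrier using S.R_uminus[OF a(1)] by blast
    assume "y \<in> carrier HH"
    then obtain b where b: "b \<in> S.R n" "y = top_class b"
      unfolding V_carrier by blast
    show "x \<oplus>\<^bsub>HH\<^esub> y \<in> carrier HH"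
      unfolding V_carrier a(2) b(2) V_add using S.R_add[OF a(1) b(1)] by (rule imageI)
    show "x \<oplus>\<^bsub>HH\<^esub> y = y \<oplus>\<^bsub>HH\<^esub> x"
      by (simp add: a(2) b(2) V_add add.commute)
    assume "z \<in> carrier HH"
    then obtain c where c: "z = top_class c"
      unfolding V_carrier by blast
    show "x \<oplus>\<^bsub>HH\<^esub> y \<oplus>\<^bsub>HH\<^esub> z =
        x \<oplus>\<^bsub>HH\<^esub> (y \<oplus>\<^bsub>HH\<^esub> z)"
      by (simp add: a(2) b(2) c V_add add.assoc)
  next
    show "\<zero>\<^bsub>HH\<^esub> \<in> carrier HH"
      unfolding V_carrier V_zero by (intro imageI S.R_0)
  qed
  moreover have "module_axioms (Q_dR n s) HH"
  proof
    fix c d x y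
    assume c: "c \<in> KK" and x: "x \<in> carrier HH"
    from x obtain a where a: "a \<in> S.R n" "x = top_class a"
      unfolding V_carrier by blast
    show "c \<odot>\<^bsub>HH\<^esub> x \<in> carrier HH"
      unfolding V_carrier a(2) V_smult[OF c] by (intro imageI S.R_mult const_R c a(1))
    {
      assume d: "d \<in> KK"
      have cd: "c + d \<in> KK" "c * d \<in> KK"
        using Q.a_closed[OF c d] Q.m_closed[OF c d] by simp_all
      show "(c \<oplus>\<^bsub>Q_dR n s\<^esub> d) \<odot>\<^bsub>HH\<^esub> x =
          c \<odot>\<^bsub>HH\<^esub> x \<oplus>\<^bsub>HH\<^esub> d \<odot>\<^bsub>HH\<^esub> x"
        by (simp add: a(2) V_smult c d cd V_add ratfun_const_add distrib_right)
      show "(c \<otimes>\<^bsub>Q_dR n s\<^esub> d) \<odot>\<^bsub>HH\<^esub> x =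
          c \<odot>\<^bsub>HH\<^esub> (d \<odot>\<^bsub>HH\<^esub> x)"
        by (simp add: a(2) V_smult c d cd ratfun_const_mult mult.assoc)
    }
    assume "y \<in> carrier HH"
    then obtain b where b: "y = top_class b"
      unfolding V_carrier by blast
    show "c \<odot>\<^bsub>HH\<^esub> (x \<oplus>\<^bsub>HH\<^esub> y) =
        c \<odot>\<^bsub>HH\<^esub> x \<oplus>\<^bsub>HH\<^esub> c \<odot>\<^bsub>HH\<^esub> y"
      by (simp add: a(2) b V_smult c V_add distrib_left)
  next
    fix x
    assume "x \<in> carrier HH"
    then obtain a where a: "x = top_class a"
      unfolding V_carrier by blast
    show "\<one>\<^bsub>Q_dR n s\<^esub> \<odot>\<^bsub>HH\<^esub> x = x"
      using V_smult[of 1 a] Q.one_closed by (simp add: a)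
  qed
  ultimately show ?thesis
    by (intro vectorspace.intro Module.module.intro Q.is_cring field_Q_dR)
qed

section \<open>The classes of the cell forms are a basis\<close>

definition cell :: "nat list \<Rightarrow> dform set" where
  "cell ys = top_class (S.PT ys)"

lemma cell_carrier: "ys \<in> chain_lists n \<Longrightarrow> cell ys \<in> carrier HH"
  unfolding cell_def V_carrier by (intro imageI S.PT_R order_refl)

text \<open>Stated for subsets \<open>F\<close> because a linear dependence is witnessed by some
  finite subset; the coefficients are extended by 0 to all chains.\<close>

lemma cells_independent:
  assumes "F \<subseteq> chain_lists n" "\<And>ys. ys \<in> F \<Longrightarrow> c ys \<in> KK"
    and "(\<Sum>ys\<in>F. ratfun_const (c ys) * S.PT ys) \<in> exact" "ys \<in> F"
  shows "c ys = 0"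
proof -
  define c' where "c' ys = (if ys \<in> F then ratfun_const (c ys) else 0)" for ys
  obtain b where b: "\<forall>i\<in>{1..n}. b i \<in> S.R n"
    "(\<Sum>ys\<in>F. ratfun_const (c ys) * S.PT ys) = (\<Sum>i\<in>{1..n}. ratfun_deriv i (b i) + S.log_coeff i * b i)"
    using assms(3) unfolding exact_def by blast
  have "(\<Sum>ys\<in>chain_lists n. c' ys * S.PT ys) = (\<Sum>ys\<in>F. ratfun_const (c ys) * S.PT ys)"
    by (rule sum.mono_neutral_cong_right) (use assms(1) finite_chain_lists in \<open>auto simp: c'_def\<close>)
  moreover have "c' ys \<in> ratfun_const ` KK" for ys
    using assms(2) S.K_0 by (simp add: c'_def)
  ultimately have "c' ys = 0"
    using S.scalar_PT_independent[of c' b ys] b assms(1,4) by auto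
  then show ?thesis
    using assms(4) ratfun_const_inj[of "c ys" 0] by (simp add: c'_def)
qed

text \<open>Two equal classes would give an exact combination with coefficients 1 and -1, contrary
  to independence.\<close>

lemma cell_inj: "inj_on cell (chain_lists n)"
proof (rule inj_onI, rule ccontr)
  fix ys zs
  assume ys: "ys \<in> chain_lists n" and zs: "zs \<in> chain_lists n" and eq: "cell ys = cell zs" and "ys \<noteq> zs"
  have 1: "1 \<in> KK" "- 1 \<in> KK"
    using subfield_set_Q_dR[of n s] by (auto simp: subfield_set_def)
  have "S.PT ys - S.PT zs \<in> exact"
    using eq unfolding cell_def top_class_eq_iff .
  then have "(\<Sum>xs\<in>{ys, zs}. ratfun_const (if xs = ys then 1 else - 1) * S.PT xs) \<in> exact"
    using \<open>ys \<noteq> zs\<close> by (simp add: ratfun_const_uminus)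
  then have "(if ys = ys then 1 else - 1 :: complex) = 0"
    using ys zs 1 by (intro cells_independent[of "{ys, zs}" "\<lambda>xs. if xs = ys then 1 else - 1"]) auto
  then show False
    by simp
qed

theorem cells_basis:
  "vectorspace.basis (Q_dR n s) HH (cell ` chain_lists n)"
proof -
  interpret V: vectorspace "Q_dR n s" "HH"
    by (rule vectorspace_V)
  \<comment> \<open>Reindexing by chains relies on \<open>cell_inj\<close>. A combination of classes
    is thus a single class, and dependence and spanning become statements about functions modulo
    \<open>exact\<close>.\<close>
  have chain_sum: "V.lincomb a (cell ` F) = top_class (\<Sum>ys\<in>F. ratfun_const (a (cell ys)) * S.PT ys)"
    if F: "F \<subseteq> chain_lists n" and a: "\<And>ys. ys \<in> F \<Longrightarrow> a (cell ys) \<in> KK" for a F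
  proof -
    have fin: "finite F"
      by (rule finite_subset[OF F finite_chain_lists])
    have "V.lincomb a (cell ` F) = (\<Oplus>\<^bsub>HH\<^esub>ys\<in>F. a (cell ys) \<odot>\<^bsub>HH\<^esub> cell ys)"
      unfolding V.lincomb_def using F a cell_carrier
      by (intro V.M.finsum_reindex inj_on_subset[OF cell_inj F]) (auto intro!: V.smult_closed)
    also have "\<dots> = top_class (\<Sum>ys\<in>F. ratfun_const (a (cell ys)) * S.PT ys)"
      using fin F a
    proof (induction F rule: finite_induct)
      case (insert ys F)
      have "(\<Oplus>\<^bsub>HH\<^esub>ys\<in>insert ys F. a (cell ys) \<odot>\<^bsub>HH\<^esub> cell ys) =
          a (cell ys) \<odot>\<^bsub>HH\<^esub> cell ys \<oplus>\<^bsub>HH\<^esub>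
          (\<Oplus>\<^bsub>HH\<^esub>ys\<in>F. a (cell ys) \<odot>\<^bsub>HH\<^esub> cell ys)"
        using insert cell_carrier by (intro V.M.finsum_insert) (auto intro!: V.smult_closed)
      then show ?case
        using insert by (simp add: cell_def V_smult V_add)
    qed (simp add: V_zero)
    finally show ?thesis .
  qed
  have "V.lin_indpt (cell ` chain_lists n)"
  proof
    assume "V.lin_dep (cell ` chain_lists n)"
    then obtain A a v where A: "finite A" "A \<subseteq> cell ` chain_lists n" "a \<in> A \<rightarrow> KK"
      "V.lincomb a A = \<zero>\<^bsub>HH\<^esub>" "v \<in> A" "a v \<noteq> \<zero>\<^bsub>Q_dR n s\<^esub>"
      unfolding V.lin_dep_def by blast
    define F where "F = {ys \<in> chain_lists n. cell ys \<in> A}"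
    have F: "F \<subseteq> chain_lists n" "A = cell ` F"
      using A(2) by (auto simp: F_def)
    have aF: "a (cell ys) \<in> KK" if "ys \<in> F" for ys
      using A(3) that by (auto simp: F_def)
    have "top_class (\<Sum>ys\<in>F. ratfun_const (a (cell ys)) * S.PT ys) = top_class 0"
      using A(4) chain_sum[of F a, OF F(1) aF] unfolding F(2) V_zero by simp
    then have "(\<Sum>ys\<in>F. ratfun_const (a (cell ys)) * S.PT ys) \<in> exact"
      unfolding top_class_eq_iff by simp
    then have "a (cell ys) = 0" if "ys \<in> F" for ys
      using cells_independent[OF F(1), of "\<lambda>ys. a (cell ys)"] aF that by blast
    then show False
      using A(5,6) F(2) by auto
  qed
  moreover have "V.span (cell ` chain_lists n) = carrier HH"
  proof
    have sub: "cell ` chain_lists n \<subseteq> carrier HH"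
      using cell_carrier by blast
    show "V.span (cell ` chain_lists n) \<subseteq> carrier HH"
      by (rule V.span_is_subset2[OF sub])
    show "carrier HH \<subseteq> V.span (cell ` chain_lists n)"
    proof
      fix x
      assume "x \<in> carrier HH"
      then obtain r where r: "r \<in> S.R n" "x = top_class r"
        unfolding V_carrier by blast
      obtain c b where cb: "\<forall>ys\<in>chain_lists n. c ys \<in> ratfun_const ` KK"
        "\<forall>i\<in>{1..n}. b i \<in> S.R n"
        "r = (\<Sum>ys\<in>chain_lists n. c ys * S.PT ys) + (\<Sum>i\<in>{1..n}. ratfun_deriv i (b i) + S.log_coeff i * b i)"
        using S.scalar_PT_spanning[OF r(1)] by blast
      \<comment> \<open>The coefficients come as constant functions; their preimages are the scalars
        of the vector space.\<close>
      define c' where "c' ys = inv_into (KK) ratfun_const (c ys)" for ys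
      have c': "c' ys \<in> KK" "c ys = ratfun_const (c' ys)" if "ys \<in> chain_lists n" for ys
      proof -
        have im: "c ys \<in> ratfun_const ` KK"
          using cb(1) that by blast
        show "c' ys \<in> KK"
          unfolding c'_def by (rule inv_into_into[OF im])
        show "c ys = ratfun_const (c' ys)"
          unfolding c'_def by (simp only: f_inv_into_f[OF im])
      qed
      define a where "a v = c' (the_inv_into (chain_lists n) cell v)" for v
      have a: "a (cell ys) = c' ys" if "ys \<in> chain_lists n" for ys
        unfolding a_def using the_inv_into_f_f[OF cell_inj that] by simp
      have "V.lincomb a (cell ` chain_lists n) = top_class (\<Sum>ys\<in>chain_lists n. ratfun_const (a (cell ys)) * S.PT ys)"
        by (rule chain_sum) (use a c'(1) in auto)
      also have "(\<Sum>ys\<in>chain_lists n. ratfun_const (a (cell ys)) * S.PT ys) = (\<Sum>ys\<in>chain_lists n. c ys * S.PT ys)"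
        by (rule sum.cong) (use a c'(2) in auto)
      also have "top_class \<dots> = x"
        unfolding r(2) top_class_eq_iff cb(3) using exact_uminus[OF exactI[of b]] cb(2) by simp
      finally have "x = V.lincomb a (cell ` chain_lists n)" ..
      moreover have "a \<in> cell ` chain_lists n \<rightarrow> KK"
        using a c'(1) by auto
      ultimately show "x \<in> V.span (cell ` chain_lists n)"
        unfolding V.span_def using finite_chain_lists by blast
    qed
  qed
  ultimately show ?thesis
    unfolding V.basis_def using cell_carrier by blast
qed

lemma class_cell_form:
  "\<sigma> permutes {1..n} \<Longrightarrow> dR_class n s n (cell_form n \<sigma>) = cell (map \<sigma> [1..<Suc n])"
  by (simp only: cell_form_top cell_def top_class_def)

lemma class_cell_form_inj: "inj_on (\<lambda>\<sigma>. dR_class n s n (cell_form n \<sigma>)) {\<sigma>. \<sigma> permutes {1..n}}"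
proof -
  have "inj_on (cell \<circ> (\<lambda>\<sigma>. map \<sigma> [1..<Suc n])) {\<sigma>. \<sigma> permutes {1..n}}"
    using bij_betw_chain cell_inj by (intro comp_inj_on) (simp_all only: bij_betw_def)
  then show ?thesis
    by (rule inj_on_cong[THEN iffD1, rotated]) (simp add: class_cell_form)
qed

lemma class_cell_form_image:
  "(\<lambda>\<sigma>. dR_class n s n (cell_form n \<sigma>)) ` {\<sigma>. \<sigma> permutes {1..n}} = cell ` chain_lists n"
proof -
  have "(\<lambda>\<sigma>. dR_class n s n (cell_form n \<sigma>)) ` {\<sigma>. \<sigma> permutes {1..n}} =
      cell ` (\<lambda>\<sigma>. map \<sigma> [1..<Suc n]) ` {\<sigma>. \<sigma> permutes {1..n}}"
    unfolding image_image by (rule image_cong) (auto simp only: class_cell_form mem_Collect_eq)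
  then show ?thesis
    by (simp only: bij_betw_imp_surj_on[OF bij_betw_chain])
qed

end

text \<open>A basis in the sense of \<open>vectorspace.basis\<close> is a set. Injectivity is stated
  beside it so that distinct permutations give distinct basis elements.\<close>

theorem theorem6p10:
  fixes n :: nat and s :: "nat \<Rightarrow> nat \<Rightarrow> complex"
  assumes "admissible n s"
    and "generic n s"
  shows "vectorspace (Q_dR n s) (dR_cohomology n s n) \<and>
    inj_on (\<lambda>\<sigma>. dR_class n s n (cell_form n \<sigma>)) {\<sigma>. \<sigma> permutes {1..n}} \<and>
    vectorspace.basis (Q_dR n s) (dR_cohomology n s n)
      ((\<lambda>\<sigma>. dR_class n s n (cell_form n \<sigma>)) ` {\<sigma>. \<sigma> permutes {1..n}})"
  unfolding class_cell_form_image[OF assms]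
  using vectorspace_V[OF assms] class_cell_form_inj[OF assms] cells_basis[OF assms] by blast

end
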